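(* Let $k$ be a field, $C$ a $k$-coalgebra, $\mathcal{A}$ a $C$-ring and $\kappa:\mathcal{A}\to k$ a character in $\mathcal{A}$. Let $\bar{\mathcal{A}}=\mathrm{coker}\,\eta_{\mathcal{A}}$, let $\pi:\mathcal{A}\to\bar{\mathcal{A}}$ be the canonical surjection, and let $\lambda_1:\bar{\mathcal{A}}\to C$ and $\lambda_2:\bar{\mathcal{A}}\square_C\bar{\mathcal{A}}\to\bar{\mathcal{A}}$ be the $k$-linear maps determined by $$\lambda_1\circ\pi=(\kappa\otimes \mathrm{id}_C)\circ\varrho^{\mathcal{A}}-(\mathrm{id}_C\otimes\kappa)\circ{}^{\mathcal{A}}\!\varrho,\qquad \lambda_2\circ(\pi\square_C\pi)=\kappa\square_C\pi-\pi\circ\mu_{\mathcal{A}}+\pi\square_C\kappa .$$ Then for any right $C$-comodule $M$, the formula $$\varrho_M=\nabla\circ(\mathrm{id}_M\square_C\pi)+\mathrm{id}_M\square_C\kappa$$ gives a bijective correspondence between right $\mathcal{A}$-actions $\varrho_M:M\square_C\mathcal{A}\to M$ on $M$ and flat connections $\nabla:M\square_C\bar{\mathcal{A}}\to M$ in $M$ with respect to $(\bar{\mathcal{A}},\lambda)$, where $\lambda=(\lambda_1,\lambda_2)$.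
   Context: $k$ is a field and $C$ is a $k$-coalgebra with coproduct $\Delta$ and counit $\varepsilon$; $\otimes$ is over $k$. Cotensor product: for a right $C$-comodule $(M,\varrho^M)$ and a left $C$-comodule $(N,{}^N\!\varrho)$, $M\square_C N=\ker(\mathrm{id}_M\otimes{}^N\!\varrho-\varrho^M\otimes \mathrm{id}_N)\subseteq M\otimes N$. For $k$-linear maps $f:M\to M'$, $g:N\to N'$, $f\square_C g$ denotes the restriction of $f\otimes g$ to $M\square_C N$. A $C$-bicomodule is a vector space with commuting left and right $C$-coactions; the category of $C$-bicomodules is monoidal with product $\square_C$ and unit $C$, with $M\square_C C\simeq M$ and $C\square_C N\simeq N$ via the coactions and counit. If $N$ is a $C$-bicomodule, $M\square_C N$ is a right $C$-comodule with coaction $\mathrm{id}_M\square_C\varrho^N$. A $C$-ring is a monoid $(\mathcal{A},\mu_{\mathcal{A}},\eta_{\mathcal{A}})$ in the monoidal category of $C$-bicomodules: $\mathcal{A}$ is a $C$-bicomodule with coactions ${}^{\mathcal{A}}\!\varrho:\mathcal{A}\to C\otimes\mathcal{A}$, $\varrho^{\mathcal{A}}:\mathcal{A}\to\mathcal{A}\otimes C$, and $\mu_{\mathcal{A}}:\mathcal{A}\square_C\mathcal{A}\to\mathcal{A}$, $\eta_{\mathcal{A}}:C\to\mathcal{A}$ are $C$-bicomodule maps with $\mu_{\mathcal{A}}\circ(\mu_{\mathcal{A}}\square_C\mathrm{id})=\mu_{\mathcal{A}}\circ(\mathrm{id}\square_C\mu_{\mathcal{A}})$, $\mu_{\mathcal{A}}\circ(\mathrm{id}\square_C\eta_{\mathcal{A}})\circ\varrho^{\mathcal{A}}=\mathrm{id}_{\mathcal{A}}=\mu_{\mathcal{A}}\circ(\eta_{\mathcal{A}}\square_C\mathrm{id})\circ{}^{\mathcal{A}}\!\varrho$.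 A character in $\mathcal{A}$ is a $k$-linear map $\kappa:\mathcal{A}\to k$ with $\kappa\circ\mu_{\mathcal{A}}=\kappa\square_C\kappa$ and $\kappa\circ\eta_{\mathcal{A}}=\varepsilon$. A right $\mathcal{A}$-action on a right $C$-comodule $(M,\varrho^M)$ is a right $C$-comodule map $\varrho_M:M\square_C\mathcal{A}\to M$ with $\varrho_M\circ(\varrho_M\square_C\mathrm{id}_{\mathcal{A}})=\varrho_M\circ(\mathrm{id}_M\square_C\mu_{\mathcal{A}})$ and $\varrho_M\circ(\mathrm{id}_M\square_C\eta_{\mathcal{A}})\circ\varrho^M=\mathrm{id}_M$. $\bar{\mathcal{A}}$ is a $C$-bicomodule with the coactions induced from those of $\mathcal{A}$ via $\pi$; the map $\pi\square_C\pi:\mathcal{A}\square_C\mathcal{A}\to\bar{\mathcal{A}}\square_C\bar{\mathcal{A}}$ is surjective, and $\lambda_1,\lambda_2$ are well defined. A connection in a right $C$-comodule $M$ with respect to $(\bar{\mathcal{A}},\lambda)$ is a $k$-linear map $\nabla:M\square_C\bar{\mathcal{A}}\to M$ such that $\varrho^M\circ\nabla=(\nabla\otimes\mathrm{id}_C)\circ(\mathrm{id}_M\square_C\varrho^{\bar{\mathcal{A}}})+\mathrm{id}_M\square_C\lambda_1$. The map $\nabla_\lambda=\nabla\square_C\mathrm{id}_{\bar{\mathcal{A}}}+\mathrm{id}_M\square_C\lambda_2$ on $M\square_C\bar{\mathcal{A}}\square_C\bar{\mathcal{A}}$ takes values in $M\square_C\bar{\mathcal{A}}$; the curvature of $\nabla$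 is $F_\nabla=\nabla\circ\nabla_\lambda:M\square_C\bar{\mathcal{A}}\square_C\bar{\mathcal{A}}\to M$, and $\nabla$ is flat if $F_\nabla=0$. *)

theory Defs
  imports "HOL-Algebra.Module" "HOL-Algebra.QuotRing"
begin

(* Vector spaces over a field K are HOL-Algebra modules over K. The fields "mult" and "one" which
   the module record inherits from rings play no role and are left undefined in the constructions
   below. *)

definition linear_map ::
  "('k, 'x) ring_scheme \<Rightarrow> ('k, 'v, 'y) module_scheme \<Rightarrow> ('k, 'w, 'z) module_scheme \<Rightarrow> ('v \<Rightarrow> 'w) \<Rightarrow> bool"
  where "linear_map K V W f \<longleftrightarrow>
    f \<in> carrier V \<rightarrow> carrier W \<and>
    (\<forall>x\<in>carrier V. \<forall>y\<in>carrier V. f (x \<oplus>\<^bsub>V\<^esub> y) = f x \<oplus>\<^bsub>W\<^esub> f y) \<and>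
    (\<forall>a\<in>carrier K. \<forall>x\<in>carrier V. f (a \<odot>\<^bsub>V\<^esub> x) = a \<odot>\<^bsub>W\<^esub> f x)"

definition self_module :: "('k, 'x) ring_scheme \<Rightarrow> ('k, 'k) module"
  where "self_module K = \<lparr>carrier = carrier K, mult = undefined, one = undefined,
    zero = \<zero>\<^bsub>K\<^esub>, add = add K, smult = mult K\<rparr>"

definition quot_module :: "('k, 'v, 'y) module_scheme \<Rightarrow> 'v set \<Rightarrow> ('k, 'v set) module"
  where "quot_module V H = \<lparr>carrier = a_rcosets\<^bsub>V\<^esub> H, mult = undefined, one = undefined,
    zero = H, add = set_add V, smult = (\<lambda>a X. \<Union>x\<in>X. H +>\<^bsub>V\<^esub> (a \<odot>\<^bsub>V\<^esub> x))\<rparr>"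

(* The free vector space on X, realised by finitely supported functions. *)
definition free_module :: "('k, 'x) ring_scheme \<Rightarrow> 'i set \<Rightarrow> ('k, 'i \<Rightarrow> 'k) module"
  where "free_module K X = \<lparr>
    carrier = {f. range f \<subseteq> carrier K \<and> {i. f i \<noteq> \<zero>\<^bsub>K\<^esub>} \<subseteq> X \<and> finite {i. f i \<noteq> \<zero>\<^bsub>K\<^esub>}},
    mult = undefined, one = undefined,
    zero = (\<lambda>i. \<zero>\<^bsub>K\<^esub>), add = (\<lambda>f g i. f i \<oplus>\<^bsub>K\<^esub> g i), smult = (\<lambda>a f i. a \<otimes>\<^bsub>K\<^esub> f i)\<rparr>"

definition free_gen :: "('k, 'x) ring_scheme \<Rightarrow> 'i \<Rightarrow> 'i \<Rightarrow> 'k"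
  where "free_gen K i = (\<lambda>j. if j = i then \<one>\<^bsub>K\<^esub> else \<zero>\<^bsub>K\<^esub>)"


section \<open>Tensor products\<close>

definition bilinear_relations ::
  "('k, 'x) ring_scheme \<Rightarrow> ('k, 'v, 'y) module_scheme \<Rightarrow> ('k, 'w, 'z) module_scheme \<Rightarrow> ('v \<times> 'w \<Rightarrow> 'k) set"
  where "bilinear_relations K V W =
   (let F = free_module K (carrier V \<times> carrier W); d = (\<lambda>v w. free_gen K (v, w)) in
      {d (v \<oplus>\<^bsub>V\<^esub> v') w \<ominus>\<^bsub>F\<^esub> (d v w \<oplus>\<^bsub>F\<^esub> d v' w) | v v' w.
         v \<in> carrier V \<and> v' \<in> carrier V \<and> w \<in> carrier W}
    \<union> {d v (w \<oplus>\<^bsub>W\<^esub> w') \<ominus>\<^bsub>F\<^esub> (d v w \<oplus>\<^bsub>F\<^esub> d v w') | v w w'.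
         v \<in> carrier V \<and> w \<in> carrier W \<and> w' \<in> carrier W}
    \<union> {d (a \<odot>\<^bsub>V\<^esub> v) w \<ominus>\<^bsub>F\<^esub> a \<odot>\<^bsub>F\<^esub> d v w | a v w.
         a \<in> carrier K \<and> v \<in> carrier V \<and> w \<in> carrier W}
    \<union> {d v (a \<odot>\<^bsub>W\<^esub> w) \<ominus>\<^bsub>F\<^esub> a \<odot>\<^bsub>F\<^esub> d v w | a v w.
         a \<in> carrier K \<and> v \<in> carrier V \<and> w \<in> carrier W})"

definition tensor_kernel ::
  "('k, 'x) ring_scheme \<Rightarrow> ('k, 'v, 'y) module_scheme \<Rightarrow> ('k, 'w, 'z) module_scheme \<Rightarrow> ('v \<times> 'w \<Rightarrow> 'k) set"
  where "tensor_kernel K V W =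
    \<Inter>{H. submodule H K (free_module K (carrier V \<times> carrier W)) \<and> bilinear_relations K V W \<subseteq> H}"

definition tensor ::
  "('k, 'x) ring_scheme \<Rightarrow> ('k, 'v, 'y) module_scheme \<Rightarrow> ('k, 'w, 'z) module_scheme
    \<Rightarrow> ('k, ('v \<times> 'w \<Rightarrow> 'k) set) module"
  where "tensor K V W =
    quot_module (free_module K (carrier V \<times> carrier W)) (tensor_kernel K V W)"

definition pure_tensor ::
  "('k, 'x) ring_scheme \<Rightarrow> ('k, 'v, 'y) module_scheme \<Rightarrow> ('k, 'w, 'z) module_scheme
    \<Rightarrow> 'v \<Rightarrow> 'w \<Rightarrow> ('v \<times> 'w \<Rightarrow> 'k) set"
  where "pure_tensor K V W v w =
    tensor_kernel K V W +>\<^bsub>free_module K (carrier V \<times> carrier W)\<^esub> free_gen K (v, w)"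

(* The linear map from a tensor product to P induced by a bilinear map b: an element t is a coset
   of formal linear combinations, and for bilinear b the value does not depend on the chosen
   representative. *)
definition tensor_lift ::
  "('k, 'x) ring_scheme \<Rightarrow> ('k, 'p, 'y) module_scheme \<Rightarrow> ('v \<Rightarrow> 'w \<Rightarrow> 'p) \<Rightarrow> ('v \<times> 'w \<Rightarrow> 'k) set \<Rightarrow> 'p"
  where "tensor_lift K P b t =
    (let c = (SOME c. c \<in> t) in
      \<Oplus>\<^bsub>P\<^esub>i\<in>{i. c i \<noteq> \<zero>\<^bsub>K\<^esub>}. c i \<odot>\<^bsub>P\<^esub> b (fst i) (snd i))"

(* tensor_map K V' W' f g is the tensor product of f and g, where V' and W' are the codomains
   of f and g. With f = g = id it is also used as the map induced by subspace inclusions. *)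
definition tensor_map ::
  "('k, 'x) ring_scheme \<Rightarrow> ('k, 'v2, 'y) module_scheme \<Rightarrow> ('k, 'w2, 'z) module_scheme
    \<Rightarrow> ('v \<Rightarrow> 'v2) \<Rightarrow> ('w \<Rightarrow> 'w2) \<Rightarrow> ('v \<times> 'w \<Rightarrow> 'k) set \<Rightarrow> ('v2 \<times> 'w2 \<Rightarrow> 'k) set"
  where "tensor_map K V' W' f g =
    tensor_lift K (tensor K V' W') (\<lambda>v w. pure_tensor K V' W' (f v) (g w))"

(* The canonical isomorphism from (U (x) V) (x) W to U (x) (V (x) W). *)
definition tensor_assoc ::
  "('k, 'x) ring_scheme \<Rightarrow> ('k, 'u, 'y1) module_scheme \<Rightarrow> ('k, 'v, 'y2) module_scheme
    \<Rightarrow> ('k, 'w, 'y3) module_scheme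
    \<Rightarrow> (('u \<times> 'v \<Rightarrow> 'k) set \<times> 'w \<Rightarrow> 'k) set \<Rightarrow> ('u \<times> ('v \<times> 'w \<Rightarrow> 'k) set \<Rightarrow> 'k) set"
  where "tensor_assoc K U V W =
   (let T = tensor K U (tensor K V W) in
      tensor_lift K T (\<lambda>t w. tensor_lift K T
        (\<lambda>u v. pure_tensor K U (tensor K V W) u (pure_tensor K V W v w)) t))"

(* The canonical isomorphisms from K (x) V and V (x) K to V. *)
definition left_unit ::
  "('k, 'x) ring_scheme \<Rightarrow> ('k, 'v, 'y) module_scheme \<Rightarrow> ('k \<times> 'v \<Rightarrow> 'k) set \<Rightarrow> 'v"
  where "left_unit K V = tensor_lift K V (\<lambda>a v. a \<odot>\<^bsub>V\<^esub> v)"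

definition right_unit ::
  "('k, 'x) ring_scheme \<Rightarrow> ('k, 'v, 'y) module_scheme \<Rightarrow> ('v \<times> 'k \<Rightarrow> 'k) set \<Rightarrow> 'v"
  where "right_unit K V = tensor_lift K V (\<lambda>v a. a \<odot>\<^bsub>V\<^esub> v)"


section \<open>Coalgebras and comodules\<close>

record ('k, 'c) coalg = "('k, 'c) module" +
  comult :: "'c \<Rightarrow> ('c \<times> 'c \<Rightarrow> 'k) set"
  counit :: "'c \<Rightarrow> 'k"

record ('k, 'v, 'c) rcomod = "('k, 'v) module" +
  rcoact :: "'v \<Rightarrow> ('v \<times> 'c \<Rightarrow> 'k) set"

record ('k, 'v, 'c) bicomod = "('k, 'v, 'c) rcomod" +
  lcoact :: "'v \<Rightarrow> ('c \<times> 'v \<Rightarrow> 'k) set"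

locale coalgebra =
  fixes K :: "('k, 'x) ring_scheme" and C :: "('k, 'c, 'y) coalg_scheme"
  assumes module: "module K C"
    and comult_linear: "linear_map K C (tensor K C C) (comult C)"
    and counit_linear: "linear_map K C (self_module K) (counit C)"
    and coassoc: "\<And>c. c \<in> carrier C \<Longrightarrow>
      tensor_assoc K C C C (tensor_map K (tensor K C C) C (comult C) id (comult C c)) =
      tensor_map K C (tensor K C C) id (comult C) (comult C c)"
    and counit_left: "\<And>c. c \<in> carrier C \<Longrightarrow>
      left_unit K C (tensor_map K (self_module K) C (counit C) id (comult C c)) = c"
    and counit_right: "\<And>c. c \<in> carrier C \<Longrightarrow>
      right_unit K C (tensor_map K C (self_module K) id (counit C) (comult C c)) = c"

locale right_comodule =
  fixes K :: "('k, 'x) ring_scheme" and C :: "('k, 'c, 'y) coalg_scheme"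
    and M :: "('k, 'v, 'c, 'z) rcomod_scheme"
  assumes module: "module K M"
    and rcoact_linear: "linear_map K M (tensor K M C) (rcoact M)"
    and rcoact_coassoc: "\<And>m. m \<in> carrier M \<Longrightarrow>
      tensor_assoc K M C C (tensor_map K (tensor K M C) C (rcoact M) id (rcoact M m)) =
      tensor_map K M (tensor K C C) id (comult C) (rcoact M m)"
    and rcoact_counit: "\<And>m. m \<in> carrier M \<Longrightarrow>
      right_unit K M (tensor_map K M (self_module K) id (counit C) (rcoact M m)) = m"

(* Only the module structure and lcoact of N are used here. *)
locale left_comodule =
  fixes K :: "('k, 'x) ring_scheme" and C :: "('k, 'c, 'y) coalg_scheme"
    and N :: "('k, 'v, 'c, 'z) bicomod_scheme"
  assumes module: "module K N"
    and lcoact_linear: "linear_map K N (tensor K C N) (lcoact N)"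
    and lcoact_coassoc: "\<And>n. n \<in> carrier N \<Longrightarrow>
      tensor_assoc K C C N (tensor_map K (tensor K C C) N (comult C) id (lcoact N n)) =
      tensor_map K C (tensor K C N) id (lcoact N) (lcoact N n)"
    and lcoact_counit: "\<And>n. n \<in> carrier N \<Longrightarrow>
      left_unit K N (tensor_map K (self_module K) N (counit C) id (lcoact N n)) = n"

locale bicomodule =
  fixes K :: "('k, 'x) ring_scheme" and C :: "('k, 'c, 'y) coalg_scheme"
    and N :: "('k, 'v, 'c, 'z) bicomod_scheme"
  assumes right: "right_comodule K C N"
    and left: "left_comodule K C N"
    and coacts_commute: "\<And>n. n \<in> carrier N \<Longrightarrow>
      tensor_assoc K C N C (tensor_map K (tensor K C N) C (lcoact N) id (rcoact N n)) =
      tensor_map K C (tensor K N C) id (rcoact N) (lcoact N n)"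

definition rcomod_map ::
  "('k, 'x) ring_scheme \<Rightarrow> ('k, 'c, 'y) coalg_scheme \<Rightarrow> ('k, 'v, 'c, 'z1) rcomod_scheme
    \<Rightarrow> ('k, 'w, 'c, 'z2) rcomod_scheme \<Rightarrow> ('v \<Rightarrow> 'w) \<Rightarrow> bool"
  where "rcomod_map K C M N f \<longleftrightarrow> linear_map K M N f \<and>
    (\<forall>x\<in>carrier M. rcoact N (f x) = tensor_map K N C f id (rcoact M x))"

definition bicomod_map ::
  "('k, 'x) ring_scheme \<Rightarrow> ('k, 'c, 'y) coalg_scheme \<Rightarrow> ('k, 'v, 'c, 'z1) bicomod_scheme
    \<Rightarrow> ('k, 'w, 'c, 'z2) bicomod_scheme \<Rightarrow> ('v \<Rightarrow> 'w) \<Rightarrow> bool"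
  where "bicomod_map K C M N f \<longleftrightarrow> rcomod_map K C M N f \<and>
    (\<forall>x\<in>carrier M. lcoact N (f x) = tensor_map K C N id f (lcoact M x))"

definition coalg_bicomod :: "('k, 'c, 'y) coalg_scheme \<Rightarrow> ('k, 'c, 'c) bicomod"
  where "coalg_bicomod C = \<lparr>carrier = carrier C, mult = undefined, one = undefined,
    zero = \<zero>\<^bsub>C\<^esub>, add = add C, smult = smult C, rcoact = comult C, lcoact = comult C\<rparr>"


section \<open>Cotensor products\<close>

(* The subspace of M (x) N on which the two maps to M (x) (C (x) N) induced by the coactions agree,
   written M [] N in comments. The cotensor product of linear maps f and g is their tensor_map,
   applied only to elements of this subspace. *)
definition cotensor ::
  "('k, 'x) ring_scheme \<Rightarrow> ('k, 'c, 'y) coalg_scheme \<Rightarrow> ('k, 'm, 'c, 'z1) rcomod_scheme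
    \<Rightarrow> ('k, 'n, 'c, 'z2) bicomod_scheme \<Rightarrow> ('k, ('m \<times> 'n \<Rightarrow> 'k) set) module"
  where "cotensor K C M N = (tensor K M N)\<lparr>carrier := {t \<in> carrier (tensor K M N).
    tensor_map K M (tensor K C N) id (lcoact N) t =
    tensor_assoc K M C N (tensor_map K (tensor K M C) N (rcoact M) id t)}\<rparr>"

(* Over a field, for the inclusion i of the cotensor product of M and N into M (x) N, the map
   i (x) id is injective, and the image of id (x) rcoact N on the cotensor product lies in the image
   of i (x) id (up to tensor_assoc). Hence inv_into below yields the coaction of the cotensor
   product with values in (M [] N) (x) C. *)
definition cotensor_rcoact ::
  "('k, 'x) ring_scheme \<Rightarrow> ('k, 'c, 'y) coalg_scheme \<Rightarrow> ('k, 'm, 'c, 'z1) rcomod_scheme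
    \<Rightarrow> ('k, 'n, 'c, 'z2) bicomod_scheme
    \<Rightarrow> ('m \<times> 'n \<Rightarrow> 'k) set \<Rightarrow> (('m \<times> 'n \<Rightarrow> 'k) set \<times> 'c \<Rightarrow> 'k) set"
  where "cotensor_rcoact K C M N t =
    inv_into (carrier (tensor K (cotensor K C M N) C))
      (\<lambda>s. tensor_assoc K M N C (tensor_map K (tensor K M N) C id id s))
      (tensor_map K M (tensor K N C) id (rcoact N) t)"

definition cotensor_lcoact ::
  "('k, 'x) ring_scheme \<Rightarrow> ('k, 'c, 'y) coalg_scheme \<Rightarrow> ('k, 'm, 'c, 'z1) bicomod_scheme
    \<Rightarrow> ('k, 'n, 'c, 'z2) bicomod_scheme
    \<Rightarrow> ('m \<times> 'n \<Rightarrow> 'k) set \<Rightarrow> ('c \<times> ('m \<times> 'n \<Rightarrow> 'k) set \<Rightarrow> 'k) set"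
  where "cotensor_lcoact K C M N t =
    inv_into (carrier (tensor K C (cotensor K C M N)))
      (tensor_map K C (tensor K M N) id id)
      (tensor_assoc K C M N (tensor_map K (tensor K C M) N (lcoact M) id t))"

definition cotensor_rcomod ::
  "('k, 'x) ring_scheme \<Rightarrow> ('k, 'c, 'y) coalg_scheme \<Rightarrow> ('k, 'm, 'c, 'z1) rcomod_scheme
    \<Rightarrow> ('k, 'n, 'c, 'z2) bicomod_scheme \<Rightarrow> ('k, ('m \<times> 'n \<Rightarrow> 'k) set, 'c) rcomod"
  where "cotensor_rcomod K C M N = (let T = cotensor K C M N in
    \<lparr>carrier = carrier T, mult = undefined, one = undefined, zero = zero T, add = add T,
     smult = smult T, rcoact = cotensor_rcoact K C M N\<rparr>)"

definition cotensor_bicomod ::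
  "('k, 'x) ring_scheme \<Rightarrow> ('k, 'c, 'y) coalg_scheme \<Rightarrow> ('k, 'm, 'c, 'z1) bicomod_scheme
    \<Rightarrow> ('k, 'n, 'c, 'z2) bicomod_scheme \<Rightarrow> ('k, ('m \<times> 'n \<Rightarrow> 'k) set, 'c) bicomod"
  where "cotensor_bicomod K C M N = (let T = cotensor K C M N in
    \<lparr>carrier = carrier T, mult = undefined, one = undefined, zero = zero T, add = add T,
     smult = smult T, rcoact = cotensor_rcoact K C M N, lcoact = cotensor_lcoact K C M N\<rparr>)"

(* The canonical isomorphism from (M [] N) [] P to M [] (N [] P); both sides are compared inside
   M (x) (N (x) P), into which they embed over a field. *)
definition cotensor_assoc ::
  "('k, 'x) ring_scheme \<Rightarrow> ('k, 'c, 'y) coalg_scheme \<Rightarrow> ('k, 'm, 'c, 'z1) rcomod_scheme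
    \<Rightarrow> ('k, 'n, 'c, 'z2) bicomod_scheme \<Rightarrow> ('k, 'p, 'c, 'z3) bicomod_scheme
    \<Rightarrow> (('m \<times> 'n \<Rightarrow> 'k) set \<times> 'p \<Rightarrow> 'k) set \<Rightarrow> ('m \<times> ('n \<times> 'p \<Rightarrow> 'k) set \<Rightarrow> 'k) set"
  where "cotensor_assoc K C M N P t =
    inv_into (carrier (cotensor K C M (cotensor_bicomod K C N P)))
      (tensor_map K M (tensor K N P) id id)
      (tensor_assoc K M N P (tensor_map K (tensor K M N) P id id t))"


section \<open>Rings over a coalgebra, characters and actions\<close>

record ('k, 'a, 'c) C_ring_data = "('k, 'a, 'c) bicomod" +
  mu :: "('a \<times> 'a \<Rightarrow> 'k) set \<Rightarrow> 'a"
  eta :: "'c \<Rightarrow> 'a"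

locale C_ring =
  fixes K :: "('k, 'x) ring_scheme" and C :: "('k, 'c, 'y) coalg_scheme"
    and A :: "('k, 'a, 'c, 'z) C_ring_data_scheme"
  assumes bicomodule: "bicomodule K C A"
    and mu_map: "bicomod_map K C (cotensor_bicomod K C A A) A (mu A)"
    and eta_map: "bicomod_map K C (coalg_bicomod C) A (eta A)"
    and mu_assoc: "\<And>t. t \<in> carrier (cotensor K C (cotensor_bicomod K C A A) A) \<Longrightarrow>
      mu A (tensor_map K A A (mu A) id t) =
      mu A (tensor_map K A A id (mu A) (cotensor_assoc K C A A A t))"
    and mu_unit_right: "\<And>a. a \<in> carrier A \<Longrightarrow> mu A (tensor_map K A A id (eta A) (rcoact A a)) = a"
    and mu_unit_left: "\<And>a. a \<in> carrier A \<Longrightarrow> mu A (tensor_map K A A (eta A) id (lcoact A a)) = a"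

definition character ::
  "('k, 'x) ring_scheme \<Rightarrow> ('k, 'c, 'y) coalg_scheme \<Rightarrow> ('k, 'a, 'c, 'z) C_ring_data_scheme
    \<Rightarrow> ('a \<Rightarrow> 'k) \<Rightarrow> bool"
  where "character K C A \<kappa> \<longleftrightarrow> linear_map K A (self_module K) \<kappa> \<and>
    (\<forall>t\<in>carrier (cotensor K C A A). \<kappa> (mu A t) =
      left_unit K (self_module K) (tensor_map K (self_module K) (self_module K) \<kappa> \<kappa> t)) \<and>
    (\<forall>c\<in>carrier C. \<kappa> (eta A c) = counit C c)"

definition right_action ::
  "('k, 'x) ring_scheme \<Rightarrow> ('k, 'c, 'y) coalg_scheme \<Rightarrow> ('k, 'a, 'c, 'z1) C_ring_data_scheme
    \<Rightarrow> ('k, 'm, 'c, 'z2) rcomod_scheme \<Rightarrow> (('m \<times> 'a \<Rightarrow> 'k) set \<Rightarrow> 'm) \<Rightarrow> bool"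
  where "right_action K C A M r \<longleftrightarrow> rcomod_map K C (cotensor_rcomod K C M A) M r \<and>
    (\<forall>t\<in>carrier (cotensor K C (cotensor_rcomod K C M A) A).
      r (tensor_map K M A r id t) =
      r (tensor_map K M A id (mu A) (cotensor_assoc K C M A A t))) \<and>
    (\<forall>m\<in>carrier M. r (tensor_map K M A id (eta A) (rcoact M m)) = m)"


section \<open>The cokernel of the unit and connections\<close>

definition coker_proj ::
  "('k, 'c, 'y) coalg_scheme \<Rightarrow> ('k, 'a, 'c, 'z) C_ring_data_scheme \<Rightarrow> 'a \<Rightarrow> 'a set"
  where "coker_proj C A a = (eta A ` carrier C) +>\<^bsub>A\<^esub> a"

(* The coactions are the ones induced from A: an element q of the cokernel is a coset and is
   represented by any of its elements. *)
definition coker_bicomod ::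
  "('k, 'x) ring_scheme \<Rightarrow> ('k, 'c, 'y) coalg_scheme \<Rightarrow> ('k, 'a, 'c, 'z) C_ring_data_scheme
    \<Rightarrow> ('k, 'a set, 'c) bicomod"
  where "coker_bicomod K C A = (let Q = quot_module A (eta A ` carrier C) in
    \<lparr>carrier = carrier Q, mult = undefined, one = undefined, zero = zero Q, add = add Q,
     smult = smult Q,
     rcoact = (\<lambda>q. tensor_map K Q C (coker_proj C A) id (rcoact A (SOME a. a \<in> q))),
     lcoact = (\<lambda>q. tensor_map K C Q id (coker_proj C A) (lcoact A (SOME a. a \<in> q)))\<rparr>)"

(* D is the connection (usually written nabla), connection_ext the map on M [] B [] B derived from
   it. The coaction of cotensor_rcomod K C M B is the map induced by id and the right coaction of
   B. *)
definition connection ::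
  "('k, 'x) ring_scheme \<Rightarrow> ('k, 'c, 'y) coalg_scheme \<Rightarrow> ('k, 'b, 'c, 'z1) bicomod_scheme
    \<Rightarrow> ('b \<Rightarrow> 'c) \<Rightarrow> ('k, 'm, 'c, 'z2) rcomod_scheme \<Rightarrow> (('m \<times> 'b \<Rightarrow> 'k) set \<Rightarrow> 'm) \<Rightarrow> bool"
  where "connection K C B lam1 M D \<longleftrightarrow> linear_map K (cotensor K C M B) M D \<and>
    (\<forall>t\<in>carrier (cotensor K C M B). rcoact M (D t) =
      tensor_map K M C D id (rcoact (cotensor_rcomod K C M B) t)
        \<oplus>\<^bsub>tensor K M C\<^esub> tensor_map K M C id lam1 t)"

definition connection_ext ::
  "('k, 'x) ring_scheme \<Rightarrow> ('k, 'c, 'y) coalg_scheme \<Rightarrow> ('k, 'b, 'c, 'z1) bicomod_scheme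
    \<Rightarrow> (('b \<times> 'b \<Rightarrow> 'k) set \<Rightarrow> 'b) \<Rightarrow> ('k, 'm, 'c, 'z2) rcomod_scheme
    \<Rightarrow> (('m \<times> 'b \<Rightarrow> 'k) set \<Rightarrow> 'm)
    \<Rightarrow> (('m \<times> 'b \<Rightarrow> 'k) set \<times> 'b \<Rightarrow> 'k) set \<Rightarrow> ('m \<times> 'b \<Rightarrow> 'k) set"
  where "connection_ext K C B lam2 M D t =
    tensor_map K M B D id t
      \<oplus>\<^bsub>tensor K M B\<^esub> tensor_map K M B id lam2 (cotensor_assoc K C M B B t)"

definition curvature ::
  "('k, 'x) ring_scheme \<Rightarrow> ('k, 'c, 'y) coalg_scheme \<Rightarrow> ('k, 'b, 'c, 'z1) bicomod_scheme
    \<Rightarrow> (('b \<times> 'b \<Rightarrow> 'k) set \<Rightarrow> 'b) \<Rightarrow> ('k, 'm, 'c, 'z2) rcomod_scheme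
    \<Rightarrow> (('m \<times> 'b \<Rightarrow> 'k) set \<Rightarrow> 'm)
    \<Rightarrow> (('m \<times> 'b \<Rightarrow> 'k) set \<times> 'b \<Rightarrow> 'k) set \<Rightarrow> 'm"
  where "curvature K C B lam2 M D t = D (connection_ext K C B lam2 M D t)"

definition flat_connection ::
  "('k, 'x) ring_scheme \<Rightarrow> ('k, 'c, 'y) coalg_scheme \<Rightarrow> ('k, 'b, 'c, 'z1) bicomod_scheme
    \<Rightarrow> ('b \<Rightarrow> 'c) \<Rightarrow> (('b \<times> 'b \<Rightarrow> 'k) set \<Rightarrow> 'b) \<Rightarrow> ('k, 'm, 'c, 'z2) rcomod_scheme
    \<Rightarrow> (('m \<times> 'b \<Rightarrow> 'k) set \<Rightarrow> 'm) \<Rightarrow> bool"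
  where "flat_connection K C B lam1 lam2 M D \<longleftrightarrow> connection K C B lam1 M D \<and>
    (\<forall>t\<in>carrier (cotensor K C (cotensor_rcomod K C M B) B). curvature K C B lam2 M D t = \<zero>\<^bsub>M\<^esub>)"

end

theory Submission
  imports Defs
begin

text \<open>
  Over a field, an element \<open>t\<close> of \<open>V \<otimes> W\<close> is determined by its slices \<open>(id \<otimes> \<phi>) t\<close>, where \<open>\<phi>\<close> runs
  through the functionals on \<open>W\<close>, and it comes from \<open>H \<otimes> W\<close> for a subspace \<open>H\<close> of \<open>V\<close> as soon as all
  its slices lie in \<open>H\<close> (\<open>slR_detect\<close>, \<open>slR_mem\<close>). Slicing a coaction by the functionals \<open>\<phi>\<close> on \<open>C\<close>
  turns a right comodule \<open>M\<close> into a space with operators \<open>ract M \<phi>\<close>, and a left comodule \<open>N\<close> into a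
  space with operators \<open>lact N \<phi>\<close>. In these terms coactions and associators disappear: the cotensor
  product \<open>M \<box> N\<close> is the part of \<open>M \<otimes> N\<close> on which \<open>ract M \<phi> \<otimes> id\<close> and \<open>id \<otimes> lact N \<phi>\<close> agree
  (\<open>mem_cotensor\<close>), its operators are \<open>id \<otimes> ract N \<phi>\<close> (\<open>ract_rcot\<close>), and colinear maps are the linear
  maps that commute with the operators (\<open>rcomod_map_iff\<close>).

  The character yields a left colinear section \<open>sec\<close> of \<open>\<pi>\<close>, which sends \<open>\<pi> a\<close> to
  \<open>a - \<eta> ((id \<otimes> \<kappa>) (lcoact a))\<close>. Therefore each \<open>x\<close> in \<open>M \<box> A\<close> is the sum of a lift of \<open>(M \<box> \<pi>) x\<close>
  and of \<open>(M \<box> \<eta>) (rcoact m)\<close> with \<open>m = (M \<box> \<kappa>) x\<close> (\<open>decomposition\<close>), so that the formula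
  \<open>r = D \<circ> (M \<box> \<pi>) + M \<box> \<kappa>\<close> matches the linear maps \<open>D\<close> with the linear maps \<open>r\<close> that satisfy the unit
  law. Such an \<open>r\<close> is colinear if and only if \<open>D\<close> is a connection (\<open>connection_iff_ract\<close>), because
  \<open>\<phi> \<circ> lam1 \<circ> \<pi>\<close> is the difference of \<open>\<kappa> \<circ> ract A \<phi>\<close> and \<open>\<kappa> \<circ> lact A \<phi>\<close>. For colinear \<open>r\<close>, expanding
  both sides of the associativity law at \<open>t\<close> shows that their difference is the curvature of \<open>D\<close> at
  the image of \<open>t\<close> under \<open>(M \<box> \<pi>) \<box> \<pi>\<close> (\<open>associativity_defect\<close>). Hence flatness implies associativity.

  For the converse, \<open>(M \<box> \<pi>) \<box> \<pi>\<close> has to be onto. The section \<open>sec\<close> takes care of the outer factor,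
  but the inner one would need a section of \<open>\<pi>\<close> that is colinear on both sides. Instead the action
  itself helps: by the unit law \<open>x - (M \<box> \<eta>) (rcoact (r x))\<close> depends only on \<open>(M \<box> \<pi>) x\<close>, and this
  defines a right colinear section of \<open>M \<box> \<pi>\<close> (\<open>iterated_lift\<close>).
\<close>

context abelian_group
begin

lemma minus_eq_zero_iff:
  assumes "x \<in> carrier G" "y \<in> carrier G"
  shows "x \<ominus> y = \<zero> \<longleftrightarrow> x = y"
  using assms unfolding a_minus_def by (metis minus_equality minus_minus r_neg a_inv_closed a_comm)

lemma a_inv_zero: "\<ominus> \<zero> = \<zero>"
  by (rule minus_equality) simp_all

lemma diff_add_diff:
  assumes "p \<in> carrier G" "z \<in> carrier G" "q \<in> carrier G" "k \<in> carrier G"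
  shows "(p \<ominus> z) \<oplus> ((z \<ominus> q) \<oplus> k) = (p \<ominus> q) \<oplus> k"
proof -
  have "(p \<ominus> z) \<oplus> ((z \<ominus> q) \<oplus> k) = p \<oplus> ((\<ominus> z \<oplus> z) \<oplus> (\<ominus> q \<oplus> k))"
    using assms by (simp add: a_minus_def a_assoc)
  then show ?thesis using assms by (simp add: a_minus_def a_assoc l_neg)
qed

lemma eq_add_diff_iff:
  assumes "a \<in> carrier G" "b \<in> carrier G" "c \<in> carrier G" "d \<in> carrier G"
  shows "a = b \<oplus> (c \<ominus> d) \<longleftrightarrow> a \<oplus> d = b \<oplus> c"
proof
  assume "a = b \<oplus> (c \<ominus> d)"
  then show "a \<oplus> d = b \<oplus> c" using assms by (simp add: a_minus_def a_assoc l_neg)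
next
  assume "a \<oplus> d = b \<oplus> c"
  then have "(a \<oplus> d) \<ominus> d = (b \<oplus> c) \<ominus> d" by simp
  then show "a = b \<oplus> (c \<ominus> d)" using assms by (simp add: a_minus_def a_assoc r_neg)
qed

lemma add_diff_shuffle:
  assumes "x \<in> carrier G" "y \<in> carrier G" "d \<in> carrier G" "k \<in> carrier G"
  shows "x \<oplus> (d \<oplus> k) = (y \<oplus> k) \<oplus> ((x \<ominus> y) \<oplus> d)"
  using assms by (simp add: a_minus_def a_ac r_neg r_neg1 r_neg2)

lemma minus_zero_right: "x \<in> carrier G \<Longrightarrow> x \<ominus> \<zero> = x"
  by (simp add: a_minus_def a_inv_zero)

lemma add_eq_self:
  assumes "x \<in> carrier G" "c \<in> carrier G" "x \<oplus> c = x" shows "c = \<zero>"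
proof -
  have "\<ominus> x \<oplus> (x \<oplus> c) = \<ominus> x \<oplus> x" using assms(3) by simp
  then show ?thesis using assms(1,2) by (simp add: r_neg1 l_neg)
qed

end

section \<open>Linear maps\<close>

lemma linear_mapI:
  assumes "\<And>x. x \<in> carrier V \<Longrightarrow> f x \<in> carrier W"
    and "\<And>x y. x \<in> carrier V \<Longrightarrow> y \<in> carrier V \<Longrightarrow> f (x \<oplus>\<^bsub>V\<^esub> y) = f x \<oplus>\<^bsub>W\<^esub> f y"
    and "\<And>a x. a \<in> carrier K \<Longrightarrow> x \<in> carrier V \<Longrightarrow> f (a \<odot>\<^bsub>V\<^esub> x) = a \<odot>\<^bsub>W\<^esub> f x"
  shows "linear_map K V W f"
  using assms unfolding linear_map_def by auto

lemma linear_closed: "linear_map K V W f \<Longrightarrow> x \<in> carrier V \<Longrightarrow> f x \<in> carrier W"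
  unfolding linear_map_def by auto

lemma linear_add:
  "linear_map K V W f \<Longrightarrow> x \<in> carrier V \<Longrightarrow> y \<in> carrier V \<Longrightarrow> f (x \<oplus>\<^bsub>V\<^esub> y) = f x \<oplus>\<^bsub>W\<^esub> f y"
  unfolding linear_map_def by auto

lemma linear_smult:
  "linear_map K V W f \<Longrightarrow> a \<in> carrier K \<Longrightarrow> x \<in> carrier V \<Longrightarrow> f (a \<odot>\<^bsub>V\<^esub> x) = a \<odot>\<^bsub>W\<^esub> f x"
  unfolding linear_map_def by auto

lemma linear_zero:
  assumes "module K V" "module K W" "linear_map K V W f"
  shows "f \<zero>\<^bsub>V\<^esub> = \<zero>\<^bsub>W\<^esub>"
proof -
  interpret V: module K V by fact
  interpret W: module K W by fact
  have "f (\<zero>\<^bsub>K\<^esub> \<odot>\<^bsub>V\<^esub> \<zero>\<^bsub>V\<^esub>) = \<zero>\<^bsub>K\<^esub> \<odot>\<^bsub>W\<^esub> f \<zero>\<^bsub>V\<^esub>"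
    by (rule linear_smult[OF assms(3)]) auto
  then show ?thesis using linear_closed[OF assms(3)] by simp
qed

lemma linear_uminus:
  assumes "module K V" "module K W" "linear_map K V W f" "x \<in> carrier V"
  shows "f (\<ominus>\<^bsub>V\<^esub> x) = \<ominus>\<^bsub>W\<^esub> f x"
proof -
  interpret V: module K V by fact
  interpret W: module K W by fact
  have "f ((\<ominus>\<^bsub>K\<^esub> \<one>\<^bsub>K\<^esub>) \<odot>\<^bsub>V\<^esub> x) = (\<ominus>\<^bsub>K\<^esub> \<one>\<^bsub>K\<^esub>) \<odot>\<^bsub>W\<^esub> f x"
    by (rule linear_smult[OF assms(3)]) (auto simp: assms)
  then show ?thesis using linear_closed[OF assms(3,4)] assms(4)
    by (simp add: V.smult_l_minus W.smult_l_minus)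
qed

lemma linear_minus:
  assumes "module K V" "module K W" "linear_map K V W f" "x \<in> carrier V" "y \<in> carrier V"
  shows "f (x \<ominus>\<^bsub>V\<^esub> y) = f x \<ominus>\<^bsub>W\<^esub> f y"
proof -
  interpret V: module K V by fact
  show ?thesis unfolding a_minus_def
    using assms by (simp add: linear_add[OF assms(3)] linear_uminus[OF assms(1-3)])
qed

lemma kernel_submodule:
  assumes "module K V" "module K W" "linear_map K V W f"
  shows "submodule {x \<in> carrier V. f x = \<zero>\<^bsub>W\<^esub>} K V"
proof -
  interpret V: module K V by fact
  interpret W: module K W by fact
  show ?thesis
    by (rule V.submoduleI)
      (auto simp: linear_zero[OF assms] linear_uminus[OF assms] linear_add[OF assms(3)]
        linear_smult[OF assms(3)])
qed

lemma image_submodule: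
  assumes "module K V" "module K W" "linear_map K V W f"
  shows "submodule (f ` carrier V) K W"
proof -
  interpret V: module K V by fact
  interpret W: module K W by fact
  show ?thesis
  proof (rule W.submoduleI)
    show "f ` carrier V \<subseteq> carrier W" using linear_closed[OF assms(3)] by auto
    show "\<zero>\<^bsub>W\<^esub> \<in> f ` carrier V" using linear_zero[OF assms] by force
    show "\<ominus>\<^bsub>W\<^esub> a \<in> f ` carrier V" if "a \<in> f ` carrier V" for a
      using that linear_uminus[OF assms] by (metis (no_types, lifting) V.a_inv_closed image_iff)
    show "a \<oplus>\<^bsub>W\<^esub> b \<in> f ` carrier V" if "a \<in> f ` carrier V" "b \<in> f ` carrier V" for a b
      using that linear_add[OF assms(3)] by (metis (no_types, lifting) V.a_closed image_iff)
    show "a \<odot>\<^bsub>W\<^esub> b \<in> f ` carrier V" if "a \<in> carrier K" "b \<in> f ` carrier V" for a b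
      using that linear_smult[OF assms(3)] by (metis (no_types, lifting) V.smult_closed image_iff)
  qed
qed

lemma submodule_incl: "submodule H K V \<Longrightarrow> module K V \<Longrightarrow> linear_map K (V\<lparr>carrier := H\<rparr>) V id"
  by (rule linear_mapI) (auto dest: module.submoduleE(1))

lemma self_module_simps [simp]:
  "carrier (self_module K) = carrier K" "\<zero>\<^bsub>self_module K\<^esub> = \<zero>\<^bsub>K\<^esub>"
  "add (self_module K) = add K" "smult (self_module K) = mult K"
  by (simp_all add: self_module_def)

lemma self_module_module:
  assumes "cring K" shows "module K (self_module K)"
proof -
  interpret cring K by fact
  have "abelian_group (self_module K)"
  proof (rule abelian_groupI)
    show "\<exists>y\<in>carrier (self_module K). y \<oplus>\<^bsub>self_module K\<^esub> x = \<zero>\<^bsub>self_module K\<^esub>"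
      if "x \<in> carrier (self_module K)" for x
      using that by (intro bexI[of _ "\<ominus>\<^bsub>K\<^esub> x"]) (auto simp: l_neg)
  qed (simp_all add: a_ac)
  then show ?thesis
    by (intro moduleI assms) (simp_all add: l_distr r_distr m_assoc)
qed

section \<open>Quotients\<close>

locale quotient_module = module K V for K :: "('k, 'x) ring_scheme" (structure)
    and V :: "('k, 'v, 'y) module_scheme" (structure) +
  fixes H assumes sub: "submodule H K V"
begin

sublocale H: abelian_subgroup H V
  by (rule abelian_subgroupI3)
    (use sub submodule.axioms(1) in \<open>auto simp: additive_subgroup_def abelian_group_axioms\<close>)

abbreviation proj where "proj v \<equiv> H +>\<^bsub>V\<^esub> v"
abbreviation Q where "Q \<equiv> quot_module V H"

lemma proj_smult:
  assumes "a \<in> carrier K" "v \<in> carrier V"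
  shows "(\<Union>x\<in>proj v. proj (a \<odot>\<^bsub>V\<^esub> x)) = proj (a \<odot>\<^bsub>V\<^esub> v)"
proof -
  have "proj (a \<odot>\<^bsub>V\<^esub> x) = proj (a \<odot>\<^bsub>V\<^esub> v)" if x: "x \<in> proj v" for x
  proof -
    obtain h where h: "h \<in> H" "x = h \<oplus>\<^bsub>V\<^esub> v" using x by (auto simp: a_r_coset_def')
    have hV: "h \<in> carrier V" using h submoduleE(1)[OF sub] by auto
    have "a \<odot>\<^bsub>V\<^esub> x = a \<odot>\<^bsub>V\<^esub> h \<oplus>\<^bsub>V\<^esub> a \<odot>\<^bsub>V\<^esub> v" using h hV assms by (simp add: smult_r_distr)
    moreover have "a \<odot>\<^bsub>V\<^esub> h \<in> H" using submoduleE(4)[OF sub] assms h by auto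
    ultimately have "a \<odot>\<^bsub>V\<^esub> x \<in> proj (a \<odot>\<^bsub>V\<^esub> v)" by (auto simp: a_r_coset_def')
    then show ?thesis using H.a_repr_independence'[symmetric] assms by auto
  qed
  moreover have "v \<in> proj v" using H.a_rcos_self assms by auto
  ultimately show ?thesis by blast
qed

lemma quot_simps:
  "carrier Q = proj ` carrier V"
  "\<zero>\<^bsub>Q\<^esub> = H"
  "v \<in> carrier V \<Longrightarrow> w \<in> carrier V \<Longrightarrow>
    (proj v) \<oplus>\<^bsub>Q\<^esub> (proj w) = proj (v \<oplus>\<^bsub>V\<^esub> w)"
  "a \<in> carrier K \<Longrightarrow> v \<in> carrier V \<Longrightarrow>
    a \<odot>\<^bsub>Q\<^esub> (proj v) = proj (a \<odot>\<^bsub>V\<^esub> v)"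
  by (auto simp: quot_module_def A_RCOSETS_def' H.a_rcos_sum proj_smult)

lemma quot_zero: "H = proj \<zero>\<^bsub>V\<^esub>"
  using a_coset_add_zero submoduleE(1)[OF sub] by simp

lemma quot_module: "module K Q"
proof (rule moduleI)
  show "cring K" by (rule R.is_cring)
  show "abelian_group Q"
  proof (rule abelian_groupI)
    show "\<exists>y\<in>carrier Q. y \<oplus>\<^bsub>Q\<^esub> x = \<zero>\<^bsub>Q\<^esub>"
      if "x \<in> carrier Q" for x
    proof -
      from that obtain v where v: "v \<in> carrier V" "x = proj v" by (auto simp: quot_simps)
      have "(proj (\<ominus>\<^bsub>V\<^esub> v)) \<oplus>\<^bsub>Q\<^esub> x = \<zero>\<^bsub>Q\<^esub>"
        using v by (simp add: quot_simps l_neg quot_zero[symmetric])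
      then show ?thesis using v by (force simp: quot_simps)
    qed
    show "\<zero>\<^bsub>Q\<^esub> \<oplus>\<^bsub>Q\<^esub> x = x" if "x \<in> carrier Q" for x
    proof -
      from that obtain v where v: "v \<in> carrier V" "x = proj v" by (auto simp: quot_simps)
      have "(proj \<zero>\<^bsub>V\<^esub>) \<oplus>\<^bsub>Q\<^esub> x = x"
        using v by (simp only: quot_simps zero_closed M.l_zero)
      then show ?thesis using quot_zero by (simp add: quot_simps(2))
    qed
    show "\<zero>\<^bsub>Q\<^esub> \<in> carrier Q"
      using quot_zero by (auto simp: quot_simps)
  qed (auto simp: quot_simps M.a_ac)
qed (auto simp: quot_simps smult_l_distr smult_r_distr smult_assoc1)

lemma proj_linear: "linear_map K V Q proj"
  by (rule linear_mapI) (auto simp: quot_simps)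

lemma proj_eq_iff:
  assumes "v \<in> carrier V" "w \<in> carrier V"
  shows "proj v = proj w \<longleftrightarrow> v \<ominus>\<^bsub>V\<^esub> w \<in> H"
proof -
  have "proj v = proj w \<longleftrightarrow> v \<in> proj w"
    using assms H.a_repr_independence' H.a_repr_independenceD by metis
  also have "\<dots> \<longleftrightarrow> v \<ominus>\<^bsub>V\<^esub> w \<in> H"
    using H.a_rcos_module[OF assms(2,1)] by (simp add: a_minus_def)
  finally show ?thesis .
qed

lemma some_rep:
  assumes "v \<in> carrier V"
  shows "(SOME a. a \<in> proj v) \<in> carrier V" "(SOME a. a \<in> proj v) \<ominus>\<^bsub>V\<^esub> v \<in> H"
proof -
  let ?a = "SOME a. a \<in> proj v"
  have a: "?a \<in> proj v" by (rule someI[of _ v]) (use H.a_rcos_self assms in auto)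
  then show aV: "?a \<in> carrier V"
    using H.a_elemrcos_carrier assms is_abelian_group by blast
  have "proj ?a = proj v" using H.a_repr_independence'[OF a assms] by simp
  then show "?a \<ominus>\<^bsub>V\<^esub> v \<in> H" using proj_eq_iff assms aV by simp
qed

text \<open>This makes \<open>tensor_lift\<close> and the coactions of the cokernel well defined, which evaluate at a chosen
  representative.\<close>

lemma linear_some_rep:
  assumes "module K P" "linear_map K V P f" "\<And>h. h \<in> H \<Longrightarrow> f h = \<zero>\<^bsub>P\<^esub>" "v \<in> carrier V"
  shows "f (SOME a. a \<in> proj v) = f v"
proof -
  interpret P: module K P by fact
  let ?a = "SOME a. a \<in> proj v"
  have "f ?a \<ominus>\<^bsub>P\<^esub> f v = \<zero>\<^bsub>P\<^esub>"
    using linear_minus[OF module_axioms assms(1,2) some_rep(1)[OF assms(4)] assms(4)]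
      assms(3) some_rep[OF assms(4)] by simp
  then show ?thesis
    using linear_closed[OF assms(2)] some_rep(1)[OF assms(4)] assms(4) P.minus_eq_zero_iff by auto
qed

end

section \<open>Free modules\<close>

locale ground_field =
  fixes K :: "('k, 'x) ring_scheme" (structure)
  assumes is_field: "field K"
begin

sublocale field K by (rule is_field)

abbreviation free where "free \<equiv> free_module K"
abbreviation tensor_space (infixl "**" 70) where "V ** W \<equiv> tensor K V W"
abbreviation pure where "pure \<equiv> pure_tensor K"
abbreviation tmap where "tmap \<equiv> tensor_map K"
abbreviation assoc where "assoc \<equiv> tensor_assoc K"

lemma free_carrier:
  "c \<in> carrier (free X) \<longleftrightarrow>
    (\<forall>i. c i \<in> carrier K) \<and> {i. c i \<noteq> \<zero>} \<subseteq> X \<and> finite {i. c i \<noteq> \<zero>}"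
  unfolding free_module_def by auto

lemma free_simps:
  "\<zero>\<^bsub>free X\<^esub> = (\<lambda>i. \<zero>)"
  "c \<oplus>\<^bsub>free X\<^esub> d = (\<lambda>i. c i \<oplus> d i)"
  "a \<odot>\<^bsub>free X\<^esub> c = (\<lambda>i. a \<otimes> c i)"
  unfolding free_module_def by auto

lemma free_support_mono:
  assumes "c \<in> carrier (free X)" "{i. d i \<noteq> \<zero>} \<subseteq> {i. c i \<noteq> \<zero>}" "\<And>i. d i \<in> carrier K"
  shows "d \<in> carrier (free X)"
  using assms unfolding free_carrier by (auto intro: finite_subset)

lemma free_add_closed:
  assumes "c \<in> carrier (free X)" "d \<in> carrier (free X)"
  shows "(\<lambda>i. c i \<oplus> d i) \<in> carrier (free X)"
proof -
  have "{i. c i \<oplus> d i \<noteq> \<zero>} \<subseteq> {i. c i \<noteq> \<zero>} \<union> {i. d i \<noteq> \<zero>}" by auto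
  then show ?thesis using assms unfolding free_carrier by (auto intro: finite_subset)
qed

lemma free_module: "module K (free X)"
proof (rule moduleI)
  show "cring K" by (rule is_cring)
  have ninv: "(\<lambda>i. \<ominus> c i) \<in> carrier (free X)" if "c \<in> carrier (free X)" for c
    by (rule free_support_mono[OF that]) (use that in \<open>auto simp: free_carrier\<close>)
  show "abelian_group (free X)"
  proof (rule abelian_groupI)
    show "\<exists>y\<in>carrier (free X). y \<oplus>\<^bsub>free X\<^esub> x = \<zero>\<^bsub>free X\<^esub>"
      if "x \<in> carrier (free X)" for x
      using that by (intro bexI[OF _ ninv[OF that]]) (auto simp: free_simps free_carrier l_neg)
    show "\<zero>\<^bsub>free X\<^esub> \<in> carrier (free X)" by (simp add: free_simps free_carrier)
    show "x \<oplus>\<^bsub>free X\<^esub> y \<in> carrier (free X)"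
      if "x \<in> carrier (free X)" "y \<in> carrier (free X)" for x y
      using free_add_closed[OF that] by (simp add: free_simps)
  qed (auto simp: free_simps free_carrier a_ac)
  show "a \<odot>\<^bsub>free X\<^esub> x \<in> carrier (free X)"
    if "a \<in> carrier K" "x \<in> carrier (free X)" for a x
    unfolding free_simps
    by (rule free_support_mono[OF that(2)]) (use that in \<open>auto simp: free_carrier\<close>)
qed (auto simp: free_simps free_carrier l_distr r_distr m_assoc intro!: free_add_closed)

lemma free_gen_closed: "i \<in> X \<Longrightarrow> free_gen K i \<in> carrier (free X)"
  unfolding free_carrier free_gen_def by auto

lemma free_induct [consumes 1, case_names zero add]:
  assumes "c \<in> carrier (free X)"
    and "Q \<zero>\<^bsub>free X\<^esub>"
    and "\<And>a i c. a \<in> carrier K \<Longrightarrow> i \<in> X \<Longrightarrow> c \<in> carrier (free X) \<Longrightarrow> Q c \<Longrightarrow>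
      Q (a \<odot>\<^bsub>free X\<^esub> free_gen K i \<oplus>\<^bsub>free X\<^esub> c)"
  shows "Q c"
proof -
  have "finite {i. c i \<noteq> \<zero>}" using assms(1) by (simp add: free_carrier)
  moreover have "finite S \<Longrightarrow> c \<in> carrier (free X) \<Longrightarrow> {i. c i \<noteq> \<zero>} \<subseteq> S \<Longrightarrow> Q c" for S
  proof (induction S arbitrary: c rule: finite_induct)
    case empty
    then have "c = (\<lambda>i. \<zero>)" by auto
    then show ?case using assms(2) by (simp add: free_simps)
  next
    case (insert i S)
    let ?c = "c(i := \<zero>)"
    have c: "?c \<in> carrier (free X)"
      by (rule free_support_mono[OF insert(4)]) (use insert(4) in \<open>auto simp: free_carrier\<close>)
    have Q: "Q ?c" by (rule insert.IH[OF c]) (use insert.prems in auto)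
    show ?case
    proof (cases "c i = \<zero>")
      case True
      then show ?thesis using Q by (metis fun_upd_triv)
    next
      case False
      have "i \<in> X" "c i \<in> carrier K" using insert.prems False by (auto simp: free_carrier)
      moreover have "c i \<odot>\<^bsub>free X\<^esub> free_gen K i \<oplus>\<^bsub>free X\<^esub> ?c = c"
        using insert.prems by (auto simp: free_simps free_gen_def free_carrier)
      ultimately show ?thesis using assms(3)[OF _ _ c Q] by metis
    qed
  qed
  ultimately show ?thesis using assms(1) by blast
qed

definition free_lift :: "('k, 'p, 'y) module_scheme \<Rightarrow> ('i \<Rightarrow> 'p) \<Rightarrow> ('i \<Rightarrow> 'k) \<Rightarrow> 'p"
  where "free_lift P g c = (\<Oplus>\<^bsub>P\<^esub>i\<in>{i. c i \<noteq> \<zero>}. c i \<odot>\<^bsub>P\<^esub> g i)"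

text \<open>Two coefficient functions have different supports; for additivity their sums are compared over a
  common finite index set.\<close>

lemma free_lift_superset:
  assumes "module K P" "\<And>i. i \<in> X \<Longrightarrow> g i \<in> carrier P" "c \<in> carrier (free X)"
    "finite S" "{i. c i \<noteq> \<zero>} \<subseteq> S" "S \<subseteq> X"
  shows "free_lift P g c = (\<Oplus>\<^bsub>P\<^esub>i\<in>S. c i \<odot>\<^bsub>P\<^esub> g i)"
proof -
  interpret P: module K P by fact
  show ?thesis unfolding free_lift_def
    by (rule P.add.finprod_mono_neutral_cong_left) (use assms in \<open>auto simp: free_carrier\<close>)
qed

lemma free_lift_linear:
  assumes "module K P" "\<And>i. i \<in> X \<Longrightarrow> g i \<in> carrier P"
  shows "linear_map K (free X) P (free_lift P g)"
proof (rule linear_mapI)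
  interpret P: module K P by fact
  fix c d assume c: "c \<in> carrier (free X)" and d: "d \<in> carrier (free X)"
  let ?S = "{i. c i \<noteq> \<zero>} \<union> {i. d i \<noteq> \<zero>}"
  have S: "finite ?S" "?S \<subseteq> X" using c d by (auto simp: free_carrier)
  have cd: "c \<oplus>\<^bsub>free X\<^esub> d \<in> carrier (free X)"
    using free_add_closed[OF c d] by (simp add: free_simps)
  have "free_lift P g (c \<oplus>\<^bsub>free X\<^esub> d)
      = (\<Oplus>\<^bsub>P\<^esub>i\<in>?S. (c \<oplus>\<^bsub>free X\<^esub> d) i \<odot>\<^bsub>P\<^esub> g i)"
    by (rule free_lift_superset[OF assms cd S(1) _ S(2)]) (auto simp: free_simps)
  also have "\<dots> = (\<Oplus>\<^bsub>P\<^esub>i\<in>?S. c i \<odot>\<^bsub>P\<^esub> g i \<oplus>\<^bsub>P\<^esub> d i \<odot>\<^bsub>P\<^esub> g i)"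
    by (rule P.finsum_cong') (use S c d assms(2) in \<open>auto simp: free_simps free_carrier subset_iff P.smult_l_distr\<close>)
  also have "\<dots> = (\<Oplus>\<^bsub>P\<^esub>i\<in>?S. c i \<odot>\<^bsub>P\<^esub> g i) \<oplus>\<^bsub>P\<^esub> (\<Oplus>\<^bsub>P\<^esub>i\<in>?S. d i \<odot>\<^bsub>P\<^esub> g i)"
    by (rule P.finsum_addf) (use S c d assms(2) in \<open>auto simp: free_carrier subset_iff\<close>)
  also have "\<dots> = free_lift P g c \<oplus>\<^bsub>P\<^esub> free_lift P g d"
    by (subst (1 2) free_lift_superset[OF assms _ S(1) _ S(2)]) (use c d in auto)
  finally show "free_lift P g (c \<oplus>\<^bsub>free X\<^esub> d) = free_lift P g c \<oplus>\<^bsub>P\<^esub> free_lift P g d" .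
next
  interpret P: module K P by fact
  interpret F: module K "free X" by (rule free_module)
  fix a c assume a: "a \<in> carrier K" and c: "c \<in> carrier (free X)"
  let ?S = "{i. c i \<noteq> \<zero>}"
  have S: "finite ?S" "?S \<subseteq> X" using c by (auto simp: free_carrier)
  have "free_lift P g (a \<odot>\<^bsub>free X\<^esub> c) = (\<Oplus>\<^bsub>P\<^esub>i\<in>?S. (a \<odot>\<^bsub>free X\<^esub> c) i \<odot>\<^bsub>P\<^esub> g i)"
    by (rule free_lift_superset[OF assms F.smult_closed[OF a c] S(1) _ S(2)])
      (use a in \<open>auto simp: free_simps\<close>)
  also have "\<dots> = (\<Oplus>\<^bsub>P\<^esub>i\<in>?S. a \<odot>\<^bsub>P\<^esub> (c i \<odot>\<^bsub>P\<^esub> g i))"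
    by (rule P.finsum_cong') (use S a c assms(2) in \<open>auto simp: free_simps free_carrier subset_iff P.smult_assoc1\<close>)
  also have "\<dots> = a \<odot>\<^bsub>P\<^esub> free_lift P g c"
    unfolding free_lift_def
    by (rule P.finsum_smult_ldistr[symmetric]) (use S a c assms(2) in \<open>auto simp: free_carrier subset_iff\<close>)
  finally show "free_lift P g (a \<odot>\<^bsub>free X\<^esub> c) = a \<odot>\<^bsub>P\<^esub> free_lift P g c" .
next
  interpret P: module K P by fact
  fix c assume c: "c \<in> carrier (free X)"
  show "free_lift P g c \<in> carrier P"
    unfolding free_lift_def by (rule P.finsum_closed) (use c assms(2) in \<open>auto simp: free_carrier\<close>)
qed

lemma free_lift_gen:
  assumes "module K P" "\<And>i. i \<in> X \<Longrightarrow> g i \<in> carrier P" "i \<in> X"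
  shows "free_lift P g (free_gen K i) = g i"
proof -
  interpret P: module K P by fact
  have "{j. free_gen K i j \<noteq> \<zero>} = {i}" by (auto simp: free_gen_def)
  then have "free_lift P g (free_gen K i) = (\<Oplus>\<^bsub>P\<^esub>j\<in>{i}. free_gen K i j \<odot>\<^bsub>P\<^esub> g j)"
    by (simp only: free_lift_def)
  also have "\<dots> = g i" using assms(2,3) by (simp add: free_gen_def)
  finally show ?thesis .
qed

section \<open>The universal property of the tensor product\<close>

definition bilinear_map ::
  "('k, 'v, 'y1) module_scheme \<Rightarrow> ('k, 'w, 'y2) module_scheme \<Rightarrow> ('k, 'p, 'y3) module_scheme
    \<Rightarrow> ('v \<Rightarrow> 'w \<Rightarrow> 'p) \<Rightarrow> bool"
  where "bilinear_map V W P b \<longleftrightarrow>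
    (\<forall>v\<in>carrier V. linear_map K W P (b v)) \<and> (\<forall>w\<in>carrier W. linear_map K V P (\<lambda>v. b v w))"

lemma bilinear_mapD:
  assumes "bilinear_map V W P b"
  shows "v \<in> carrier V \<Longrightarrow> linear_map K W P (b v)"
    "w \<in> carrier W \<Longrightarrow> linear_map K V P (\<lambda>v. b v w)"
  using assms by (auto simp: bilinear_map_def)

lemma bilinear_mapI:
  assumes "\<And>v. v \<in> carrier V \<Longrightarrow> linear_map K W P (b v)"
    "\<And>w. w \<in> carrier W \<Longrightarrow> linear_map K V P (\<lambda>v. b v w)"
  shows "bilinear_map V W P b"
  using assms by (auto simp: bilinear_map_def)

end

locale tensor_product = ground_field K + V: module K V + W: module K W
  for K :: "('k, 'x) ring_scheme" (structure) and V :: "('k, 'v, 'y1) module_scheme"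
    and W :: "('k, 'w, 'y2) module_scheme"
begin

abbreviation F where "F \<equiv> free (carrier V \<times> carrier W)"
abbreviation N where "N \<equiv> tensor_kernel K V W"

sublocale F: module K F by (rule free_module)

lemma gen_closed: "v \<in> carrier V \<Longrightarrow> w \<in> carrier W \<Longrightarrow> free_gen K (v, w) \<in> carrier F"
  by (rule free_gen_closed) auto

lemma relations_closed: "bilinear_relations K V W \<subseteq> carrier F"
  unfolding bilinear_relations_def Let_def
  by (auto intro!: F.minus_closed F.a_closed F.smult_closed gen_closed)

lemma kernel_sub: "submodule N K F"
proof -
  let ?\<H> = "{H. submodule H K F \<and> bilinear_relations K V W \<subseteq> H}"
  have ne: "carrier F \<in> ?\<H>" using relations_closed F.carrier_is_submodule by auto
  show ?thesis
  proof (rule F.submoduleI)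
    show "N \<subseteq> carrier F" unfolding tensor_kernel_def using ne by blast
    show "\<zero>\<^bsub>F\<^esub> \<in> N" unfolding tensor_kernel_def
      using subgroup.one_closed[OF submodule.axioms(1)] by fastforce
  qed (auto simp: tensor_kernel_def dest: F.submoduleE)
qed

lemma relations_kernel: "bilinear_relations K V W \<subseteq> N"
  unfolding tensor_kernel_def by blast

sublocale Q: quotient_module K F N
  by (intro quotient_module.intro quotient_module_axioms.intro F.module_axioms kernel_sub)

lemma tensor_eq: "(V ** W) = quot_module F N" by (simp add: tensor_def)

lemma tensor_module: "module K (V ** W)"
  unfolding tensor_eq by (rule Q.quot_module)

sublocale T: module K "V ** W" by (rule tensor_module)

lemma pure_eq: "pure V W v w = N +>\<^bsub>F\<^esub> free_gen K (v, w)" by (simp add: pure_tensor_def)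

lemma relation_eq:
  assumes "x \<ominus>\<^bsub>F\<^esub> y \<in> bilinear_relations K V W" "x \<in> carrier F" "y \<in> carrier F"
  shows "N +>\<^bsub>F\<^esub> x = N +>\<^bsub>F\<^esub> y"
  using Q.proj_eq_iff[OF assms(2,3)] relations_kernel assms(1) by blast

lemma pure_closed: "v \<in> carrier V \<Longrightarrow> w \<in> carrier W \<Longrightarrow> pure V W v w \<in> carrier (V ** W)"
  unfolding tensor_eq pure_eq by (rule linear_closed[OF Q.proj_linear]) (rule gen_closed)

lemma pure_add_left:
  assumes "v \<in> carrier V" "v' \<in> carrier V" "w \<in> carrier W"
  shows "pure V W (v \<oplus>\<^bsub>V\<^esub> v') w = pure V W v w \<oplus>\<^bsub>V ** W\<^esub> pure V W v' w"
proof -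
  have "N +>\<^bsub>F\<^esub> free_gen K (v \<oplus>\<^bsub>V\<^esub> v', w) = N +>\<^bsub>F\<^esub> (free_gen K (v, w) \<oplus>\<^bsub>F\<^esub> free_gen K (v', w))"
    by (rule relation_eq, unfold bilinear_relations_def Let_def, use assms in blast)
      (use assms in \<open>simp_all add: gen_closed\<close>)
  then show ?thesis unfolding tensor_eq pure_eq using assms by (simp add: Q.quot_simps gen_closed)
qed

lemma pure_add_right:
  assumes "v \<in> carrier V" "w \<in> carrier W" "w' \<in> carrier W"
  shows "pure V W v (w \<oplus>\<^bsub>W\<^esub> w') = pure V W v w \<oplus>\<^bsub>V ** W\<^esub> pure V W v w'"
proof -
  have "N +>\<^bsub>F\<^esub> free_gen K (v, w \<oplus>\<^bsub>W\<^esub> w') = N +>\<^bsub>F\<^esub> (free_gen K (v, w) \<oplus>\<^bsub>F\<^esub> free_gen K (v, w'))"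
    by (rule relation_eq, unfold bilinear_relations_def Let_def, use assms in blast)
      (use assms in \<open>simp_all add: gen_closed\<close>)
  then show ?thesis unfolding tensor_eq pure_eq using assms by (simp add: Q.quot_simps gen_closed)
qed

lemma pure_smult_left:
  assumes "a \<in> carrier K" "v \<in> carrier V" "w \<in> carrier W"
  shows "pure V W (a \<odot>\<^bsub>V\<^esub> v) w = a \<odot>\<^bsub>V ** W\<^esub> pure V W v w"
proof -
  have "N +>\<^bsub>F\<^esub> free_gen K (a \<odot>\<^bsub>V\<^esub> v, w) = N +>\<^bsub>F\<^esub> (a \<odot>\<^bsub>F\<^esub> free_gen K (v, w))"
    by (rule relation_eq, unfold bilinear_relations_def Let_def, use assms in blast)
      (use assms in \<open>simp_all add: gen_closed\<close>)
  then show ?thesis unfolding tensor_eq pure_eq using assms by (simp add: Q.quot_simps gen_closed)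
qed

lemma pure_smult_right:
  assumes "a \<in> carrier K" "v \<in> carrier V" "w \<in> carrier W"
  shows "pure V W v (a \<odot>\<^bsub>W\<^esub> w) = a \<odot>\<^bsub>V ** W\<^esub> pure V W v w"
proof -
  have "N +>\<^bsub>F\<^esub> free_gen K (v, a \<odot>\<^bsub>W\<^esub> w) = N +>\<^bsub>F\<^esub> (a \<odot>\<^bsub>F\<^esub> free_gen K (v, w))"
    by (rule relation_eq, unfold bilinear_relations_def Let_def, use assms in blast)
      (use assms in \<open>simp_all add: gen_closed\<close>)
  then show ?thesis unfolding tensor_eq pure_eq using assms by (simp add: Q.quot_simps gen_closed)
qed

lemma pure_bilinear: "bilinear_map V W (V ** W) (pure V W)"
  by (intro bilinear_mapI linear_mapI)
    (simp_all add: pure_closed pure_add_left pure_add_right pure_smult_left pure_smult_right)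

lemma tensor_induct [consumes 1, case_names zero add]:
  assumes x: "x \<in> carrier (V ** W)"
    and zero: "Q \<zero>\<^bsub>V ** W\<^esub>"
    and add: "\<And>v w x. v \<in> carrier V \<Longrightarrow> w \<in> carrier W \<Longrightarrow> x \<in> carrier (V ** W) \<Longrightarrow> Q x \<Longrightarrow>
      Q (pure V W v w \<oplus>\<^bsub>V ** W\<^esub> x)"
  shows "Q x"
proof -
  obtain c where c: "c \<in> carrier F" "x = N +>\<^bsub>F\<^esub> c"
    using x unfolding tensor_eq by (auto simp: Q.quot_simps)
  note proj = Q.proj_linear[folded tensor_eq]
  have "Q (N +>\<^bsub>F\<^esub> c)" using c(1)
  proof (induction rule: free_induct)
    case zero
    then show ?case using assms(2) linear_zero[OF F.module_axioms T.module_axioms proj] by simp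
  next
    case (add a i c)
    obtain v w where i: "i = (v, w)" "v \<in> carrier V" "w \<in> carrier W" using add by auto
    have "N +>\<^bsub>F\<^esub> (a \<odot>\<^bsub>F\<^esub> free_gen K i \<oplus>\<^bsub>F\<^esub> c)
        = a \<odot>\<^bsub>V ** W\<^esub> (N +>\<^bsub>F\<^esub> free_gen K i) \<oplus>\<^bsub>V ** W\<^esub> (N +>\<^bsub>F\<^esub> c)"
      using add i by (simp add: linear_add[OF proj] linear_smult[OF proj] gen_closed)
    also have "a \<odot>\<^bsub>V ** W\<^esub> (N +>\<^bsub>F\<^esub> free_gen K i) = pure V W (a \<odot>\<^bsub>V\<^esub> v) w"
      using add i pure_smult_left by (simp add: pure_eq)
    finally show ?case
      using assms(3)[of "a \<odot>\<^bsub>V\<^esub> v" w, OF _ i(3) linear_closed[OF proj add(3)] add(4)] add i by simp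
  qed
  then show ?thesis using c by simp
qed

context
  fixes P :: "('k, 'p, 'y3) module_scheme" and b
  assumes P: "module K P" and b: "bilinear_map V W P b"
begin

interpretation P: module K P by (rule P)

abbreviation "L \<equiv> free_lift P (\<lambda>i. b (fst i) (snd i))"

lemma b_closed: "v \<in> carrier V \<Longrightarrow> w \<in> carrier W \<Longrightarrow> b v w \<in> carrier P"
  using linear_closed[OF bilinear_mapD(1)[OF b]] by auto

lemma L_linear: "linear_map K F P L"
  by (rule free_lift_linear[OF P]) (auto intro: b_closed)

lemma L_gen: "v \<in> carrier V \<Longrightarrow> w \<in> carrier W \<Longrightarrow> L (free_gen K (v, w)) = b v w"
  by (subst free_lift_gen[OF P, where X = "carrier V \<times> carrier W"]) (auto intro: b_closed)

text \<open>The kernel of the linear extension is one of the submodules that \<open>tensor_kernel\<close> intersects.\<close>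

lemma L_kernel: "n \<in> N \<Longrightarrow> L n = \<zero>\<^bsub>P\<^esub>"
proof -
  let ?H = "{x \<in> carrier F. L x = \<zero>\<^bsub>P\<^esub>}"
  have "submodule ?H K F" by (rule kernel_submodule[OF F.module_axioms P L_linear])
  moreover have "bilinear_relations K V W \<subseteq> ?H"
  proof
    fix r assume r: "r \<in> bilinear_relations K V W"
    then have "r \<in> carrier F" using relations_closed by auto
    moreover have "L r = \<zero>\<^bsub>P\<^esub>"
      using r unfolding bilinear_relations_def Let_def
      by (auto simp: linear_minus[OF F.module_axioms P L_linear] linear_add[OF L_linear]
          linear_smult[OF L_linear] gen_closed L_gen b_closed P.minus_eq_zero_iff
          linear_add[OF bilinear_mapD(1)[OF b]] linear_smult[OF bilinear_mapD(1)[OF b]]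
          linear_add[OF bilinear_mapD(2)[OF b]] linear_smult[OF bilinear_mapD(2)[OF b]])
    ultimately show "r \<in> ?H" by auto
  qed
  ultimately show "n \<in> N \<Longrightarrow> L n = \<zero>\<^bsub>P\<^esub>" unfolding tensor_kernel_def by auto
qed

lemma tensor_lift_coset: "c \<in> carrier F \<Longrightarrow> tensor_lift K P b (N +>\<^bsub>F\<^esub> c) = L c"
  using Q.linear_some_rep[OF P L_linear L_kernel]
  by (simp add: tensor_lift_def free_lift_def Let_def)

lemma tensor_lift_pure:
  "v \<in> carrier V \<Longrightarrow> w \<in> carrier W \<Longrightarrow> tensor_lift K P b (pure V W v w) = b v w"
  by (simp add: pure_eq tensor_lift_coset gen_closed L_gen)

lemma tensor_lift_linear: "linear_map K (V ** W) P (tensor_lift K P b)"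
  unfolding tensor_eq
proof (rule linear_mapI)
  fix x y assume "x \<in> carrier (Q.Q)" "y \<in> carrier (Q.Q)"
  then show "tensor_lift K P b (x \<oplus>\<^bsub>Q.Q\<^esub> y) = tensor_lift K P b x \<oplus>\<^bsub>P\<^esub> tensor_lift K P b y"
    by (auto simp: Q.quot_simps tensor_lift_coset linear_add[OF L_linear])
next
  fix a x assume "a \<in> carrier K" "x \<in> carrier (Q.Q)"
  then show "tensor_lift K P b (a \<odot>\<^bsub>Q.Q\<^esub> x) = a \<odot>\<^bsub>P\<^esub> tensor_lift K P b x"
    by (auto simp: Q.quot_simps tensor_lift_coset linear_smult[OF L_linear])
next
  fix x assume "x \<in> carrier (Q.Q)"
  then show "tensor_lift K P b x \<in> carrier P"
    by (auto simp: Q.quot_simps tensor_lift_coset linear_closed[OF L_linear])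
qed

end

end

context ground_field
begin

text \<open>With the module structures bundled in, the rules for composites and tensor products of maps have
  no premises besides linearity of the constituents.\<close>

definition lin :: "('k, 'v, 'y1) module_scheme \<Rightarrow> ('k, 'w, 'y2) module_scheme \<Rightarrow> ('v \<Rightarrow> 'w) \<Rightarrow> bool"
  where "lin V W f \<longleftrightarrow> module K V \<and> module K W \<and> linear_map K V W f"

abbreviation \<k> :: "('k, 'k) module" where "\<k> \<equiv> self_module K"

lemma linD:
  assumes "lin V W f"
  shows "module K V" "module K W" "linear_map K V W f"
  using assms by (auto simp: lin_def)

lemma linI: "module K V \<Longrightarrow> module K W \<Longrightarrow> linear_map K V W f \<Longrightarrow> lin V W f"
  by (auto simp: lin_def)

lemma
  assumes "lin V W f"
  shows lin_closed: "x \<in> carrier V \<Longrightarrow> f x \<in> carrier W"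
    and lin_add: "x \<in> carrier V \<Longrightarrow> y \<in> carrier V \<Longrightarrow> f (x \<oplus>\<^bsub>V\<^esub> y) = f x \<oplus>\<^bsub>W\<^esub> f y"
    and lin_smult: "a \<in> carrier K \<Longrightarrow> x \<in> carrier V \<Longrightarrow> f (a \<odot>\<^bsub>V\<^esub> x) = a \<odot>\<^bsub>W\<^esub> f x"
    and lin_zero: "f \<zero>\<^bsub>V\<^esub> = \<zero>\<^bsub>W\<^esub>"
    and lin_minus: "x \<in> carrier V \<Longrightarrow> y \<in> carrier V \<Longrightarrow> f (x \<ominus>\<^bsub>V\<^esub> y) = f x \<ominus>\<^bsub>W\<^esub> f y"
  using linear_closed[OF linD(3)[OF assms]] linear_add[OF linD(3)[OF assms]]
    linear_smult[OF linD(3)[OF assms]] linear_zero[OF linD[OF assms]] linear_minus[OF linD[OF assms]]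
  by simp_all

lemma self_mod: "module K \<k>"
  by (rule self_module_module) (rule is_cring)

lemma lin_id: "module K V \<Longrightarrow> lin V V id"
  by (intro linI linear_mapI) auto

lemma lin_comp: "lin V W g \<Longrightarrow> lin U V f \<Longrightarrow> lin U W (g \<circ> f)"
  by (auto simp: lin_def linear_map_def Pi_iff)

lemma lin_cong:
  assumes f: "lin V W f" and g: "\<And>x. x \<in> carrier V \<Longrightarrow> g x = f x"
  shows "lin V W g"
proof -
  interpret V: module K V by (rule linD[OF f])
  show ?thesis using f unfolding lin_def linear_map_def by (auto simp: g)
qed

context
  fixes V :: "('k, 'v, 'y1) module_scheme" and W :: "('k, 'w, 'y2) module_scheme" and f
  assumes f: "lin V W f"
begin

interpretation W: module K W by (rule linD[OF f])

lemma lin_plus: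
  assumes g: "lin V W g"
  shows "lin V W (\<lambda>x. f x \<oplus>\<^bsub>W\<^esub> g x)"
  using lin_closed[OF f] lin_closed[OF g]
  by (intro linI linD[OF f] linear_mapI)
    (auto simp: lin_add[OF f] lin_add[OF g] lin_smult[OF f] lin_smult[OF g] W.smult_r_distr W.add.m_ac)

lemma lin_diff:
  assumes g: "lin V W g"
  shows "lin V W (\<lambda>x. f x \<ominus>\<^bsub>W\<^esub> g x)"
  using lin_closed[OF f] lin_closed[OF g]
  by (intro linI linD[OF f] linear_mapI)
    (auto simp: lin_add[OF f] lin_add[OF g] lin_smult[OF f] lin_smult[OF g] W.smult_r_distr
      W.smult_r_minus W.add.m_ac a_minus_def W.minus_add)

lemma lin_const_smult: "a \<in> carrier K \<Longrightarrow> lin V W (\<lambda>x. a \<odot>\<^bsub>W\<^esub> f x)"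
  using lin_closed[OF f]
  by (intro linI linD[OF f] linear_mapI)
    (auto simp: lin_add[OF f] lin_smult[OF f] W.smult_r_distr W.smult_assoc1[symmetric] m_comm)

end

lemma lin_zero_map:
  assumes "module K V" "module K W"
  shows "lin V W (\<lambda>x. \<zero>\<^bsub>W\<^esub>)"
proof -
  interpret W: module K W by fact
  show ?thesis by (intro linI assms linear_mapI) auto
qed

lemma lin_smult_fun:
  assumes "lin V \<k> f" "module K W" "w \<in> carrier W"
  shows "lin V W (\<lambda>v. f v \<odot>\<^bsub>W\<^esub> w)"
proof -
  interpret W: module K W by fact
  have c: "f x \<in> carrier K" if "x \<in> carrier V" for x using lin_closed[OF assms(1) that] by simp
  show ?thesis
    using assms(3) lin_add[OF assms(1)] lin_smult[OF assms(1)] c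
    by (intro linI linD(1)[OF assms(1)] assms(2) linear_mapI)
      (auto simp: W.smult_l_distr W.smult_assoc1)
qed

lemma sub_mod: "submodule H K V \<Longrightarrow> module K V \<Longrightarrow> module K (V\<lparr>carrier := H\<rparr>)"
  by (rule submodule.submodule_is_module)

lemma lin_incl: "submodule H K V \<Longrightarrow> module K V \<Longrightarrow> lin (V\<lparr>carrier := H\<rparr>) V id"
  by (auto simp: lin_def intro: sub_mod submodule_incl)

section \<open>Maps between tensor products\<close>

lemma tensor_product: "module K V \<Longrightarrow> module K W \<Longrightarrow> tensor_product K V W"
  by (simp add: tensor_product_def ground_field_axioms)

lemmas tensor_induct = tensor_product.tensor_induct[OF tensor_product, consumes 3, case_names zero add]

lemma tensor_mod: "module K V \<Longrightarrow> module K W \<Longrightarrow> module K (V ** W)"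
  by (rule tensor_product.tensor_module[OF tensor_product])

lemma pure_mem:
  "module K V \<Longrightarrow> module K W \<Longrightarrow> v \<in> carrier V \<Longrightarrow> w \<in> carrier W \<Longrightarrow>
    pure V W v w \<in> carrier (V ** W)"
  by (rule tensor_product.pure_closed[OF tensor_product])

lemma pure_bilin:
  "module K V \<Longrightarrow> module K W \<Longrightarrow> bilinear_map V W (V ** W) (pure V W)"
  by (rule tensor_product.pure_bilinear[OF tensor_product])

lemma
  assumes "module K V" "module K W"
  shows pure_lin_right: "v \<in> carrier V \<Longrightarrow> lin W (V ** W) (pure V W v)"
    and pure_lin_left: "w \<in> carrier W \<Longrightarrow> lin V (V ** W) (\<lambda>v. pure V W v w)"
  using bilinear_mapD[OF pure_bilin[OF assms]] assms tensor_mod[OF assms] by (simp_all add: lin_def)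

lemma lift_lin:
  "module K V \<Longrightarrow> module K W \<Longrightarrow> module K P \<Longrightarrow> bilinear_map V W P b \<Longrightarrow>
    lin (V ** W) P (tensor_lift K P b)"
  by (intro linI tensor_mod tensor_product.tensor_lift_linear[OF tensor_product])

lemma lift_pure:
  "module K V \<Longrightarrow> module K W \<Longrightarrow> module K P \<Longrightarrow> bilinear_map V W P b \<Longrightarrow>
    v \<in> carrier V \<Longrightarrow> w \<in> carrier W \<Longrightarrow> tensor_lift K P b (pure V W v w) = b v w"
  by (rule tensor_product.tensor_lift_pure[OF tensor_product])

lemma tensor_ext:
  assumes f: "lin (V ** W) P f" and g: "lin (V ** W) P g"
    and mods: "module K V" "module K W"
    and eq: "\<And>v w. v \<in> carrier V \<Longrightarrow> w \<in> carrier W \<Longrightarrow> f (pure V W v w) = g (pure V W v w)"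
    and x: "x \<in> carrier (V ** W)"
  shows "f x = g x"
  using tensor_product.tensor_induct[OF tensor_product[OF mods] x, of "\<lambda>x. f x = g x"]
  by (simp add: lin_zero[OF f] lin_zero[OF g] lin_add[OF f] lin_add[OF g] pure_mem mods eq)

lemma tensor_ext3:
  assumes f: "lin (U ** V ** W) P f" and g: "lin (U ** V ** W) P g"
    and mods: "module K U" "module K V" "module K W"
    and eq: "\<And>u v w. u \<in> carrier U \<Longrightarrow> v \<in> carrier V \<Longrightarrow> w \<in> carrier W \<Longrightarrow>
      f (pure (U ** V) W (pure U V u v) w) =
      g (pure (U ** V) W (pure U V u v) w)"
    and x: "x \<in> carrier (U ** V ** W)"
  shows "f x = g x"
proof (rule tensor_ext[OF f g tensor_mod[OF mods(1,2)] mods(3) _ x])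
  fix t w assume t: "t \<in> carrier (U ** V)" and w: "w \<in> carrier W"
  note p = pure_lin_left[OF tensor_mod[OF mods(1,2)] mods(3) w]
  show "f (pure (U ** V) W t w) = g (pure (U ** V) W t w)"
    using tensor_ext[OF lin_comp[OF f p] lin_comp[OF g p] mods(1,2) _ t] eq w by simp
qed

lemma tmap_bilin:
  assumes f: "lin V V' f" and g: "lin W W' g"
  shows "bilinear_map V W (V' ** W') (\<lambda>v w. pure V' W' (f v) (g w))"
proof (rule bilinear_mapI)
  note m = linD[OF f] linD[OF g]
  fix v assume "v \<in> carrier V"
  then have "lin W (V' ** W') (pure V' W' (f v) \<circ> g)"
    by (intro lin_comp[OF _ g] pure_lin_right m lin_closed[OF f])
  then show "linear_map K W (V' ** W') (\<lambda>w. pure V' W' (f v) (g w))"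
    by (auto dest: linD simp: comp_def)
next
  note m = linD[OF f] linD[OF g]
  fix w assume "w \<in> carrier W"
  then have "lin V (V' ** W') ((\<lambda>v. pure V' W' v (g w)) \<circ> f)"
    by (intro lin_comp[OF _ f] pure_lin_left m lin_closed[OF g])
  then show "linear_map K V (V' ** W') (\<lambda>v. pure V' W' (f v) (g w))"
    by (auto dest: linD simp: comp_def)
qed

lemma lin_tmap:
  assumes "lin V V' f" "lin W W' g"
  shows "lin (V ** W) (V' ** W') (tmap V' W' f g)"
  unfolding tensor_map_def
  by (intro lift_lin tmap_bilin tensor_mod assms linD(1,2)[OF assms(1)] linD(1,2)[OF assms(2)])

lemma tmap_pure:
  assumes "lin V V' f" "lin W W' g" "v \<in> carrier V" "w \<in> carrier W"
  shows "tmap V' W' f g (pure V W v w) = pure V' W' (f v) (g w)"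
  unfolding tensor_map_def
  by (rule lift_pure)
    (intro tmap_bilin tensor_mod assms linD(1,2)[OF assms(1)] linD(1,2)[OF assms(2)])+

lemma tmap_comp:
  assumes f: "lin V V' f" and g: "lin W W' g" and f': "lin V' V'' f'" and g': "lin W' W'' g'"
    and x: "x \<in> carrier (V ** W)"
  shows "tmap V'' W'' f' g' (tmap V' W' f g x) =
    tmap V'' W'' (f' \<circ> f) (g' \<circ> g) x"
proof -
  have "(tmap V'' W'' f' g' \<circ> tmap V' W' f g) x =
    tmap V'' W'' (f' \<circ> f) (g' \<circ> g) x"
    by (rule tensor_ext[OF lin_comp[OF lin_tmap[OF f' g'] lin_tmap[OF f g]]
          lin_tmap[OF lin_comp[OF f' f] lin_comp[OF g' g]] linD(1)[OF f] linD(1)[OF g] _ x])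
      (simp add: tmap_pure[OF f g] tmap_pure[OF f' g'] lin_closed[OF f] lin_closed[OF g]
        tmap_pure[OF lin_comp[OF f' f] lin_comp[OF g' g]])
  then show ?thesis by simp
qed

lemma tmap_id:
  assumes "module K V" "module K W" "x \<in> carrier (V ** W)"
  shows "tmap V W id id x = x"
proof -
  have "tmap V W id id x = id x"
    by (rule tensor_ext[OF lin_tmap[OF lin_id lin_id] lin_id[OF tensor_mod] assms(1,2) _ assms(3)])
      (simp_all add: assms tmap_pure[OF lin_id lin_id])
  then show ?thesis by simp
qed

lemma tmap_cong:
  assumes f: "lin V V' f" and g: "lin W W' g"
    and "\<And>v. v \<in> carrier V \<Longrightarrow> f v = f' v" "\<And>w. w \<in> carrier W \<Longrightarrow> g w = g' w"
    and x: "x \<in> carrier (V ** W)"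
  shows "tmap V' W' f g x = tmap V' W' f' g' x"
proof -
  have f': "lin V V' f'" and g': "lin W W' g'" using lin_cong f g assms(3,4) by metis+
  show ?thesis
    by (rule tensor_ext[OF lin_tmap[OF f g] lin_tmap[OF f' g'] linD(1)[OF f] linD(1)[OF g] _ x])
      (simp add: tmap_pure[OF f g] tmap_pure[OF f' g'] assms(3,4))
qed

lemma tmap_zero_left:
  assumes "lin V V' f" "lin W W' g" "x \<in> carrier (V ** W)" "\<And>v. v \<in> carrier V \<Longrightarrow> f v = \<zero>\<^bsub>V'\<^esub>"
  shows "tmap V' W' f g x = \<zero>\<^bsub>V' ** W'\<^esub>"
proof -
  note m = linD[OF assms(1)] linD[OF assms(2)]
  show ?thesis
    by (rule tensor_ext[OF lin_tmap[OF assms(1,2)] lin_zero_map m(1,4) _ assms(3)])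
      (auto simp: tmap_pure[OF assms(1,2)] assms(4) lin_zero[OF pure_lin_left[OF m(2,5)]] lin_closed[OF assms(2)]
        intro!: tensor_mod m)
qed

lemma tmap_zero_right:
  assumes "lin V V' f" "lin W W' g" "x \<in> carrier (V ** W)" "\<And>w. w \<in> carrier W \<Longrightarrow> g w = \<zero>\<^bsub>W'\<^esub>"
  shows "tmap V' W' f g x = \<zero>\<^bsub>V' ** W'\<^esub>"
proof -
  note m = linD[OF assms(1)] linD[OF assms(2)]
  show ?thesis
    by (rule tensor_ext[OF lin_tmap[OF assms(1,2)] lin_zero_map m(1,4) _ assms(3)])
      (auto simp: tmap_pure[OF assms(1,2)] assms(4) lin_zero[OF pure_lin_right[OF m(2,5)]] lin_closed[OF assms(1)]
        intro!: tensor_mod m)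
qed

lemma tmap_diff_left:
  assumes f: "lin V V' f" and f': "lin V V' f'" and g: "lin W W' g" and x: "x \<in> carrier (V ** W)"
  shows "tmap V' W' (\<lambda>v. f v \<ominus>\<^bsub>V'\<^esub> f' v) g x =
    tmap V' W' f g x \<ominus>\<^bsub>V' ** W'\<^esub> tmap V' W' f' g x"
  by (rule tensor_ext[OF lin_tmap[OF lin_diff[OF f f'] g] lin_diff[OF lin_tmap[OF f g] lin_tmap[OF f' g]]
        linD(1)[OF f] linD(1)[OF g] _ x])
    (simp add: tmap_pure[OF f g] tmap_pure[OF f' g] tmap_pure[OF lin_diff[OF f f'] g]
      lin_minus[OF pure_lin_left] linD[OF f] linD[OF g] lin_closed[OF f] lin_closed[OF f'] lin_closed[OF g])

lemma tmap_plus_right: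
  assumes f: "lin V V' f" and g: "lin W W' g" and g': "lin W W' g'" and x: "x \<in> carrier (V ** W)"
  shows "tmap V' W' f (\<lambda>w. g w \<oplus>\<^bsub>W'\<^esub> g' w) x =
    tmap V' W' f g x \<oplus>\<^bsub>V' ** W'\<^esub> tmap V' W' f g' x"
  by (rule tensor_ext[OF lin_tmap[OF f lin_plus[OF g g']] lin_plus[OF lin_tmap[OF f g] lin_tmap[OF f g']]
        linD(1)[OF f] linD(1)[OF g] _ x])
    (simp add: tmap_pure[OF f g] tmap_pure[OF f g'] tmap_pure[OF f lin_plus[OF g g']]
      lin_add[OF pure_lin_right] linD[OF f] linD[OF g] lin_closed[OF f] lin_closed[OF g] lin_closed[OF g'])

lemma tmap_diff_right:
  assumes f: "lin V V' f" and g: "lin W W' g" and g': "lin W W' g'" and x: "x \<in> carrier (V ** W)"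
  shows "tmap V' W' f (\<lambda>w. g w \<ominus>\<^bsub>W'\<^esub> g' w) x =
    tmap V' W' f g x \<ominus>\<^bsub>V' ** W'\<^esub> tmap V' W' f g' x"
  by (rule tensor_ext[OF lin_tmap[OF f lin_diff[OF g g']] lin_diff[OF lin_tmap[OF f g] lin_tmap[OF f g']]
        linD(1)[OF f] linD(1)[OF g] _ x])
    (simp add: tmap_pure[OF f g] tmap_pure[OF f g'] tmap_pure[OF f lin_diff[OF g g']]
      lin_minus[OF pure_lin_right] linD[OF f] linD[OF g] lin_closed[OF f] lin_closed[OF g] lin_closed[OF g'])

section \<open>The associator\<close>

context
  fixes U :: "('k, 'u, 'y1) module_scheme" and V :: "('k, 'v, 'y2) module_scheme"
    and W :: "('k, 'w, 'y3) module_scheme"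
  assumes U: "module K U" and V: "module K V" and W: "module K W"
begin

private abbreviation "TT \<equiv> (U ** (V ** W))"
private abbreviation "inner w \<equiv> tensor_lift K TT (\<lambda>u v. pure U (V ** W) u (pure V W v w))"

private lemma inner_bilin:
  assumes "w \<in> carrier W"
  shows "bilinear_map U V TT (\<lambda>u v. pure U (V ** W) u (pure V W v w))"
  using tmap_bilin[OF lin_id[OF U] pure_lin_left[OF V W assms]] by simp

private lemma inner_lin: "w \<in> carrier W \<Longrightarrow> lin (U ** V) TT (inner w)"
  by (intro lift_lin inner_bilin tensor_mod U V W)

private lemma inner_pure:
  "w \<in> carrier W \<Longrightarrow> u \<in> carrier U \<Longrightarrow> v \<in> carrier V \<Longrightarrow>
    inner w (pure U V u v) = pure U (V ** W) u (pure V W v w)"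
  by (rule lift_pure) (intro inner_bilin tensor_mod U V W | assumption)+

private lemma outer_bilin: "bilinear_map (U ** V) W TT (\<lambda>t w. inner w t)"
proof (rule bilinear_mapI)
  note pr = pure_lin_right[OF V W] and PR = pure_lin_right[OF U tensor_mod[OF V W]]
  fix t assume t: "t \<in> carrier (U ** V)"
  show "linear_map K W TT (\<lambda>w. inner w t)"
  proof (rule linear_mapI)
    fix w w' assume w: "w \<in> carrier W" "w' \<in> carrier W"
    then have ww: "w \<oplus>\<^bsub>W\<^esub> w' \<in> carrier W"
      using W by (simp add: module.axioms(2) abelian_group.axioms(1) abelian_monoid.a_closed)
    show "inner (w \<oplus>\<^bsub>W\<^esub> w') t = inner w t \<oplus>\<^bsub>TT\<^esub> inner w' t"
      by (rule tensor_ext[OF inner_lin[OF ww] lin_plus[OF inner_lin[OF w(1)] inner_lin[OF w(2)]] U V _ t])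
        (simp add: inner_pure w ww lin_add[OF pr] lin_add[OF PR] pure_mem V W)
  next
    fix a w assume w: "a \<in> carrier K" "w \<in> carrier W"
    then have aw: "a \<odot>\<^bsub>W\<^esub> w \<in> carrier W" using module.smult_closed[OF W] by auto
    show "inner (a \<odot>\<^bsub>W\<^esub> w) t = a \<odot>\<^bsub>TT\<^esub> inner w t"
      by (rule tensor_ext[OF inner_lin[OF aw] lin_const_smult[OF inner_lin[OF w(2)] w(1)] U V _ t])
        (simp add: inner_pure w aw lin_smult[OF pr] lin_smult[OF PR] pure_mem V W)
  qed (use t lin_closed[OF inner_lin] in blast)
qed (use inner_lin linD in blast)

lemma lin_assoc: "lin (U ** V ** W) (U ** (V ** W)) (assoc U V W)"
  unfolding tensor_assoc_def Let_def by (intro lift_lin outer_bilin tensor_mod U V W)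

lemma assoc_pure:
  assumes "u \<in> carrier U" "v \<in> carrier V" "w \<in> carrier W"
  shows "assoc U V W (pure (U ** V) W (pure U V u v) w) =
    pure U (V ** W) u (pure V W v w)"
  unfolding tensor_assoc_def Let_def
  by (subst lift_pure[OF tensor_mod[OF U V] W tensor_mod[OF U tensor_mod[OF V W]] outer_bilin])
    (simp_all add: assms inner_pure pure_mem U V)

text \<open>Surjectivity replaces an explicit inverse: it suffices to lift an element through the associator
  before slicing it.\<close>

lemma assoc_surj:
  assumes "x \<in> carrier (U ** (V ** W))"
  shows "\<exists>y\<in>carrier (U ** V ** W). assoc U V W y = x"
proof -
  let ?S = "assoc U V W ` carrier (U ** V ** W)"
  interpret TT: module K TT by (intro tensor_mod U V W)
  have S: "submodule ?S K TT" using image_submodule linD[OF lin_assoc] by blast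
  have "pure U (V ** W) u t \<in> ?S" if u: "u \<in> carrier U" and t: "t \<in> carrier (V ** W)" for u t
    using V W t
  proof (induction rule: tensor_induct)
    case zero
    then show ?case
      using TT.submoduleE(2)[OF S] S subgroup.one_closed[OF submodule.axioms(1)[OF S]]
      by (simp add: lin_zero[OF pure_lin_right[OF U tensor_mod[OF V W] u]])
  next
    case (add v w x)
    have "pure U (V ** W) u (pure V W v w) \<in> ?S"
      using assoc_pure[OF u add(1,2)] pure_mem[OF tensor_mod[OF U V] W pure_mem[OF U V u add(1)] add(2)]
      by (metis image_eqI)
    then show ?case
      using add TT.submoduleE(5)[OF S]
      by (simp add: lin_add[OF pure_lin_right[OF U tensor_mod[OF V W] u]] pure_mem V W)
  qed
  note pure = this
  have "x \<in> ?S" using U tensor_mod[OF V W] assms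
    by (induction rule: tensor_induct)
      (use subgroup.one_closed[OF submodule.axioms(1)[OF S]] TT.submoduleE(5)[OF S] pure in auto)
  then show ?thesis by force
qed

end

lemma assoc_natural:
  assumes f: "lin U U' f" and g: "lin V V' g" and h: "lin W W' h"
    and x: "x \<in> carrier (U ** V ** W)"
  shows "assoc U' V' W' (tmap (U' ** V') W' (tmap U' V' f g) h x) =
    tmap U' (V' ** W') f (tmap V' W' g h) (assoc U V W x)"
proof -
  note m = linD(1)[OF f] linD(1)[OF g] linD(1)[OF h] and m' = linD(2)[OF f] linD(2)[OF g] linD(2)[OF h]
  note fg = lin_tmap[OF f g] and gh = lin_tmap[OF g h]
  have "(assoc U' V' W' \<circ> tmap (U' ** V') W' (tmap U' V' f g) h) x =
    (tmap U' (V' ** W') f (tmap V' W' g h) \<circ> assoc U V W) x"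
    by (rule tensor_ext3[OF lin_comp[OF lin_assoc[OF m'] lin_tmap[OF fg h]]
          lin_comp[OF lin_tmap[OF f gh] lin_assoc[OF m]] m _ x])
      (simp add: tmap_pure[OF f g] tmap_pure[OF g h] tmap_pure[OF fg h] tmap_pure[OF f gh]
        assoc_pure m m' pure_mem lin_closed[OF f] lin_closed[OF g] lin_closed[OF h])
  then show ?thesis by simp
qed

section \<open>Slices\<close>

text \<open>\<open>slR V \<phi>\<close> and \<open>slL W \<phi>\<close> are \<open>id \<otimes> \<phi>\<close> and \<open>\<phi> \<otimes> id\<close> with the ground field cancelled. They are written with
  the unit isomorphisms so that the counit axioms and the cotensor product of a map with a character
  are literally slices.\<close>

definition slR :: "('k, 'v, 'y1) module_scheme \<Rightarrow> ('w \<Rightarrow> 'k) \<Rightarrow> ('v \<times> 'w \<Rightarrow> 'k) set \<Rightarrow> 'v"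
  where "slR V \<phi> t = right_unit K V (tmap V \<k> id \<phi> t)"

definition slL :: "('k, 'w, 'y1) module_scheme \<Rightarrow> ('v \<Rightarrow> 'k) \<Rightarrow> ('v \<times> 'w \<Rightarrow> 'k) set \<Rightarrow> 'w"
  where "slL W \<phi> t = left_unit K W (tmap \<k> W \<phi> id t)"

lemma smult_bilin:
  assumes "module K V"
  shows "bilinear_map V \<k> V (\<lambda>v a. a \<odot>\<^bsub>V\<^esub> v)" "bilinear_map \<k> V V (\<lambda>a v. a \<odot>\<^bsub>V\<^esub> v)"
  using linD(3)[OF lin_smult_fun[OF lin_id[OF self_mod] assms]]
    linD(3)[OF lin_const_smult[OF lin_id[OF assms]]]
  by (auto intro!: bilinear_mapI)

lemma lin_right_unit: "module K V \<Longrightarrow> lin (V ** \<k>) V (right_unit K V)"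
  unfolding right_unit_def by (intro lift_lin self_mod smult_bilin)

lemma lin_left_unit: "module K V \<Longrightarrow> lin (\<k> ** V) V (left_unit K V)"
  unfolding left_unit_def by (intro lift_lin self_mod smult_bilin)

lemma right_unit_pure:
  "module K V \<Longrightarrow> v \<in> carrier V \<Longrightarrow> a \<in> carrier K \<Longrightarrow> right_unit K V (pure V \<k> v a) = a \<odot>\<^bsub>V\<^esub> v"
  unfolding right_unit_def by (subst lift_pure) (auto intro: self_mod smult_bilin)

lemma left_unit_pure:
  "module K V \<Longrightarrow> v \<in> carrier V \<Longrightarrow> a \<in> carrier K \<Longrightarrow> left_unit K V (pure \<k> V a v) = a \<odot>\<^bsub>V\<^esub> v"
  unfolding left_unit_def by (subst lift_pure) (auto intro: self_mod smult_bilin)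

lemma lin_slR: "module K V \<Longrightarrow> lin W \<k> \<phi> \<Longrightarrow> lin (V ** W) V (slR V \<phi>)"
  using lin_comp[OF lin_right_unit lin_tmap[OF lin_id]] unfolding slR_def comp_def .

lemma lin_slL: "module K W \<Longrightarrow> lin V \<k> \<phi> \<Longrightarrow> lin (V ** W) W (slL W \<phi>)"
  using lin_comp[OF lin_left_unit lin_tmap[OF _ lin_id]] unfolding slL_def comp_def .

lemma slR_pure:
  "module K V \<Longrightarrow> lin W \<k> \<phi> \<Longrightarrow> v \<in> carrier V \<Longrightarrow> w \<in> carrier W \<Longrightarrow>
    slR V \<phi> (pure V W v w) = \<phi> w \<odot>\<^bsub>V\<^esub> v"
  unfolding slR_def using lin_closed[of W \<k> \<phi> w]
  by (simp add: tmap_pure[OF lin_id] right_unit_pure)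

lemma slL_pure:
  "module K W \<Longrightarrow> lin V \<k> \<phi> \<Longrightarrow> v \<in> carrier V \<Longrightarrow> w \<in> carrier W \<Longrightarrow>
    slL W \<phi> (pure V W v w) = \<phi> v \<odot>\<^bsub>W\<^esub> w"
  unfolding slL_def using lin_closed[of V \<k> \<phi> v]
  by (simp add: tmap_pure[OF _ lin_id] left_unit_pure)

lemma slR_tmap:
  assumes f: "lin V V' f" and g: "lin W W' g" and p: "lin W' \<k> \<phi>" and x: "x \<in> carrier (V ** W)"
  shows "slR V' \<phi> (tmap V' W' f g x) = f (slR V (\<phi> \<circ> g) x)"
proof -
  note m = linD[OF f] linD[OF g] and pg = lin_comp[OF p g]
  have c: "\<phi> (g w) \<in> carrier K" if "w \<in> carrier W" for w using lin_closed[OF pg that] by simp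
  have "(slR V' \<phi> \<circ> tmap V' W' f g) x = (f \<circ> slR V (\<phi> \<circ> g)) x"
    by (rule tensor_ext[OF lin_comp[OF lin_slR[OF m(2) p] lin_tmap[OF f g]]
          lin_comp[OF f lin_slR[OF m(1) pg]] m(1,4) _ x])
      (simp add: tmap_pure[OF f g] slR_pure[OF m(2) p] slR_pure[OF m(1) pg] c lin_smult[OF f]
        lin_closed[OF f] lin_closed[OF g])
  then show ?thesis by simp
qed

lemma slL_tmap:
  assumes f: "lin V V' f" and g: "lin W W' g" and p: "lin V' \<k> \<phi>" and x: "x \<in> carrier (V ** W)"
  shows "slL W' \<phi> (tmap V' W' f g x) = g (slL W (\<phi> \<circ> f) x)"
proof -
  note m = linD[OF f] linD[OF g] and pg = lin_comp[OF p f]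
  have c: "\<phi> (f w) \<in> carrier K" if "w \<in> carrier V" for w using lin_closed[OF pg that] by simp
  have "(slL W' \<phi> \<circ> tmap V' W' f g) x = (g \<circ> slL W (\<phi> \<circ> f)) x"
    by (rule tensor_ext[OF lin_comp[OF lin_slL[OF m(5) p] lin_tmap[OF f g]]
          lin_comp[OF g lin_slL[OF m(4) pg]] m(1,4) _ x])
      (simp add: tmap_pure[OF f g] slL_pure[OF m(5) p] slL_pure[OF m(4) pg] c lin_smult[OF g]
        lin_closed[OF f] lin_closed[OF g])
  then show ?thesis by simp
qed

lemma left_unit_tmap:
  assumes p: "lin V \<k> \<phi>" and g: "lin W W' g" and x: "x \<in> carrier (V ** W)"
  shows "left_unit K W' (tmap \<k> W' \<phi> g x) = g (slL W \<phi> x)"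
  using slL_tmap[OF p g lin_id[OF self_mod] x]
    tmap_id[OF self_mod linD(2)[OF g] lin_closed[OF lin_tmap[OF p g] x]] by (simp add: slL_def)

lemma right_unit_tmap:
  assumes g: "lin V V' g" and p: "lin W \<k> \<phi>" and x: "x \<in> carrier (V ** W)"
  shows "right_unit K V' (tmap V' \<k> g \<phi> x) = g (slR V \<phi> x)"
  using slR_tmap[OF g p lin_id[OF self_mod] x]
    tmap_id[OF linD(2)[OF g] self_mod lin_closed[OF lin_tmap[OF g p] x]] by (simp add: slR_def)

lemma slR_cong:
  assumes "module K V" "lin W \<k> \<phi>" "\<And>w. w \<in> carrier W \<Longrightarrow> \<phi> w = \<psi> w" "x \<in> carrier (V ** W)"
  shows "slR V \<phi> x = slR V \<psi> x"
  unfolding slR_def by (subst tmap_cong[OF lin_id assms(2) _ assms(3) assms(4)]) (auto simp: assms)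

lemma slice_slice:
  assumes p: "lin V \<k> \<xi>" and q: "lin W \<k> \<phi>" and x: "x \<in> carrier (V ** W)"
  shows "\<xi> (slR V \<phi> x) = \<phi> (slL W \<xi> x)"
proof -
  note m = linD(1)[OF p] linD(1)[OF q]
  have c: "\<phi> w \<in> carrier K" if "w \<in> carrier W" for w using lin_closed[OF q that] by simp
  have d: "\<xi> w \<in> carrier K" if "w \<in> carrier V" for w using lin_closed[OF p that] by simp
  have "(\<xi> \<circ> slR V \<phi>) x = (\<phi> \<circ> slL W \<xi>) x"
    by (rule tensor_ext[OF lin_comp[OF p lin_slR[OF m(1) q]] lin_comp[OF q lin_slL[OF m(2) p]] m _ x])
      (simp add: slR_pure slL_pure p q m c d lin_smult[OF p] lin_smult[OF q] m_comm)
  then show ?thesis by simp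
qed

text \<open>Slicing a threefold tensor product at its first, last and middle factor removes the associator.
  All axioms that contain an associator are used only through these three rules.\<close>

context
  fixes U :: "('k, 'u, 'y1) module_scheme" and V :: "('k, 'v, 'y2) module_scheme"
    and W :: "('k, 'w, 'y3) module_scheme" and x
  assumes U: "module K U" and V: "module K V" and W: "module K W"
    and x: "x \<in> carrier (U ** V ** W)"
begin

lemma slL_assoc:
  assumes p: "lin U \<k> \<xi>"
  shows "slL (V ** W) \<xi> (assoc U V W x) = tmap V W (slL V \<xi>) id x"
proof -
  have d: "\<xi> w \<in> carrier K" if "w \<in> carrier U" for w using lin_closed[OF p that] by simp
  have "(slL (V ** W) \<xi> \<circ> assoc U V W) x = tmap V W (slL V \<xi>) id x"
    by (rule tensor_ext3[OF lin_comp[OF lin_slL[OF tensor_mod[OF V W] p] lin_assoc[OF U V W]]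
          lin_tmap[OF lin_slL[OF V p] lin_id[OF W]] U V W _ x])
      (simp add: assoc_pure U V W slL_pure tensor_mod p pure_mem d lin_smult[OF pure_lin_left]
        tmap_pure[OF lin_slL[OF V p] lin_id[OF W]])
  then show ?thesis by simp
qed

lemma slR_assoc:
  assumes p: "lin W \<k> \<phi>"
  shows "tmap U V id (slR V \<phi>) (assoc U V W x) = slR (U ** V) \<phi> x"
proof -
  have d: "\<phi> w \<in> carrier K" if "w \<in> carrier W" for w using lin_closed[OF p that] by simp
  have "(tmap U V id (slR V \<phi>) \<circ> assoc U V W) x = slR (U ** V) \<phi> x"
    by (rule tensor_ext3[OF lin_comp[OF lin_tmap[OF lin_id[OF U] lin_slR[OF V p]] lin_assoc[OF U V W]]
          lin_slR[OF tensor_mod[OF U V] p] U V W _ x])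
      (simp add: assoc_pure U V W slR_pure tensor_mod p pure_mem d lin_smult[OF pure_lin_right]
        tmap_pure[OF lin_id[OF U] lin_slR[OF V p]])
  then show ?thesis by simp
qed

lemma slM_assoc:
  assumes p: "lin V \<k> \<phi>"
  shows "tmap U W id (slL W \<phi>) (assoc U V W x) = tmap U W (slR U \<phi>) id x"
proof -
  have d: "\<phi> w \<in> carrier K" if "w \<in> carrier V" for w using lin_closed[OF p that] by simp
  have "(tmap U W id (slL W \<phi>) \<circ> assoc U V W) x = tmap U W (slR U \<phi>) id x"
    by (rule tensor_ext3[OF lin_comp[OF lin_tmap[OF lin_id[OF U] lin_slL[OF W p]] lin_assoc[OF U V W]]
          lin_tmap[OF lin_slR[OF U p] lin_id[OF W]] U V W _ x])
      (simp add: assoc_pure U V W slR_pure slL_pure tensor_mod p pure_mem d lin_smult[OF pure_lin_right]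
        lin_smult[OF pure_lin_left]
        tmap_pure[OF lin_id[OF U] lin_slL[OF W p]] tmap_pure[OF lin_slR[OF U p] lin_id[OF W]])
  then show ?thesis by simp
qed

end

end

context ground_field
begin

section \<open>Slices determine tensors\<close>

lemma extend_submodule:
  assumes V: "module K V" and H: "submodule H K V" and v: "v \<in> carrier V"
  shows "submodule {h \<oplus>\<^bsub>V\<^esub> a \<odot>\<^bsub>V\<^esub> v | h a. h \<in> H \<and> a \<in> carrier K} K V" (is "submodule ?E K V")
proof -
  interpret V: module K V by fact
  note HE = V.submoduleE[OF H]
  have HV: "h \<in> carrier V" if "h \<in> H" for h using HE(1) that by auto
  have z: "\<zero>\<^bsub>V\<^esub> \<in> H" using subgroup.one_closed[OF submodule.axioms(1)[OF H]] by simp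
  have I: "h \<oplus>\<^bsub>V\<^esub> a \<odot>\<^bsub>V\<^esub> v \<in> ?E" if "h \<in> H" "a \<in> carrier K" for h a using that by blast
  show ?thesis
  proof (rule V.submoduleI)
    show "?E \<subseteq> carrier V" using HV v by auto
    show "\<zero>\<^bsub>V\<^esub> \<in> ?E" using I[OF z zero_closed] v by simp
    show "\<ominus>\<^bsub>V\<^esub> x \<in> ?E" if "x \<in> ?E" for x
    proof -
      obtain h a where x: "h \<in> H" "a \<in> carrier K" "x = h \<oplus>\<^bsub>V\<^esub> a \<odot>\<^bsub>V\<^esub> v" using \<open>x \<in> ?E\<close> by blast
      then have "\<ominus>\<^bsub>V\<^esub> x = \<ominus>\<^bsub>V\<^esub> h \<oplus>\<^bsub>V\<^esub> (\<ominus> a) \<odot>\<^bsub>V\<^esub> v"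
        using HV v by (simp add: V.minus_add V.smult_l_minus)
      then show ?thesis using I[OF HE(3)[OF x(1)] a_inv_closed[OF x(2)]] by simp
    qed
    show "x \<oplus>\<^bsub>V\<^esub> y \<in> ?E" if "x \<in> ?E" "y \<in> ?E" for x y
    proof -
      obtain h a where x: "h \<in> H" "a \<in> carrier K" "x = h \<oplus>\<^bsub>V\<^esub> a \<odot>\<^bsub>V\<^esub> v" using \<open>x \<in> ?E\<close> by blast
      obtain g b where y: "g \<in> H" "b \<in> carrier K" "y = g \<oplus>\<^bsub>V\<^esub> b \<odot>\<^bsub>V\<^esub> v" using \<open>y \<in> ?E\<close> by blast
      have "x \<oplus>\<^bsub>V\<^esub> y = (h \<oplus>\<^bsub>V\<^esub> g) \<oplus>\<^bsub>V\<^esub> (a \<oplus> b) \<odot>\<^bsub>V\<^esub> v"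
        using x y HV v by (simp add: V.smult_l_distr V.M.a_ac)
      then show ?thesis using I[OF HE(5)[OF x(1) y(1)] a_closed[OF x(2) y(2)]] by simp
    qed
    show "b \<odot>\<^bsub>V\<^esub> x \<in> ?E" if "b \<in> carrier K" "x \<in> ?E" for b x
    proof -
      obtain h a where x: "h \<in> H" "a \<in> carrier K" "x = h \<oplus>\<^bsub>V\<^esub> a \<odot>\<^bsub>V\<^esub> v" using \<open>x \<in> ?E\<close> by blast
      have "b \<odot>\<^bsub>V\<^esub> x = b \<odot>\<^bsub>V\<^esub> h \<oplus>\<^bsub>V\<^esub> (b \<otimes> a) \<odot>\<^bsub>V\<^esub> v"
        using x HV v \<open>b \<in> carrier K\<close> by (simp add: V.smult_r_distr V.smult_assoc1)
      then show ?thesis using I[OF HE(4)[OF that(1) x(1)] m_closed[OF that(1) x(2)]] by simp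
    qed
  qed
qed

text \<open>By Zorn's lemma there is a maximal subspace \<open>H\<close> that contains \<open>S\<close> but not \<open>w\<close>. It has codimension
  one, so the coordinate along \<open>w\<close> modulo \<open>H\<close> is the required functional.\<close>

lemma separating_functional:
  assumes V: "module K V" and S: "submodule S K V" and w: "w \<in> carrier V" "w \<notin> S"
  obtains \<phi> where "lin V \<k> \<phi>" "\<And>s. s \<in> S \<Longrightarrow> \<phi> s = \<zero>" "\<phi> w = \<one>"
proof -
  interpret V: module K V by fact
  let ?A = "{H. submodule H K V \<and> S \<subseteq> H \<and> w \<notin> H}"
  have "\<exists>M\<in>?A. \<forall>X\<in>?A. M \<subseteq> X \<longrightarrow> X = M"
  proof (rule subset_Zorn_nonempty)
    show "?A \<noteq> {}" using S w by auto
    fix \<C> assume C: "\<C> \<noteq> {}" "subset.chain ?A \<C>"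
    have sub: "submodule H K V" if "H \<in> \<C>" for H using C(2) that by (auto simp: subset.chain_def)
    have tot: "H \<subseteq> H' \<or> H' \<subseteq> H" if "H \<in> \<C>" "H' \<in> \<C>" for H H'
      using C(2) that by (auto simp: subset.chain_def)
    have "submodule (\<Union>\<C>) K V"
    proof (rule V.submoduleI)
      show "\<Union>\<C> \<subseteq> carrier V" using V.submoduleE(1)[OF sub] by blast
      show "\<zero>\<^bsub>V\<^esub> \<in> \<Union>\<C>" using C(1) subgroup.one_closed[OF submodule.axioms(1)[OF sub]] by force
      show "x \<oplus>\<^bsub>V\<^esub> y \<in> \<Union>\<C>" if xy: "x \<in> \<Union>\<C>" "y \<in> \<Union>\<C>" for x y
      proof -
        obtain H1 H2 where H12: "H1 \<in> \<C>" "x \<in> H1" "H2 \<in> \<C>" "y \<in> H2" using xy by blast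
        obtain H where H: "H \<in> \<C>" "x \<in> H" "y \<in> H" using tot[OF H12(1,3)] H12 by blast
        then show ?thesis using V.submoduleE(5)[OF sub[OF H(1)]] by blast
      qed
      show "\<ominus>\<^bsub>V\<^esub> x \<in> \<Union>\<C>" if x: "x \<in> \<Union>\<C>" for x
      proof -
        obtain H where "H \<in> \<C>" "x \<in> H" using x by blast
        then show ?thesis using V.submoduleE(3)[OF sub] by (intro UnionI)
      qed
      show "a \<odot>\<^bsub>V\<^esub> x \<in> \<Union>\<C>" if a: "a \<in> carrier K" and x: "x \<in> \<Union>\<C>" for a x
      proof -
        obtain H where "H \<in> \<C>" "x \<in> H" using x by blast
        then show ?thesis using V.submoduleE(4)[OF sub a] by (intro UnionI)
      qed
    qed
    moreover have "S \<subseteq> H" "w \<notin> H" if "H \<in> \<C>" for H using C(2) that by (auto simp: subset.chain_def)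
    ultimately show "\<Union>\<C> \<in> ?A" using C(1) by blast
  qed
  then obtain H where HA: "H \<in> ?A" and maxA: "\<forall>X\<in>?A. H \<subseteq> X \<longrightarrow> X = H" by (rule bexE)
  from HA have H: "submodule H K V" "S \<subseteq> H" "w \<notin> H" by simp_all
  have max: "X = H" if X: "submodule X K V" "H \<subseteq> X" "w \<notin> X" for X
    using maxA[THEN bspec, of X] X H(2) by simp
  note HE = V.submoduleE[OF H(1)]
  have HV: "h \<in> carrier V" if "h \<in> H" for h using HE(1) that by auto
  have z: "\<zero>\<^bsub>V\<^esub> \<in> H" using subgroup.one_closed[OF submodule.axioms(1)[OF H(1)]] by simp
  have ex: "\<exists>c\<in>carrier K. v \<ominus>\<^bsub>V\<^esub> c \<odot>\<^bsub>V\<^esub> w \<in> H" if v: "v \<in> carrier V" for v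
  proof (cases "v \<in> H")
    case True
    then show ?thesis using w v by (intro bexI[of _ "\<zero>"]) (auto simp: a_minus_def V.a_inv_zero)
  next
    case False
    let ?E = "{h \<oplus>\<^bsub>V\<^esub> a \<odot>\<^bsub>V\<^esub> v | h a. h \<in> H \<and> a \<in> carrier K}"
    have E: "submodule ?E K V" by (rule extend_submodule[OF V H(1) v])
    have HsubE: "H \<subseteq> ?E"
    proof
      fix h assume h: "h \<in> H"
      have "h = h \<oplus>\<^bsub>V\<^esub> \<zero> \<odot>\<^bsub>V\<^esub> v" using h HV v by simp
      then show "h \<in> ?E" using h by blast
    qed
    have "v = \<zero>\<^bsub>V\<^esub> \<oplus>\<^bsub>V\<^esub> \<one> \<odot>\<^bsub>V\<^esub> v" using v by simp
    then have "v \<in> ?E" using z by blast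
    \<comment> \<open>For \<open>v\<close> outside \<open>H\<close>, maximality puts \<open>w\<close> into the span of \<open>H\<close> and \<open>v\<close>; solve for \<open>v\<close>.\<close>
    then have "w \<in> ?E" using max[OF E HsubE] False by blast
    then obtain h a where wh: "w = h \<oplus>\<^bsub>V\<^esub> a \<odot>\<^bsub>V\<^esub> v" "h \<in> H" "a \<in> carrier K" by blast
    have a0: "a \<noteq> \<zero>" using wh H(3) HV v by auto
    then have ai: "inv a \<in> carrier K" "inv a \<otimes> a = \<one>" using wh(3) field_Units by auto
    have "inv a \<odot>\<^bsub>V\<^esub> w = inv a \<odot>\<^bsub>V\<^esub> h \<oplus>\<^bsub>V\<^esub> v"
      using wh ai HV v by (simp add: V.smult_r_distr V.smult_assoc1[symmetric])
    then have "v \<ominus>\<^bsub>V\<^esub> inv a \<odot>\<^bsub>V\<^esub> w = \<ominus>\<^bsub>V\<^esub> (inv a \<odot>\<^bsub>V\<^esub> h)"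
      using wh(2) ai HV v by (simp add: a_minus_def V.minus_add V.M.a_ac V.M.r_neg2 V.M.r_neg1)
    then show ?thesis using HE(3,4) wh(2) ai by (metis (no_types, lifting))
  qed
  have uniq: "c = d" if c: "c \<in> carrier K" "d \<in> carrier K" "v \<in> carrier V"
    "v \<ominus>\<^bsub>V\<^esub> c \<odot>\<^bsub>V\<^esub> w \<in> H" "v \<ominus>\<^bsub>V\<^esub> d \<odot>\<^bsub>V\<^esub> w \<in> H" for c d v
  proof (rule ccontr)
    assume "c \<noteq> d"
    define e where "e = c \<ominus> d"
    have e: "e \<in> carrier K" "e \<noteq> \<zero>"
      using c \<open>c \<noteq> d\<close> minus_eq_zero_iff[OF c(1,2)] by (auto simp: e_def)
    then have ei: "inv e \<in> carrier K" "inv e \<otimes> e = \<one>" using field_Units by auto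
    have "(v \<ominus>\<^bsub>V\<^esub> d \<odot>\<^bsub>V\<^esub> w) \<oplus>\<^bsub>V\<^esub> \<ominus>\<^bsub>V\<^esub> (v \<ominus>\<^bsub>V\<^esub> c \<odot>\<^bsub>V\<^esub> w) \<in> H" using c HE by blast
    moreover have "(v \<ominus>\<^bsub>V\<^esub> d \<odot>\<^bsub>V\<^esub> w) \<oplus>\<^bsub>V\<^esub> \<ominus>\<^bsub>V\<^esub> (v \<ominus>\<^bsub>V\<^esub> c \<odot>\<^bsub>V\<^esub> w) = e \<odot>\<^bsub>V\<^esub> w"
      using c w unfolding e_def a_minus_def
      by (simp add: V.minus_add V.smult_l_distr V.smult_l_minus V.M.a_ac V.M.r_neg1 V.M.r_neg2)
    ultimately have "inv e \<odot>\<^bsub>V\<^esub> (e \<odot>\<^bsub>V\<^esub> w) \<in> H" using HE(4) ei by metis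
    then show False using H(3) ei e w by (simp add: V.smult_assoc1[symmetric])
  qed
  define \<phi> where "\<phi> v = (SOME c. c \<in> carrier K \<and> v \<ominus>\<^bsub>V\<^esub> c \<odot>\<^bsub>V\<^esub> w \<in> H)" for v
  have phi: "\<phi> v \<in> carrier K" "v \<ominus>\<^bsub>V\<^esub> \<phi> v \<odot>\<^bsub>V\<^esub> w \<in> H" if "v \<in> carrier V" for v
    unfolding \<phi>_def using someI_ex[of "\<lambda>c. c \<in> carrier K \<and> v \<ominus>\<^bsub>V\<^esub> c \<odot>\<^bsub>V\<^esub> w \<in> H"] ex[OF that] by blast+
  have phiI: "\<phi> v = c" if "v \<in> carrier V" "c \<in> carrier K" "v \<ominus>\<^bsub>V\<^esub> c \<odot>\<^bsub>V\<^esub> w \<in> H" for v c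
    using uniq[OF phi(1) that(2) that(1) phi(2) that(3)] that by simp
  have "lin V \<k> \<phi>"
  proof (intro linI V self_mod linear_mapI)
    fix x y assume x: "x \<in> carrier V" and y: "y \<in> carrier V"
    have "(x \<oplus>\<^bsub>V\<^esub> y) \<ominus>\<^bsub>V\<^esub> (\<phi> x \<oplus> \<phi> y) \<odot>\<^bsub>V\<^esub> w = (x \<ominus>\<^bsub>V\<^esub> \<phi> x \<odot>\<^bsub>V\<^esub> w) \<oplus>\<^bsub>V\<^esub> (y \<ominus>\<^bsub>V\<^esub> \<phi> y \<odot>\<^bsub>V\<^esub> w)"
      using x y w phi by (simp add: a_minus_def V.smult_l_distr V.minus_add V.M.a_ac)
    then have "\<phi> (x \<oplus>\<^bsub>V\<^esub> y) = \<phi> x \<oplus> \<phi> y"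
      using x y phi HE(5) by (intro phiI) auto
    then show "\<phi> (x \<oplus>\<^bsub>V\<^esub> y) = \<phi> x \<oplus>\<^bsub>\<k>\<^esub> \<phi> y" by simp
  next
    fix a x assume a: "a \<in> carrier K" and x: "x \<in> carrier V"
    have "(a \<odot>\<^bsub>V\<^esub> x) \<ominus>\<^bsub>V\<^esub> (a \<otimes> \<phi> x) \<odot>\<^bsub>V\<^esub> w = a \<odot>\<^bsub>V\<^esub> (x \<ominus>\<^bsub>V\<^esub> \<phi> x \<odot>\<^bsub>V\<^esub> w)"
      using a x w phi by (simp add: a_minus_def V.smult_r_distr V.smult_r_minus V.smult_assoc1)
    then have "\<phi> (a \<odot>\<^bsub>V\<^esub> x) = a \<otimes> \<phi> x"
      using a x phi HE(4) by (intro phiI) auto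
    then show "\<phi> (a \<odot>\<^bsub>V\<^esub> x) = a \<odot>\<^bsub>\<k>\<^esub> \<phi> x" by simp
  qed (use phi in auto)
  moreover have "\<phi> s = \<zero>" if "s \<in> S" for s
    using that H(2) HV w by (intro phiI) (auto simp: a_minus_def V.a_inv_zero)
  moreover have "\<phi> w = \<one>" using w z by (intro phiI) (auto simp: a_minus_def V.r_neg)
  ultimately show thesis using that by blast
qed

text \<open>The bilinear map is a parameter so that right and left slices, which differ in the order of the
  arguments of the elementary tensors, are treated together.\<close>

definition bsum :: "('k, 't, 'y) module_scheme \<Rightarrow> ('v \<Rightarrow> 'w \<Rightarrow> 't) \<Rightarrow> ('v \<times> 'w) list \<Rightarrow> 't"
  where "bsum T b xs = foldr (\<lambda>(v, w) s. b v w \<oplus>\<^bsub>T\<^esub> s) xs \<zero>\<^bsub>T\<^esub>"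

lemma bsum_simps [simp]:
  "bsum T b [] = \<zero>\<^bsub>T\<^esub>" "bsum T b ((v, w) # xs) = b v w \<oplus>\<^bsub>T\<^esub> bsum T b xs"
  by (simp_all add: bsum_def)

fun list_span :: "('k, 'w, 'y) module_scheme \<Rightarrow> 'w list \<Rightarrow> 'w set" where
  "list_span W [] = {\<zero>\<^bsub>W\<^esub>}"
| "list_span W (w # ws) = {u \<oplus>\<^bsub>W\<^esub> a \<odot>\<^bsub>W\<^esub> w | u a. u \<in> list_span W ws \<and> a \<in> carrier K}"

lemma list_span_submodule:
  assumes "module K W" "set ws \<subseteq> carrier W"
  shows "submodule (list_span W ws) K W"
  using assms(2)
proof (induction ws)
  case Nil
  interpret W: module K W by fact
  show ?case by (rule W.submoduleI) auto
next
  case (Cons w ws)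
  then show ?case using extend_submodule[OF assms(1)] by simp
qed

context
  fixes V :: "('k, 'v, 'y1) module_scheme" and W :: "('k, 'w, 'y2) module_scheme"
    and T :: "('k, 't, 'y3) module_scheme" and b
  assumes V: "module K V" and W: "module K W" and T: "module K T" and b: "bilinear_map V W T b"
begin

interpretation V: module K V by (rule V)
interpretation W: module K W by (rule W)
interpretation T: module K T by (rule T)

private lemma b_simps:
  "v \<in> carrier V \<Longrightarrow> w \<in> carrier W \<Longrightarrow> b v w \<in> carrier T"
  "v \<in> carrier V \<Longrightarrow> w \<in> carrier W \<Longrightarrow> w' \<in> carrier W \<Longrightarrow> b v (w \<oplus>\<^bsub>W\<^esub> w') = b v w \<oplus>\<^bsub>T\<^esub> b v w'"
  "v \<in> carrier V \<Longrightarrow> v' \<in> carrier V \<Longrightarrow> w \<in> carrier W \<Longrightarrow> b (v \<oplus>\<^bsub>V\<^esub> v') w = b v w \<oplus>\<^bsub>T\<^esub> b v' w"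
  "a \<in> carrier K \<Longrightarrow> v \<in> carrier V \<Longrightarrow> w \<in> carrier W \<Longrightarrow> b v (a \<odot>\<^bsub>W\<^esub> w) = a \<odot>\<^bsub>T\<^esub> b v w"
  "a \<in> carrier K \<Longrightarrow> v \<in> carrier V \<Longrightarrow> w \<in> carrier W \<Longrightarrow> b (a \<odot>\<^bsub>V\<^esub> v) w = a \<odot>\<^bsub>T\<^esub> b v w"
  "v \<in> carrier V \<Longrightarrow> b v \<zero>\<^bsub>W\<^esub> = \<zero>\<^bsub>T\<^esub>"
  "w \<in> carrier W \<Longrightarrow> b \<zero>\<^bsub>V\<^esub> w = \<zero>\<^bsub>T\<^esub>"
  using linear_closed[OF bilinear_mapD(1)[OF b]] linear_add[OF bilinear_mapD(1)[OF b]]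
    linear_add[OF bilinear_mapD(2)[OF b]] linear_smult[OF bilinear_mapD(1)[OF b]]
    linear_smult[OF bilinear_mapD(2)[OF b]] linear_zero[OF W T bilinear_mapD(1)[OF b]]
    linear_zero[OF V T bilinear_mapD(2)[OF b]]
  by auto

lemma bsum_closed: "set xs \<subseteq> carrier V \<times> carrier W \<Longrightarrow> bsum T b xs \<in> carrier T"
  by (induction xs) (auto simp: b_simps)

text \<open>The summand with a dependent second component is distributed over the others.\<close>

lemma bsum_shorten:
  assumes "set xs \<subseteq> carrier V \<times> carrier W" "w \<in> list_span W (map snd xs)" "v \<in> carrier V"
  shows "\<exists>ys. set ys \<subseteq> carrier V \<times> carrier W \<and> length ys = length xs \<and>
    bsum T b ((v, w) # xs) = bsum T b ys"
  using assms
proof (induction xs arbitrary: w)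
  case Nil
  then show ?case by (auto simp: b_simps)
next
  case (Cons x xs)
  obtain v1 w1 where x: "x = (v1, w1)" "v1 \<in> carrier V" "w1 \<in> carrier W" using Cons.prems by auto
  obtain u a where w: "w = u \<oplus>\<^bsub>W\<^esub> a \<odot>\<^bsub>W\<^esub> w1" "u \<in> list_span W (map snd xs)" "a \<in> carrier K"
    using Cons.prems x by auto
  have xs: "set xs \<subseteq> carrier V \<times> carrier W" using Cons.prems by auto
  have u: "u \<in> carrier W"
    using w(2) W.submoduleE(1)[OF list_span_submodule[OF W, of "map snd xs"]] xs by force
  obtain ys where ys: "set ys \<subseteq> carrier V \<times> carrier W" "length ys = length xs"
    "bsum T b ((v, u) # xs) = bsum T b ys" using Cons.IH[OF xs w(2) Cons.prems(3)] by blast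
  have "bsum T b ((v, w) # x # xs) = bsum T b ((v1 \<oplus>\<^bsub>V\<^esub> a \<odot>\<^bsub>V\<^esub> v, w1) # ys)"
    using x w u Cons.prems(3) bsum_closed[OF xs] ys(3)[symmetric]
    by (simp add: b_simps T.M.a_ac)
  then show ?case using ys x w Cons.prems(3) by (intro exI[of _ "(v1 \<oplus>\<^bsub>V\<^esub> a \<odot>\<^bsub>V\<^esub> v, w1) # ys"]) auto
qed

text \<open>If the second component \<open>w\<close> of the first summand depends on the others, the sum can be shortened.
  Otherwise a functional that is one at \<open>w\<close> and vanishes at the others exhibits the first component
  as a slice, and the summand can be split off.\<close>

lemma bsum_slices:
  assumes H: "submodule H K V"
    and sl: "\<And>\<phi>. lin W \<k> \<phi> \<Longrightarrow> lin T V (sl \<phi>)"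
    and sl_b: "\<And>\<phi> v w. lin W \<k> \<phi> \<Longrightarrow> v \<in> carrier V \<Longrightarrow> w \<in> carrier W \<Longrightarrow> sl \<phi> (b v w) = \<phi> w \<odot>\<^bsub>V\<^esub> v"
    and xs: "set xs \<subseteq> carrier V \<times> carrier W"
    and mem: "\<And>\<phi>. lin W \<k> \<phi> \<Longrightarrow> sl \<phi> (bsum T b xs) \<in> H"
  shows "\<exists>ys. set ys \<subseteq> H \<times> carrier W \<and> bsum T b xs = bsum T b ys"
  using xs mem
proof (induction "length xs" arbitrary: xs)
  case 0
  then show ?case by (intro exI[of _ "[]"]) auto
next
  case (Suc n)
  obtain v w xs' where xs: "xs = (v, w) # xs'" using Suc(2) by (cases xs) auto
  have n: "n = length xs'" and xs': "set xs' \<subseteq> carrier V \<times> carrier W"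
    and v: "v \<in> carrier V" and w: "w \<in> carrier W" using Suc xs by auto
  let ?S = "list_span W (map snd xs')"
  have S: "submodule ?S K W" by (rule list_span_submodule[OF W]) (use xs' in auto)
  show ?case
  proof (cases "w \<in> ?S")
    case True
    then obtain ys where ys: "set ys \<subseteq> carrier V \<times> carrier W" "length ys = length xs'"
      "bsum T b xs = bsum T b ys" using bsum_shorten[OF xs' _ v] xs by metis
    show ?thesis using Suc(1)[of ys] ys n Suc.prems(2) by auto
  next
    case False
    obtain \<phi> where phi: "lin W \<k> \<phi>" "\<And>s. s \<in> ?S \<Longrightarrow> \<phi> s = \<zero>" "\<phi> w = \<one>"
      using separating_functional[OF W S w False] by blast
    have in_span: "snd x \<in> list_span W (map snd zs)"
      if zs: "x \<in> set zs" "set zs \<subseteq> carrier V \<times> carrier W" for zs x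
      using zs
    proof (induction zs)
      case (Cons z zs)
      have sub: "submodule (list_span W (map snd zs)) K W"
        by (rule list_span_submodule[OF W]) (use Cons.prems in auto)
      have zW: "snd z \<in> carrier W" using Cons.prems by (cases z) auto
      show ?case
      proof (cases "x = z")
        case True
        have "\<zero>\<^bsub>W\<^esub> \<in> list_span W (map snd zs)"
          using subgroup.one_closed[OF submodule.axioms(1)[OF sub]] by simp
        moreover have "snd x = \<zero>\<^bsub>W\<^esub> \<oplus>\<^bsub>W\<^esub> \<one> \<odot>\<^bsub>W\<^esub> snd z" using zW True by simp
        ultimately show ?thesis by (simp only: list.map list_span.simps) blast
      next
        case False
        then have x: "snd x \<in> list_span W (map snd zs)" using Cons by auto
        then have "snd x = snd x \<oplus>\<^bsub>W\<^esub> \<zero> \<odot>\<^bsub>W\<^esub> snd z" using zW W.submoduleE(1)[OF sub] by auto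
        then show ?thesis using x by (simp only: list.map list_span.simps) blast
      qed
    qed simp
    have "sl \<phi> (bsum T b zs) = \<zero>\<^bsub>V\<^esub>" if "set zs \<subseteq> set xs'" for zs
      using that
    proof (induction zs)
      case Nil
      then show ?case by (simp add: lin_zero[OF sl[OF phi(1)]])
    next
      case (Cons z zs)
      obtain v' w' where z: "z = (v', w')" by (cases z)
      have zm: "v' \<in> carrier V" "w' \<in> carrier W" "set zs \<subseteq> carrier V \<times> carrier W"
        using Cons.prems xs' z by auto
      have "\<phi> w' = \<zero>" using in_span[of z xs'] Cons.prems xs' z phi(2) by auto
      then show ?case
        using Cons z zm bsum_closed[OF zm(3)]
        by (simp add: lin_add[OF sl[OF phi(1)]] sl_b[OF phi(1)] b_simps)
    qed
    then have "sl \<phi> (bsum T b xs) = v"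
      using xs v w bsum_closed[OF xs'] phi
      by (simp add: lin_add[OF sl[OF phi(1)]] sl_b[OF phi(1)] b_simps)
    then have vH: "v \<in> H" using Suc.prems(2)[OF phi(1)] by simp
    have "sl \<psi> (bsum T b xs') \<in> H" if psi: "lin W \<k> \<psi>" for \<psi>
    proof -
      have pw: "\<psi> w \<in> carrier K" using lin_closed[OF psi w] by simp
      have c: "sl \<psi> (bsum T b xs') \<in> carrier V" using lin_closed[OF sl[OF psi] bsum_closed[OF xs']] .
      have "sl \<psi> (bsum T b xs) = \<psi> w \<odot>\<^bsub>V\<^esub> v \<oplus>\<^bsub>V\<^esub> sl \<psi> (bsum T b xs')"
        using xs v w bsum_closed[OF xs'] by (simp add: lin_add[OF sl[OF psi]] sl_b[OF psi] b_simps)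
      then have "sl \<psi> (bsum T b xs') = \<ominus>\<^bsub>V\<^esub> (\<psi> w \<odot>\<^bsub>V\<^esub> v) \<oplus>\<^bsub>V\<^esub> sl \<psi> (bsum T b xs)"
        using c pw v by (simp add: V.M.r_neg1)
      also have "\<dots> \<in> H"
        using Suc.prems(2)[OF psi] vH pw V.submoduleE(3-5)[OF H] by blast
      finally show ?thesis .
    qed
    then obtain ys where ys: "set ys \<subseteq> H \<times> carrier W" "bsum T b xs' = bsum T b ys"
      using Suc(1)[OF n xs'] by blast
    then show ?thesis using vH w xs by (intro exI[of _ "(v, w) # ys"]) auto
  qed
qed

end

lemma tensor_bsum:
  assumes V: "module K V" and W: "module K W" and t: "t \<in> carrier (V ** W)"
  shows "\<exists>xs. set xs \<subseteq> carrier V \<times> carrier W \<and> t = bsum (V ** W) (pure V W) xs"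
  using V W t
proof (induction rule: tensor_induct)
  case zero
  then show ?case by (intro exI[of _ "[]"]) auto
next
  case (add v w x)
  then obtain xs where "set xs \<subseteq> carrier V \<times> carrier W" "x = bsum (V ** W) (pure V W) xs"
    by blast
  then show ?case using add by (intro exI[of _ "(v, w) # xs"]) auto
qed

lemma bsum_swap: "bsum T (\<lambda>w v. b v w) (map prod.swap xs) = bsum T b xs"
  by (induction xs) auto

lemma bsum_map:
  assumes f: "lin T T' f" and T: "set xs \<subseteq> A \<times> B" "\<And>v w. v \<in> A \<Longrightarrow> w \<in> B \<Longrightarrow> b v w \<in> carrier T"
    and b: "\<And>v w. v \<in> A \<Longrightarrow> w \<in> B \<Longrightarrow> f (b v w) = b' v w"
  shows "f (bsum T b xs) = bsum T' b' xs \<and> bsum T b xs \<in> carrier T"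
proof -
  interpret T: module K T by (rule linD[OF f])
  show ?thesis using T(1)
    by (induction xs) (auto simp: lin_zero[OF f] lin_add[OF f] T(2) b)
qed

text \<open>This is where the ground ring has to be a field. For \<open>H = 0\<close> it says that slices detect zero, and
  for general \<open>H\<close> that kernels commute with tensoring.\<close>

lemma slR_mem:
  assumes W: "module K W" and V: "module K V" and H: "submodule H K V" and t: "t \<in> carrier (V ** W)"
    and mem: "\<And>\<phi>. lin W \<k> \<phi> \<Longrightarrow> slR V \<phi> t \<in> H"
  obtains s where "s \<in> carrier ((V\<lparr>carrier := H\<rparr>) ** W)" "tmap V W id id s = t"
proof -
  let ?V = "V\<lparr>carrier := H\<rparr>"
  obtain xs where xs: "set xs \<subseteq> carrier V \<times> carrier W" "t = bsum (V ** W) (pure V W) xs"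
    using tensor_bsum[OF V W t] by blast
  have "\<exists>ys. set ys \<subseteq> H \<times> carrier W \<and> bsum (V ** W) (pure V W) xs =
    bsum (V ** W) (pure V W) ys"
    by (rule bsum_slices[OF V W tensor_mod[OF V W] pure_bilin[OF V W] H lin_slR[OF V]])
      (use xs mem slR_pure[OF V] in auto)
  then obtain ys where ys: "set ys \<subseteq> H \<times> carrier W" "t = bsum (V ** W) (pure V W) ys"
    using xs(2) by blast
  note i = lin_incl[OF H V]
  have "tmap V W id id (bsum (?V ** W) (pure ?V W) ys) = t \<and>
    bsum (?V ** W) (pure ?V W) ys \<in> carrier (?V ** W)"
    unfolding ys(2)
    by (rule bsum_map[OF lin_tmap[OF i lin_id[OF W]] ys(1)])
      (auto simp: tmap_pure[OF i lin_id[OF W]] intro!: pure_mem linD(1)[OF i] W)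
  then show thesis using that by blast
qed

lemma slL_mem:
  assumes V: "module K V" and W: "module K W" and H: "submodule H K W" and t: "t \<in> carrier (V ** W)"
    and mem: "\<And>\<phi>. lin V \<k> \<phi> \<Longrightarrow> slL W \<phi> t \<in> H"
  obtains s where "s \<in> carrier (V ** (W\<lparr>carrier := H\<rparr>))" "tmap V W id id s = t"
proof -
  let ?W = "W\<lparr>carrier := H\<rparr>" and ?p = "\<lambda>w v. pure V W v w"
  obtain xs where xs: "set xs \<subseteq> carrier V \<times> carrier W" "t = bsum (V ** W) (pure V W) xs"
    using tensor_bsum[OF V W t] by blast
  have bil: "bilinear_map W V (V ** W) ?p" using pure_bilin[OF V W] by (auto simp: bilinear_map_def)
  have "\<exists>ys. set ys \<subseteq> H \<times> carrier V \<and> bsum (V ** W) ?p (map prod.swap xs) = bsum (V ** W) ?p ys"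
    by (rule bsum_slices[OF W V tensor_mod[OF V W] bil H lin_slL[OF W]])
      (use xs mem slL_pure[OF W] bsum_swap[of "V ** W" "pure V W" xs] in auto)
  then obtain ys where ys: "set ys \<subseteq> H \<times> carrier V" "t = bsum (V ** W) ?p ys"
    using xs(2) bsum_swap[of "V ** W" "pure V W" xs] by auto
  note i = lin_incl[OF H W]
  have "tmap V W id id (bsum (V ** ?W) (\<lambda>w v. pure V ?W v w) ys) = t \<and>
    bsum (V ** ?W) (\<lambda>w v. pure V ?W v w) ys \<in> carrier (V ** ?W)"
    unfolding ys(2)
    by (rule bsum_map[OF lin_tmap[OF lin_id[OF V] i] ys(1)])
      (auto simp: tmap_pure[OF lin_id[OF V] i] intro!: pure_mem linD(1)[OF i] V)
  then show thesis using that by blast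
qed

lemma zero_submodule: "module K V \<Longrightarrow> submodule {\<zero>\<^bsub>V\<^esub>} K V"
  using list_span_submodule[of V "[]"] by simp

lemma slR_detect:
  assumes W: "module K W" and V: "module K V" and x: "x \<in> carrier (V ** W)" and y: "y \<in> carrier (V ** W)"
    and eq: "\<And>\<phi>. lin W \<k> \<phi> \<Longrightarrow> slR V \<phi> x = slR V \<phi> y"
  shows "x = y"
proof -
  interpret V: module K V by fact
  interpret T: module K "V ** W" by (intro tensor_mod V W)
  have "slR V \<phi> (x \<ominus>\<^bsub>V ** W\<^esub> y) \<in> {\<zero>\<^bsub>V\<^esub>}" if "lin W \<k> \<phi>" for \<phi>
    using lin_closed[OF lin_slR[OF V that] y]
    by (simp add: lin_minus[OF lin_slR[OF V that] x y] eq[OF that] V.minus_eq_zero_iff)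
  from slR_mem[OF W V zero_submodule[OF V] T.minus_closed[OF x y] this] obtain s
    where s: "s \<in> carrier (V\<lparr>carrier := {\<zero>\<^bsub>V\<^esub>}\<rparr> ** W)" "tmap V W id id s = x \<ominus>\<^bsub>V ** W\<^esub> y"
    by blast
  moreover have "tmap V W id id s = \<zero>\<^bsub>V ** W\<^esub>"
    by (rule tmap_zero_left[OF lin_incl[OF zero_submodule[OF V] V] lin_id[OF W] s(1)]) simp
  ultimately have "x \<ominus>\<^bsub>V ** W\<^esub> y = \<zero>\<^bsub>V ** W\<^esub>" by simp
  then show ?thesis using T.minus_eq_zero_iff[OF x y] by simp
qed

lemma slL_detect:
  assumes V: "module K V" and W: "module K W" and x: "x \<in> carrier (V ** W)" and y: "y \<in> carrier (V ** W)"
    and eq: "\<And>\<phi>. lin V \<k> \<phi> \<Longrightarrow> slL W \<phi> x = slL W \<phi> y"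
  shows "x = y"
proof -
  interpret W: module K W by fact
  interpret T: module K "V ** W" by (intro tensor_mod V W)
  have "slL W \<phi> (x \<ominus>\<^bsub>V ** W\<^esub> y) \<in> {\<zero>\<^bsub>W\<^esub>}" if "lin V \<k> \<phi>" for \<phi>
    using lin_closed[OF lin_slL[OF W that] y]
    by (simp add: lin_minus[OF lin_slL[OF W that] x y] eq[OF that] W.minus_eq_zero_iff)
  from slL_mem[OF V W zero_submodule[OF W] T.minus_closed[OF x y] this] obtain s
    where s: "s \<in> carrier (V ** W\<lparr>carrier := {\<zero>\<^bsub>W\<^esub>}\<rparr>)" "tmap V W id id s = x \<ominus>\<^bsub>V ** W\<^esub> y"
    by blast
  moreover have "tmap V W id id s = \<zero>\<^bsub>V ** W\<^esub>"
    by (rule tmap_zero_right[OF lin_id[OF V] lin_incl[OF zero_submodule[OF W] W] s(1)]) simp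
  ultimately have "x \<ominus>\<^bsub>V ** W\<^esub> y = \<zero>\<^bsub>V ** W\<^esub>" by simp
  then show ?thesis using T.minus_eq_zero_iff[OF x y] by simp
qed

text \<open>The coactions of a cotensor product are chosen as preimages; their linearity is read off from the
  slices.\<close>

lemma lin_by_detection:
  assumes U: "module K U" and T: "module K T" and f: "\<And>u. u \<in> carrier U \<Longrightarrow> f u \<in> carrier T"
    and detect: "\<And>x y. x \<in> carrier T \<Longrightarrow> y \<in> carrier T \<Longrightarrow> (\<And>\<phi>. P \<phi> \<Longrightarrow> s \<phi> x = s \<phi> y) \<Longrightarrow> x = y"
    and s: "\<And>\<phi>. P \<phi> \<Longrightarrow> lin T X (s \<phi>)" and sf: "\<And>\<phi>. P \<phi> \<Longrightarrow> lin U X (\<lambda>u. s \<phi> (f u))"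
  shows "lin U T f"
proof (intro linI U T linear_mapI f)
  interpret U: module K U by fact
  interpret T: module K T by fact
  fix x y assume x: "x \<in> carrier U" and y: "y \<in> carrier U"
  show "f (x \<oplus>\<^bsub>U\<^esub> y) = f x \<oplus>\<^bsub>T\<^esub> f y"
    by (rule detect) (simp_all add: f x y lin_add[OF sf x y] lin_add[OF s f[OF x] f[OF y]])
next
  interpret U: module K U by fact
  interpret T: module K T by fact
  fix a x assume a: "a \<in> carrier K" and x: "x \<in> carrier U"
  show "f (a \<odot>\<^bsub>U\<^esub> x) = a \<odot>\<^bsub>T\<^esub> f x"
    by (rule detect) (simp_all add: f a x lin_smult[OF sf a x] lin_smult[OF s a f[OF x]])
qed

lemma incl_right_inj:
  assumes V: "module K V" and W: "module K W" and H: "submodule H K W"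
    and x: "x \<in> carrier (V ** (W\<lparr>carrier := H\<rparr>))" and y: "y \<in> carrier (V ** (W\<lparr>carrier := H\<rparr>))"
    and eq: "tmap V W id id x = tmap V W id id y"
  shows "x = y"
proof (rule slL_detect[OF V sub_mod[OF H W] x y])
  fix \<phi> assume p: "lin V \<k> \<phi>"
  note i = lin_incl[OF H W]
  show "slL (W\<lparr>carrier := H\<rparr>) \<phi> x = slL (W\<lparr>carrier := H\<rparr>) \<phi> y"
    using slL_tmap[OF lin_id[OF V] i p x] slL_tmap[OF lin_id[OF V] i p y] eq by simp
qed

end

section \<open>Comodules as spaces with operators\<close>

text \<open>The records \<open>cotensor\<close>, \<open>cotensor_rcomod\<close> and \<open>cotensor_bicomod\<close> describe the same vector space but
  have different types and fields; tensor products and linear maps see these four components.\<close>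

definition same_space :: "('k, 'v, 'y1) module_scheme \<Rightarrow> ('k, 'v, 'y2) module_scheme \<Rightarrow> bool"
  where "same_space V V' \<longleftrightarrow> carrier V = carrier V' \<and> \<zero>\<^bsub>V\<^esub> = \<zero>\<^bsub>V'\<^esub> \<and> add V = add V' \<and> smult V = smult V'"

lemma same_module:
  assumes "same_space V V'" "module K V"
  shows "module K V'"
proof -
  interpret V: module K V by fact
  have s: "carrier V' = carrier V" "\<zero>\<^bsub>V'\<^esub> = \<zero>\<^bsub>V\<^esub>" "add V' = add V" "smult V' = smult V"
    using assms(1) by (simp_all add: same_space_def)
  have "abelian_group V'"
  proof (rule abelian_groupI)
    show "\<exists>y\<in>carrier V'. y \<oplus>\<^bsub>V'\<^esub> x = \<zero>\<^bsub>V'\<^esub>" if "x \<in> carrier V'" for x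
      using that s V.l_neg by (intro bexI[of _ "\<ominus>\<^bsub>V\<^esub> x"]) auto
  qed (use s V.M.a_ac in auto)
  then show ?thesis
    by (intro moduleI V.R.is_cring)
      (use s in \<open>auto simp: V.smult_l_distr V.smult_r_distr V.smult_assoc1\<close>)
qed

lemma same_linear_map:
  assumes "same_space V V'"
  shows "linear_map K V W f \<longleftrightarrow> linear_map K V' W f"
  using assms by (auto simp: linear_map_def same_space_def)

lemma same_tensor_left: "same_space V V' \<Longrightarrow> tensor K V W = tensor K V' W"
  by (simp add: tensor_def tensor_kernel_def bilinear_relations_def same_space_def)

lemma same_tensor_right: "same_space W W' \<Longrightarrow> tensor K V W = tensor K V W'"
  by (simp add: tensor_def tensor_kernel_def bilinear_relations_def same_space_def)

locale coalgebra_over_field = ground_field K + coalg: coalgebra K C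
  for K :: "('k, 'x) ring_scheme" (structure) and C :: "('k, 'c, 'y) coalg_scheme"
begin

lemma same_linD: "same_space V V' \<Longrightarrow> lin V W f \<Longrightarrow> lin V' W f"
  using same_module same_linear_map unfolding lin_def by blast

abbreviation dual where "dual \<equiv> lin C \<k>"
abbreviation rlin where "rlin M \<equiv> lin M (M ** C) (rcoact M)"
abbreviation llin where "llin N \<equiv> lin N (C ** N) (lcoact N)"

text \<open>In the notation of Sweedler \<open>ract M \<phi> m\<close> is \<open>m\<^sub>0 \<phi>(m\<^sub>1)\<close> and \<open>lact N \<phi> n\<close> is \<open>\<phi>(n\<^sub>-\<^sub>1) n\<^sub>0\<close>: the action of the
  dual algebra of \<open>C\<close>.\<close>

definition ract :: "('k, 'm, 'c, 'z) rcomod_scheme \<Rightarrow> ('c \<Rightarrow> 'k) \<Rightarrow> 'm \<Rightarrow> 'm"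
  where "ract M \<phi> = slR M \<phi> \<circ> rcoact M"

definition lact :: "('k, 'n, 'c, 'z) bicomod_scheme \<Rightarrow> ('c \<Rightarrow> 'k) \<Rightarrow> 'n \<Rightarrow> 'n"
  where "lact N \<phi> = slL N \<phi> \<circ> lcoact N"

text \<open>The trace of a bicomodule structure on the operators. It suffices for the cotensor product to
  inherit a coaction.\<close>

definition commuting :: "('k, 'n, 'c, 'z) bicomod_scheme \<Rightarrow> bool"
  where "commuting N \<longleftrightarrow> rlin N \<and> llin N \<and>
    (\<forall>\<phi> \<psi> n. dual \<phi> \<longrightarrow> dual \<psi> \<longrightarrow> n \<in> carrier N \<longrightarrow>
      lact N \<phi> (ract N \<psi> n) = ract N \<psi> (lact N \<phi> n))"

definition rcolin ::
  "('k, 'm, 'c, 'z1) rcomod_scheme \<Rightarrow> ('k, 'n, 'c, 'z2) rcomod_scheme \<Rightarrow> ('m \<Rightarrow> 'n) \<Rightarrow> bool"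
  where "rcolin M N f \<longleftrightarrow> lin M N f \<and>
    (\<forall>\<phi>. dual \<phi> \<longrightarrow> (\<forall>x\<in>carrier M. ract N \<phi> (f x) = f (ract M \<phi> x)))"

definition lcolin ::
  "('k, 'm, 'c, 'z1) bicomod_scheme \<Rightarrow> ('k, 'n, 'c, 'z2) bicomod_scheme \<Rightarrow> ('m \<Rightarrow> 'n) \<Rightarrow> bool"
  where "lcolin M N f \<longleftrightarrow> lin M N f \<and>
    (\<forall>\<phi>. dual \<phi> \<longrightarrow> (\<forall>x\<in>carrier M. lact N \<phi> (f x) = f (lact M \<phi> x)))"

lemma lin_ract: "rlin M \<Longrightarrow> dual \<phi> \<Longrightarrow> lin M M (ract M \<phi>)"
  unfolding ract_def by (rule lin_comp[OF lin_slR]) (auto dest: linD)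

lemma lin_lact: "llin N \<Longrightarrow> dual \<phi> \<Longrightarrow> lin N N (lact N \<phi>)"
  unfolding lact_def by (rule lin_comp[OF lin_slL]) (auto dest: linD)

lemma C_mod: "module K C" by (rule coalg.module)

lemmas C_id = lin_id[OF C_mod]

lemma comult_lin: "lin C (C ** C) (comult C)"
  by (intro linI C_mod tensor_mod coalg.comult_linear)

lemma rcomod_map_iff:
  assumes M: "rlin M" and N: "rlin N"
  shows "rcomod_map K C M N f \<longleftrightarrow> rcolin M N f"
proof
  note m = linD(1)[OF M] linD(1)[OF N]
  assume f: "rcomod_map K C M N f"
  then have fl: "lin M N f" using m by (auto simp: rcomod_map_def intro: linI)
  show "rcolin M N f"
    using f fl by (auto simp: rcomod_map_def rcolin_def ract_def
        slR_tmap[OF fl C_id _ lin_closed[OF M]])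
next
  note m = linD(1)[OF M] linD(1)[OF N]
  assume "rcolin M N f"
  then have fl: "lin M N f" and
    f: "\<And>\<phi> x. dual \<phi> \<Longrightarrow> x \<in> carrier M \<Longrightarrow> ract N \<phi> (f x) = f (ract M \<phi> x)"
    by (auto simp: rcolin_def)
  have "rcoact N (f x) = tmap N C f id (rcoact M x)" if x: "x \<in> carrier M" for x
  proof (rule slR_detect[OF C_mod m(2)])
    show "rcoact N (f x) \<in> carrier (N ** C)" by (rule lin_closed[OF N lin_closed[OF fl x]])
    show "tmap N C f id (rcoact M x) \<in> carrier (N ** C)"
      by (rule lin_closed[OF lin_tmap[OF fl C_id] lin_closed[OF M x]])
    show "slR N \<phi> (rcoact N (f x)) = slR N \<phi> (tmap N C f id (rcoact M x))"
      if p: "dual \<phi>" for \<phi>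
      using f[OF p x] by (simp add: ract_def slR_tmap[OF fl C_id p lin_closed[OF M x]])
  qed
  then show "rcomod_map K C M N f" using linD(3)[OF fl] by (simp add: rcomod_map_def)
qed

lemma bicomod_map_commutes:
  assumes M: "llin M" and N: "llin N" and f: "bicomod_map K C M N f"
  shows "lcolin M N f"
proof -
  have fl: "lin M N f" using f linD(1)[OF M] linD(1)[OF N]
    by (auto simp: bicomod_map_def rcomod_map_def intro: linI)
  show ?thesis
    using f fl by (auto simp: bicomod_map_def lcolin_def lact_def
        slL_tmap[OF C_id fl _ lin_closed[OF M]])
qed

text \<open>Slicing coassociativity at the middle factor says that \<open>rcoact M m\<close> belongs to \<open>M \<box> C\<close>; slicing it
  at the last factor says that the coaction is colinear.\<close>

context
  fixes M :: "('k, 'm, 'c, 'z) rcomod_scheme"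
  assumes M: "right_comodule K C M"
begin

lemma right_comodule_rlin: "rlin M"
  using right_comodule.module[OF M] right_comodule.rcoact_linear[OF M]
  by (intro linI tensor_mod C_mod)

private lemmas rl = right_comodule_rlin and Mmod = right_comodule.module[OF M]

lemma ract_counit: "m \<in> carrier M \<Longrightarrow> ract M (counit C) m = m"
  using right_comodule.rcoact_counit[OF M] by (simp add: ract_def slR_def)

lemma rcoact_in_cotensor:
  assumes p: "dual \<phi>" and m: "m \<in> carrier M"
  shows "tmap M C (ract M \<phi>) id (rcoact M m) = tmap M C id (slL C \<phi> \<circ> comult C) (rcoact M m)"
proof -
  note r = lin_closed[OF rl m] and i = lin_id[OF Mmod] C_id
  have "tmap M C (ract M \<phi>) id (rcoact M m)
      = tmap M C (slR M \<phi>) id (tmap (M ** C) C (rcoact M) id (rcoact M m))"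
    using tmap_comp[OF rl i(2) lin_slR[OF Mmod p] i(2) r] by (simp add: ract_def)
  also have "\<dots> = tmap M C id (slL C \<phi>) (assoc M C C
      (tmap (M ** C) C (rcoact M) id (rcoact M m)))"
    by (rule slM_assoc[OF Mmod C_mod C_mod lin_closed[OF lin_tmap[OF rl i(2)] r] p, symmetric])
  also have "\<dots> = tmap M C id (slL C \<phi>) (tmap M (C ** C) id (comult C) (rcoact M m))"
    using right_comodule.rcoact_coassoc[OF M m] by simp
  also have "\<dots> = tmap M C id (slL C \<phi> \<circ> comult C) (rcoact M m)"
    using tmap_comp[OF i(1) comult_lin i(1) lin_slL[OF C_mod p] r] by simp
  finally show ?thesis .
qed

lemma rcoact_ract:
  assumes p: "dual \<phi>" and m: "m \<in> carrier M"
  shows "rcoact M (ract M \<phi> m) = tmap M C id (slR C \<phi> \<circ> comult C) (rcoact M m)"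
proof -
  note r = lin_closed[OF rl m] and i = lin_id[OF Mmod] C_id
  have "rcoact M (ract M \<phi> m)
      = slR (M ** C) \<phi> (tmap (M ** C) C (rcoact M) id (rcoact M m))"
    using slR_tmap[OF rl i(2) p r] by (simp add: ract_def)
  also have "\<dots> = tmap M C id (slR C \<phi>) (assoc M C C
      (tmap (M ** C) C (rcoact M) id (rcoact M m)))"
    by (rule slR_assoc[OF Mmod C_mod C_mod lin_closed[OF lin_tmap[OF rl i(2)] r] p, symmetric])
  also have "\<dots> = tmap M C id (slR C \<phi>) (tmap M (C ** C) id (comult C) (rcoact M m))"
    using right_comodule.rcoact_coassoc[OF M m] by simp
  also have "\<dots> = tmap M C id (slR C \<phi> \<circ> comult C) (rcoact M m)"
    using tmap_comp[OF i(1) comult_lin i(1) lin_slR[OF C_mod p] r] by simp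
  finally show ?thesis .
qed

end

lemma left_comodule_llin: "left_comodule K C N \<Longrightarrow> llin N"
  using left_comodule.module left_comodule.lcoact_linear by (intro linI tensor_mod C_mod)

lemma lcoact_lact:
  assumes N: "left_comodule K C N" and p: "dual \<phi>" and n: "n \<in> carrier N"
  shows "lcoact N (lact N \<phi> n) = tmap C N (slL C \<phi> \<circ> comult C) id (lcoact N n)"
proof -
  note l = left_comodule_llin[OF N] and Nm = left_comodule.module[OF N]
  note r = lin_closed[OF l n] and i = lin_id[OF Nm] C_id
  have "lcoact N (lact N \<phi> n) = slL (C ** N) \<phi> (tmap C (C ** N) id (lcoact N) (lcoact N n))"
    using slL_tmap[OF i(2) l p r] by (simp add: lact_def)
  also have "\<dots> = slL (C ** N) \<phi> (assoc C C N (tmap (C ** C) N (comult C) id (lcoact N n)))"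
    using left_comodule.lcoact_coassoc[OF N n] by simp
  also have "\<dots> = tmap C N (slL C \<phi>) id (tmap (C ** C) N (comult C) id (lcoact N n))"
    by (rule slL_assoc[OF C_mod C_mod Nm lin_closed[OF lin_tmap[OF comult_lin i(1)] r] p])
  also have "\<dots> = tmap C N (slL C \<phi> \<circ> comult C) id (lcoact N n)"
    using tmap_comp[OF comult_lin i(1) lin_slL[OF C_mod p] i(1) r] by simp
  finally show ?thesis .
qed

lemma bicomodule_commuting:
  assumes N: "bicomodule K C N"
  shows "commuting N"
proof -
  note NR = bicomodule.right[OF N] and NL = bicomodule.left[OF N]
  note l = left_comodule_llin[OF NL] and r = right_comodule_rlin[OF NR] and Nm = left_comodule.module[OF NL]
  note i = lin_id[OF Nm] C_id
  have "lact N \<phi> (ract N \<psi> n) = ract N \<psi> (lact N \<phi> n)"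
    if p: "dual \<phi>" and q: "dual \<psi>" and n: "n \<in> carrier N" for \<phi> \<psi> n
  proof -
    note ln = lin_closed[OF l n] and rn = lin_closed[OF r n]
    have "rcoact N (lact N \<phi> n) = slL (N ** C) \<phi> (tmap C (N ** C) id (rcoact N) (lcoact N n))"
      using slL_tmap[OF i(2) r p ln] by (simp add: lact_def)
    also have "\<dots> = slL (N ** C) \<phi> (assoc C N C (tmap (C ** N) C (lcoact N) id (rcoact N n)))"
      using bicomodule.coacts_commute[OF N n] by simp
    also have "\<dots> = tmap N C (slL N \<phi>) id (tmap (C ** N) C (lcoact N) id (rcoact N n))"
      by (rule slL_assoc[OF C_mod Nm C_mod lin_closed[OF lin_tmap[OF l i(2)] rn] p])
    also have "\<dots> = tmap N C (lact N \<phi>) id (rcoact N n)"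
      using tmap_comp[OF l i(2) lin_slL[OF Nm p] i(2) rn] by (simp add: lact_def)
    finally have "ract N \<psi> (lact N \<phi> n) = slR N \<psi> (tmap N C (lact N \<phi>) id (rcoact N n))"
      by (simp add: ract_def)
    also have "\<dots> = lact N \<phi> (ract N \<psi> n)"
      using slR_tmap[OF lin_lact[OF l p] i(2) q rn] by (simp add: ract_def)
    finally show ?thesis by simp
  qed
  then show ?thesis using l r by (auto simp: commuting_def)
qed

section \<open>Cotensor products\<close>

abbreviation cot where "cot M N \<equiv> carrier (cotensor K C M N)"

text \<open>Both sides of the defining equation lie in \<open>M \<otimes> (C \<otimes> N)\<close>. Slicing at the factor \<open>C\<close> gives the two
  operators, and such slices detect equality.\<close>

lemma mem_cotensor:
  assumes M: "rlin M" and N: "llin N"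
  shows "t \<in> cot M N \<longleftrightarrow> t \<in> carrier (M ** N) \<and>
    (\<forall>\<phi>. dual \<phi> \<longrightarrow> tmap M N (ract M \<phi>) id t = tmap M N id (lact N \<phi>) t)"
proof (cases "t \<in> carrier (M ** N)")
  case t: True
  note Mm = linD(1)[OF M] and Nm = linD(1)[OF N]
  note i = lin_id[OF Mm] lin_id[OF Nm] C_id
  let ?x = "tmap M (C ** N) id (lcoact N) t"
    and ?y = "assoc M C N (tmap (M ** C) N (rcoact M) id t)"
  have y: "tmap (M ** C) N (rcoact M) id t \<in> carrier ((M ** C) ** N)"
    by (rule lin_closed[OF lin_tmap[OF M i(2)] t])
  have x': "?x \<in> carrier (M ** (C ** N))" by (rule lin_closed[OF lin_tmap[OF i(1) N] t])
  have y': "?y \<in> carrier (M ** (C ** N))" by (rule lin_closed[OF lin_assoc[OF Mm C_mod Nm] y])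
  have X: "tmap M N id (slL N \<phi>) ?x = tmap M N id (lact N \<phi>) t" if p: "dual \<phi>" for \<phi>
    using tmap_comp[OF i(1) N i(1) lin_slL[OF Nm p] t] by (simp add: lact_def)
  have Y: "tmap M N id (slL N \<phi>) ?y = tmap M N (ract M \<phi>) id t" if p: "dual \<phi>" for \<phi>
    using slM_assoc[OF Mm C_mod Nm y p] tmap_comp[OF M i(2) lin_slR[OF Mm p] i(2) t]
    by (simp add: ract_def)
  have "?x = ?y \<longleftrightarrow> (\<forall>\<phi>. dual \<phi> \<longrightarrow> tmap M N (ract M \<phi>) id t = tmap M N id (lact N \<phi>) t)"
  proof
    assume "?x = ?y"
    then show "\<forall>\<phi>. dual \<phi> \<longrightarrow> tmap M N (ract M \<phi>) id t = tmap M N id (lact N \<phi>) t"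
      using X Y by metis
  next
    assume eq: "\<forall>\<phi>. dual \<phi> \<longrightarrow> tmap M N (ract M \<phi>) id t = tmap M N id (lact N \<phi>) t"
    show "?x = ?y"
    proof (rule slL_detect[OF Mm tensor_mod[OF C_mod Nm] x' y'])
      fix \<xi> assume xi: "lin M \<k> \<xi>"
      note sx = lin_closed[OF lin_slL[OF tensor_mod[OF C_mod Nm] xi]]
      show "slL (C ** N) \<xi> ?x = slL (C ** N) \<xi> ?y"
      proof (rule slL_detect[OF C_mod Nm sx[OF x'] sx[OF y']])
        fix \<phi> assume p: "dual \<phi>"
        have "slL N \<phi> (slL (C ** N) \<xi> z) = slL N \<xi> (tmap M N id (slL N \<phi>) z)"
          if "z \<in> carrier (M ** (C ** N))" for z
          using slL_tmap[OF i(1) lin_slL[OF Nm p] xi that] by simp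
        then show "slL N \<phi> (slL (C ** N) \<xi> ?x) = slL N \<phi> (slL (C ** N) \<xi> ?y)"
          using X[OF p] Y[OF p] x' y' eq p by simp
      qed
    qed
  qed
  then show ?thesis using t by (simp add: cotensor_def)
qed (simp add: cotensor_def)

lemma cot_submodule:
  assumes M: "rlin M" and N: "llin N"
  shows "submodule (cot M N) K (M ** N)"
proof -
  note Mm = linD(1)[OF M] and Nm = linD(1)[OF N]
  let ?f = "tmap M (C ** N) id (lcoact N)"
    and ?g = "assoc M C N \<circ> tmap (M ** C) N (rcoact M) id"
  have f: "lin (M ** N) (M ** (C ** N)) ?f" by (rule lin_tmap[OF lin_id[OF Mm] N])
  have g: "lin (M ** N) (M ** (C ** N)) ?g"
    by (rule lin_comp[OF lin_assoc[OF Mm C_mod Nm] lin_tmap[OF M lin_id[OF Nm]]])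
  interpret T: module K "M ** (C ** N)" by (rule linD[OF f])
  have "(cot M N) = {t \<in> carrier (M ** N). ?f t \<ominus>\<^bsub>M ** (C ** N)\<^esub> ?g t
      = \<zero>\<^bsub>M ** (C ** N)\<^esub>}"
    using T.minus_eq_zero_iff[OF lin_closed[OF f] lin_closed[OF g]] by (auto simp: cotensor_def)
  then show ?thesis using kernel_submodule[OF linD[OF lin_diff[OF f g]]] by simp
qed

lemma cotensor_eq: "(M ** N)\<lparr>carrier := cot M N\<rparr> = cotensor K C M N"
  by (simp add: cotensor_def)

abbreviation rcot :: "('k, 'm, 'c, 'z1) rcomod_scheme \<Rightarrow> ('k, 'n, 'c, 'z2) bicomod_scheme
    \<Rightarrow> ('k, ('m \<times> 'n \<Rightarrow> 'k) set, 'c) rcomod"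
  where "rcot \<equiv> cotensor_rcomod K C"

abbreviation bicot :: "('k, 'm, 'c, 'z1) bicomod_scheme \<Rightarrow> ('k, 'n, 'c, 'z2) bicomod_scheme
    \<Rightarrow> ('k, ('m \<times> 'n \<Rightarrow> 'k) set, 'c) bicomod"
  where "bicot \<equiv> cotensor_bicomod K C"

lemma same_rcot: "same_space (cotensor K C M N) (rcot M N)"
  by (simp add: same_space_def cotensor_rcomod_def Let_def)

lemma same_bicot: "same_space (cotensor K C M N) (bicot M N)"
  by (simp add: same_space_def cotensor_bicomod_def Let_def)

lemma carrier_rcot [simp]: "carrier (rcot M N) = cot M N"
  by (simp add: cotensor_rcomod_def Let_def)

lemma carrier_bicot [simp]: "carrier (bicot M N) = cot M N"
  by (simp add: cotensor_bicomod_def Let_def)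

lemma rcoact_rcot: "rcoact (rcot M N) = cotensor_rcoact K C M N"
  by (simp add: cotensor_rcomod_def Let_def)

lemma lcoact_bicot: "lcoact (bicot M N) = cotensor_lcoact K C M N"
  by (simp add: cotensor_bicomod_def Let_def)

context
  fixes M :: "('k, 'm, 'c, 'z1) rcomod_scheme" and N :: "('k, 'n, 'c, 'z2) bicomod_scheme"
  assumes M: "rlin M" and N: "llin N"
begin

lemma cotensor_incl: "lin (cotensor K C M N) (M ** N) id"
  using lin_incl[OF cot_submodule[OF M N]] tensor_mod[OF linD(1)[OF M] linD(1)[OF N]]
  by (simp add: cotensor_eq)

lemma rcot_incl: "lin (rcot M N) (M ** N) id"
  using same_linD[OF same_rcot cotensor_incl] .

lemma lin_into_rcot:
  assumes "lin V (M ** N) f" "\<And>x. x \<in> carrier V \<Longrightarrow> f x \<in> cot M N"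
  shows "lin V (rcot M N) f"
  using assms linD[OF assms(1)] linD(1)[OF rcot_incl] unfolding lin_def linear_map_def
  by (auto simp: cotensor_rcomod_def cotensor_def Let_def)

lemma cot_tensor: "t \<in> cot M N \<Longrightarrow> t \<in> carrier (M ** N)"
  by (simp add: cotensor_def)

end

lemma bicot_incl: "rlin M \<Longrightarrow> llin N \<Longrightarrow> lin (bicot M N) (M ** N) id"
  using same_linD[OF same_bicot cotensor_incl] .

lemma lin_into_bicot:
  assumes "rlin M" "llin N" "lin V (M ** N) f"
    "\<And>x. x \<in> carrier V \<Longrightarrow> f x \<in> cot M N"
  shows "lin V (bicot M N) f"
  using assms(3,4) linD(1)[OF bicot_incl[OF assms(1,2)]] unfolding lin_def linear_map_def
  by (auto simp: cotensor_bicomod_def cotensor_def Let_def)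

lemma cot_tmap:
  assumes M: "rlin M" and N: "llin N" and M': "rlin M'" and N': "llin N'"
    and f: "rcolin M M' f" and g: "lcolin N N' g"
    and t: "t \<in> cot M N"
  shows "tmap M' N' f g t \<in> cot M' N'"
proof -
  have fl: "lin M M' f" and gl: "lin N N' g" using f g by (auto simp: rcolin_def lcolin_def)
  have tt: "t \<in> carrier (M ** N)" by (rule cot_tensor[OF M N t])
  note i = lin_id[OF linD(1)[OF M]] lin_id[OF linD(1)[OF N]] lin_id[OF linD(1)[OF M']] lin_id[OF linD(1)[OF N']]
  have "tmap M' N' (ract M' \<phi>) id (tmap M' N' f g t) =
    tmap M' N' id (lact N' \<phi>) (tmap M' N' f g t)" if p: "dual \<phi>" for \<phi>
  proof -
    note R = lin_ract[OF M p] and R' = lin_ract[OF M' p] and L = lin_lact[OF N p] and L' = lin_lact[OF N' p]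
    have "tmap M' N' (ract M' \<phi>) id (tmap M' N' f g t) = tmap M' N' (ract M' \<phi> \<circ> f) g t"
      using tmap_comp[OF fl gl R' i(4) tt] by simp
    also have "\<dots> = tmap M' N' (f \<circ> ract M \<phi>) g t"
      by (rule tmap_cong[OF lin_comp[OF R' fl] gl _ _ tt]) (use f p in \<open>auto simp: rcolin_def\<close>)
    also have "\<dots> = tmap M' N' f g (tmap M N (ract M \<phi>) id t)"
      using tmap_comp[OF R i(2) fl gl tt] by simp
    also have "\<dots> = tmap M' N' f g (tmap M N id (lact N \<phi>) t)"
      using t p by (simp add: mem_cotensor[OF M N])
    also have "\<dots> = tmap M' N' f (g \<circ> lact N \<phi>) t"
      using tmap_comp[OF i(1) L fl gl tt] by simp
    also have "\<dots> = tmap M' N' f (lact N' \<phi> \<circ> g) t"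
      by (rule tmap_cong[OF fl lin_comp[OF gl L] _ _ tt]) (use g p in \<open>auto simp: lcolin_def\<close>)
    also have "\<dots> = tmap M' N' id (lact N' \<phi>) (tmap M' N' f g t)"
      using tmap_comp[OF fl gl i(3) L' tt] by simp
    finally show ?thesis .
  qed
  then show ?thesis using lin_closed[OF lin_tmap[OF fl gl] tt] by (simp add: mem_cotensor[OF M' N'])
qed

lemma rcolin_id: "rlin M \<Longrightarrow> rcolin M M id"
  by (auto simp: rcolin_def intro: lin_id linD)

lemma lcolin_id: "llin N \<Longrightarrow> lcolin N N id"
  by (auto simp: lcolin_def intro: lin_id linD)

lemma commutingD:
  assumes "commuting N"
  shows "rlin N" "llin N"
    "dual \<phi> \<Longrightarrow> rcolin N N (lact N \<phi>)" "dual \<phi> \<Longrightarrow> lcolin N N (ract N \<phi>)"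
  using assms by (auto simp: commuting_def rcolin_def lcolin_def intro: lin_ract lin_lact)

section \<open>The right coaction\<close>

context
  fixes M :: "('k, 'm, 'c, 'z1) rcomod_scheme" and N :: "('k, 'n, 'c, 'z2) bicomod_scheme"
  assumes M: "rlin M" and N: "commuting N"
begin

private lemmas NrR = commutingD(1)[OF N] and NlR = commutingD(2)[OF N]
private lemmas MmR = linD(1)[OF M] and NmR = linD(1)[OF NlR]
private lemmas inclR = rcot_incl[OF M NlR]

private lemma tensor_rcot: "((rcot M N) ** W) = (((M ** N)\<lparr>carrier := cot M N\<rparr>) ** W)"
  by (simp only: cotensor_eq same_tensor_left[OF same_rcot])

text \<open>The preimage that defines the coaction exists because the slices of \<open>(id \<otimes> rcoact N) t\<close> are the
  elements \<open>(id \<otimes> ract N \<phi>) t\<close>. They stay in \<open>M \<box> N\<close>, since \<open>ract N \<phi>\<close> commutes with the left operators.\<close>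

lemma cot_rcoact_spec:
  assumes t: "t \<in> cot M N"
  shows "rcoact (rcot M N) t \<in> carrier ((rcot M N) ** C)"
    "assoc M N C (tmap (M ** N) C id id (rcoact (rcot M N) t)) =
      tmap M (N ** C) id (rcoact N) t"
proof -
  have tt: "t \<in> carrier (M ** N)" by (rule cot_tensor[OF M NlR t])
  note i = lin_id[OF MmR] lin_id[OF NmR] C_id
  let ?z = "tmap M (N ** C) id (rcoact N) t"
  let ?h = "\<lambda>s. assoc M N C (tmap (M ** N) C id id s)"
  have z: "?z \<in> carrier (M ** (N ** C))" by (rule lin_closed[OF lin_tmap[OF i(1) NrR] tt])
  obtain y where y: "y \<in> carrier ((M ** N) ** C)" "assoc M N C y = ?z"
    using assoc_surj[OF MmR NmR C_mod z] by blast
  have "slR (M ** N) \<phi> y \<in> cot M N" if p: "dual \<phi>" for \<phi>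
  proof -
    have "slR (M ** N) \<phi> y = tmap M N id (slR N \<phi>) ?z"
      using slR_assoc[OF MmR NmR C_mod y(1) p] y(2) by simp
    also have "\<dots> = tmap M N id (ract N \<phi>) t"
      using tmap_comp[OF i(1) NrR i(1) lin_slR[OF NmR p] tt] by (simp add: ract_def)
    also have "\<dots> \<in> cot M N"
      by (rule cot_tmap[OF M NlR M NlR rcolin_id[OF M] commutingD(4)[OF N p] t])
    finally show ?thesis .
  qed
  from slR_mem[OF C_mod tensor_mod[OF MmR NmR] cot_submodule[OF M NlR] y(1) this]
  obtain s where "s \<in> carrier ((rcot M N) ** C)" "tmap (M ** N) C id id s = y"
    unfolding tensor_rcot .
  then have im: "?z \<in> ?h ` carrier ((cotensor K C M N) ** C)"
    using y(2) by (auto simp: same_tensor_left[OF same_rcot])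
  show "rcoact (rcot M N) t \<in> carrier ((rcot M N) ** C)"
    using inv_into_into[OF im] by (simp add: rcoact_rcot cotensor_rcoact_def same_tensor_left[OF same_rcot])
  show "?h (rcoact (rcot M N) t) = ?z"
    using f_inv_into_f[OF im] by (simp add: rcoact_rcot cotensor_rcoact_def)
qed

lemma ract_rcot:
  assumes t: "t \<in> cot M N" and p: "dual \<phi>"
  shows "ract (rcot M N) \<phi> t = tmap M N id (ract N \<phi>) t"
proof -
  have tt: "t \<in> carrier (M ** N)" by (rule cot_tensor[OF M NlR t])
  note i = lin_id[OF MmR] lin_id[OF NmR] C_id and s = cot_rcoact_spec[OF t]
  have "ract (rcot M N) \<phi> t = slR (M ** N) \<phi> (tmap (M ** N) C id id (rcoact (rcot M N) t))"
    using slR_tmap[OF inclR i(3) p s(1)] by (simp add: ract_def)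
  also have "\<dots> = tmap M N id (slR N \<phi>) (tmap M (N ** C) id (rcoact N) t)"
    using slR_assoc[OF MmR NmR C_mod lin_closed[OF lin_tmap[OF inclR i(3)] s(1)] p] s(2) by simp
  also have "\<dots> = tmap M N id (ract N \<phi>) t"
    using tmap_comp[OF i(1) NrR i(1) lin_slR[OF NmR p] tt] by (simp add: ract_def)
  finally show ?thesis .
qed

lemma rcot_rlin: "rlin (rcot M N)"
proof (rule lin_by_detection[where P = "dual" and s = "slR (rcot M N)", OF linD(1)[OF inclR] tensor_mod[OF linD(1)[OF inclR] C_mod] _ _ lin_slR[OF linD(1)[OF inclR]]])
  show "x = y" if "x \<in> carrier (rcot M N ** C)" "y \<in> carrier (rcot M N ** C)"
    "\<And>\<phi>. dual \<phi> \<Longrightarrow> slR (rcot M N) \<phi> x = slR (rcot M N) \<phi> y" for x y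
    by (rule slR_detect[OF C_mod linD(1)[OF inclR] that])
  show "rcoact (rcot M N) t \<in> carrier ((rcot M N) ** C)" if "t \<in> carrier (rcot M N)" for t
    using cot_rcoact_spec(1) that by simp
  fix \<phi> assume p: "dual \<phi>"
  have "lin (rcot M N) (M ** N) (tmap M N id (ract N \<phi>))"
    using lin_comp[OF lin_tmap[OF lin_id[OF MmR] lin_ract[OF NrR p]] inclR] by simp
  then have "lin (rcot M N) (rcot M N) (tmap M N id (ract N \<phi>))"
    by (rule lin_into_rcot[OF M NlR])
      (use cot_tmap[OF M NlR M NlR rcolin_id[OF M] commutingD(4)[OF N p]] in simp)
  then show "lin (rcot M N) (rcot M N) (\<lambda>t. slR (rcot M N) \<phi> (rcoact (rcot M N) t))"
    by (rule lin_cong) (use ract_rcot[OF _ p] in \<open>simp add: ract_def\<close>)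
qed

end

section \<open>The left coaction\<close>

context
  fixes N :: "('k, 'n, 'c, 'z1) bicomod_scheme" and P :: "('k, 'p, 'c, 'z2) bicomod_scheme"
  assumes N: "commuting N" and P: "llin P"
begin

private lemmas NrL = commutingD(1)[OF N] and NlL = commutingD(2)[OF N]
private lemmas NmL = linD(1)[OF NlL] and PmL = linD(1)[OF P]
private lemmas inclL = bicot_incl[OF NrL P]

private lemma tensor_bicot: "(V ** (bicot N P)) = (V ** ((N ** P)\<lparr>carrier := cot N P\<rparr>))"
  by (simp only: cotensor_eq same_tensor_right[OF same_bicot])

lemma bicot_incl_inj:
  assumes "module K V" "x \<in> carrier (V ** (bicot N P))" "y \<in> carrier (V ** (bicot N P))"
    "tmap V (N ** P) id id x = tmap V (N ** P) id id y"
  shows "x = y"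
  using incl_right_inj[OF assms(1) tensor_mod[OF NmL PmL] cot_submodule[OF NrL P]] assms(2-4)
  unfolding tensor_bicot by blast

lemma bicot_mem:
  assumes V: "module K V" and z: "z \<in> carrier (V ** (N ** P))"
    and mem: "\<And>\<xi>. lin V \<k> \<xi> \<Longrightarrow> slL (N ** P) \<xi> z \<in> cot N P"
  obtains s where "s \<in> carrier (V ** (bicot N P))" "tmap V (N ** P) id id s = z"
  using slL_mem[OF V tensor_mod[OF NmL PmL] cot_submodule[OF NrL P] z mem] unfolding tensor_bicot .

lemma cot_lcoact_spec:
  assumes t: "t \<in> cot N P"
  shows "lcoact (bicot N P) t \<in> carrier (C ** (bicot N P))"
    "tmap C (N ** P) id id (lcoact (bicot N P) t) =
      assoc C N P (tmap (C ** N) P (lcoact N) id t)"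
proof -
  have tt: "t \<in> carrier (N ** P)" by (rule cot_tensor[OF NrL P t])
  note i = lin_id[OF NmL] lin_id[OF PmL] C_id
  let ?y = "tmap (C ** N) P (lcoact N) id t"
  let ?z = "assoc C N P ?y"
  have y: "?y \<in> carrier ((C ** N) ** P)" by (rule lin_closed[OF lin_tmap[OF NlL i(2)] tt])
  have z: "?z \<in> carrier (C ** (N ** P))" by (rule lin_closed[OF lin_assoc[OF C_mod NmL PmL] y])
  have "slL (N ** P) \<phi> ?z \<in> cot N P" if p: "dual \<phi>" for \<phi>
  proof -
    have "slL (N ** P) \<phi> ?z = tmap N P (lact N \<phi>) id t"
      using slL_assoc[OF C_mod NmL PmL y p] tmap_comp[OF NlL i(2) lin_slL[OF NmL p] i(2) tt]
      by (simp add: lact_def)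
    also have "\<dots> \<in> cot N P"
      by (rule cot_tmap[OF NrL P NrL P commutingD(3)[OF N p] lcolin_id[OF P] t])
    finally show ?thesis .
  qed
  from bicot_mem[OF C_mod z this]
  obtain s where "s \<in> carrier (C ** (bicot N P))" "tmap C (N ** P) id id s = ?z" .
  then have im: "?z \<in> tmap C (N ** P) id id ` carrier (C ** (cotensor K C N P))"
    by (auto simp: same_tensor_right[OF same_bicot])
  show "lcoact (bicot N P) t \<in> carrier (C ** (bicot N P))"
    using inv_into_into[OF im] by (simp add: lcoact_bicot cotensor_lcoact_def same_tensor_right[OF same_bicot])
  show "tmap C (N ** P) id id (lcoact (bicot N P) t) = ?z"
    using f_inv_into_f[OF im] by (simp add: lcoact_bicot cotensor_lcoact_def)
qed

lemma lact_bicot: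
  assumes t: "t \<in> cot N P" and p: "dual \<phi>"
  shows "lact (bicot N P) \<phi> t = tmap N P (lact N \<phi>) id t"
proof -
  have tt: "t \<in> carrier (N ** P)" by (rule cot_tensor[OF NrL P t])
  note i = lin_id[OF NmL] lin_id[OF PmL] C_id and s = cot_lcoact_spec[OF t]
  have y: "tmap (C ** N) P (lcoact N) id t \<in> carrier ((C ** N) ** P)"
    by (rule lin_closed[OF lin_tmap[OF NlL i(2)] tt])
  have "lact (bicot N P) \<phi> t = slL (N ** P) \<phi> (tmap C (N ** P) id id (lcoact (bicot N P) t))"
    using slL_tmap[OF i(3) inclL p s(1)] by (simp add: lact_def)
  also have "\<dots> = tmap N P (lact N \<phi>) id t"
    using slL_assoc[OF C_mod NmL PmL y p] tmap_comp[OF NlL i(2) lin_slL[OF NmL p] i(2) tt] s(2)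
    by (simp add: lact_def)
  finally show ?thesis .
qed

lemma bicot_llin: "llin (bicot N P)"
proof (rule lin_by_detection[where P = "dual" and s = "slL (bicot N P)", OF linD(1)[OF inclL] tensor_mod[OF C_mod linD(1)[OF inclL]] _ _ lin_slL[OF linD(1)[OF inclL]]])
  show "x = y" if "x \<in> carrier (C ** bicot N P)" "y \<in> carrier (C ** bicot N P)"
    "\<And>\<phi>. dual \<phi> \<Longrightarrow> slL (bicot N P) \<phi> x = slL (bicot N P) \<phi> y" for x y
    by (rule slL_detect[OF C_mod linD(1)[OF inclL] that])
  show "lcoact (bicot N P) t \<in> carrier (C ** (bicot N P))" if "t \<in> carrier (bicot N P)" for t
    using cot_lcoact_spec(1) that by simp
  fix \<phi> assume p: "dual \<phi>"
  have "lin (bicot N P) (N ** P) (tmap N P (lact N \<phi>) id)"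
    using lin_comp[OF lin_tmap[OF lin_lact[OF NlL p] lin_id[OF PmL]] inclL] by simp
  then have "lin (bicot N P) (bicot N P) (tmap N P (lact N \<phi>) id)"
    by (rule lin_into_bicot[OF NrL P])
      (use cot_tmap[OF NrL P NrL P commutingD(3)[OF N p] lcolin_id[OF P]] in simp)
  then show "lin (bicot N P) (bicot N P) (\<lambda>t. slL (bicot N P) \<phi> (lcoact (bicot N P) t))"
    by (rule lin_cong) (use lact_bicot[OF _ p] in \<open>simp add: lact_def\<close>)
qed

end

section \<open>The associator of cotensor products\<close>

text \<open>A left slice by a functional on \<open>M\<close> is a right colinear map from \<open>M \<box> N\<close> to \<open>N\<close>. So it maps \<open>t\<close> into
  \<open>N \<box> P\<close>, and the rebracketed element comes from \<open>M \<otimes> (N \<box> P)\<close>. That it even lies in \<open>M \<box> (N \<box> P)\<close> is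
  checked in \<open>M \<otimes> (N \<otimes> P)\<close>, where the operators of \<open>N \<box> P\<close> are those of \<open>N\<close>.\<close>

lemma cot_assoc_spec:
  assumes M: "rlin M" and N: "commuting N" and P: "llin P"
    and t: "t \<in> cot (rcot M N) P"
  shows "cotensor_assoc K C M N P t \<in> cot M (bicot N P)"
    "tmap M (N ** P) id id (cotensor_assoc K C M N P t) =
      assoc M N P (tmap (M ** N) P id id t)"
proof -
  note Nr = commutingD(1)[OF N] and Nl = commutingD(2)[OF N]
  note Mm = linD(1)[OF M] and Nm = linD(1)[OF Nr] and Pm = linD(1)[OF P]
  note MNr = rcot_rlin[OF M N] and NPl = bicot_llin[OF N P]
  note incl = rcot_incl[OF M Nl] and incl' = bicot_incl[OF Nr P]
  note i = lin_id[OF Mm] lin_id[OF Nm] lin_id[OF Pm]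
  have tt: "t \<in> carrier ((rcot M N) ** P)" by (rule cot_tensor[OF MNr P t])
  let ?t = "tmap (M ** N) P id id t"
  let ?z = "assoc M N P ?t"
  have t': "?t \<in> carrier ((M ** N) ** P)" by (rule lin_closed[OF lin_tmap[OF incl i(3)] tt])
  have z: "?z \<in> carrier (M ** (N ** P))" by (rule lin_closed[OF lin_assoc[OF Mm Nm Pm] t'])
  have "slL (N ** P) \<xi> ?z \<in> cot N P" if xi: "lin M \<k> \<xi>" for \<xi>
  proof -
    have sl: "lin (rcot M N) N (slL N \<xi>)" using lin_comp[OF lin_slL[OF Nm xi] incl] by simp
    have "rcolin (rcot M N) N (slL N \<xi>)"
      unfolding rcolin_def
    proof (intro conjI sl allI impI ballI)
      fix \<phi> x assume p: "dual \<phi>" and x: "x \<in> carrier (rcot M N)"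
      then have x: "x \<in> cot M N" by simp
      show "ract N \<phi> (slL N \<xi> x) = slL N \<xi> (ract (rcot M N) \<phi> x)"
        using slL_tmap[OF i(1) lin_ract[OF Nr p] xi cot_tensor[OF M Nl x]]
        by (simp add: ract_rcot[OF M N x p])
    qed
    from cot_tmap[OF MNr P Nr P this lcolin_id[OF P] t]
    show ?thesis
      using slL_assoc[OF Mm Nm Pm t' xi] tmap_comp[OF incl i(3) lin_slL[OF Nm xi] i(3) tt] by simp
  qed
  from bicot_mem[OF N P Mm z this]
  obtain u where u: "u \<in> carrier (M ** (bicot N P))" "tmap M (N ** P) id id u = ?z" .
  have "u \<in> cot M (bicot N P)"
    unfolding mem_cotensor[OF M NPl]
  proof (intro conjI u(1) allI impI)
    fix \<phi> assume p: "dual \<phi>"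
    note R = lin_ract[OF M p] and L = lin_lact[OF Nl p] and L' = lin_lact[OF NPl p]
    note j = lin_id[OF linD(1)[OF NPl]] lin_id[OF tensor_mod[OF Nm Pm]]
    show "tmap M (bicot N P) (ract M \<phi>) id u = tmap M (bicot N P) id (lact (bicot N P) \<phi>) u"
    proof (rule bicot_incl_inj[OF N P Mm])
      show "tmap M (bicot N P) (ract M \<phi>) id u \<in> carrier (M ** (bicot N P))"
        by (rule lin_closed[OF lin_tmap[OF R j(1)] u(1)])
      show "tmap M (bicot N P) id (lact (bicot N P) \<phi>) u \<in> carrier (M ** (bicot N P))"
        by (rule lin_closed[OF lin_tmap[OF i(1) L'] u(1)])
      have "tmap M (N ** P) id id (tmap M (bicot N P) (ract M \<phi>) id u)
          = tmap M (N ** P) (ract M \<phi>) (tmap N P id id) (tmap M (N ** P) id id u)"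
      proof -
        have "tmap M (N ** P) id id (tmap M (bicot N P) (ract M \<phi>) id u)
          = tmap M (N ** P) (ract M \<phi>) id u"
          using tmap_comp[OF R j(1) i(1) incl' u(1)] by simp
        also have "\<dots> = tmap M (N ** P) (ract M \<phi>) (tmap N P id id \<circ> id) u"
          by (rule tmap_cong[OF R incl' _ _ u(1)])
            (auto simp: tmap_id[OF Nm Pm] dest: cot_tensor[OF Nr P])
        also have "\<dots> = tmap M (N ** P) (ract M \<phi>) (tmap N P id id) (tmap M (N ** P) id id u)"
          using tmap_comp[OF i(1) incl' R lin_tmap[OF i(2,3)] u(1)] by simp
        finally show ?thesis .
      qed
      also have "\<dots> = assoc M N P (tmap (M ** N) P (tmap M N (ract M \<phi>) id) id ?t)"
        using assoc_natural[OF R i(2,3) t'] u(2) by simp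
      also have "tmap (M ** N) P (tmap M N (ract M \<phi>) id) id ?t
          = tmap (M ** N) P (tmap M N (ract M \<phi>) id \<circ> id) id t"
        using tmap_comp[OF incl i(3) lin_tmap[OF R i(2)] i(3) tt] by simp
      also have "\<dots> = tmap (M ** N) P (tmap M N id (lact N \<phi>) \<circ> id) id t"
        by (rule tmap_cong[OF lin_comp[OF lin_tmap[OF R i(2)] incl] i(3) _ _ tt])
          (use p in \<open>auto simp: mem_cotensor[OF M Nl]\<close>)
      also have "\<dots> = tmap (M ** N) P (tmap M N id (lact N \<phi>)) id ?t"
        using tmap_comp[OF incl i(3) lin_tmap[OF i(1) L] i(3) tt] by simp
      also have "assoc M N P \<dots> = tmap M (N ** P) id (tmap N P (lact N \<phi>) id)
          (tmap M (N ** P) id id u)"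
        using assoc_natural[OF i(1) L i(3) t'] u(2) by simp
      also have "\<dots> = tmap M (N ** P) id (tmap N P (lact N \<phi>) id \<circ> id) u"
        using tmap_comp[OF i(1) incl' i(1) lin_tmap[OF L i(3)] u(1)] by simp
      also have "\<dots> = tmap M (N ** P) id (id \<circ> lact (bicot N P) \<phi>) u"
        by (rule tmap_cong[OF i(1) lin_comp[OF lin_tmap[OF L i(3)] incl'] _ _ u(1)])
          (auto simp: lact_bicot[OF N P _ p])
      also have "\<dots> = tmap M (N ** P) id id (tmap M (bicot N P) id (lact (bicot N P) \<phi>) u)"
        using tmap_comp[OF i(1) L' i(1) incl' u(1)] by simp
      finally show "tmap M (N ** P) id id (tmap M (bicot N P) (ract M \<phi>) id u) =
        tmap M (N ** P) id id (tmap M (bicot N P) id (lact (bicot N P) \<phi>) u)" .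
    qed
  qed
  then have im: "?z \<in> tmap M (N ** P) id id ` (cot M (bicot N P))"
    using u(2) by force
  show "cotensor_assoc K C M N P t \<in> cot M (bicot N P)"
    using inv_into_into[OF im] by (simp add: cotensor_assoc_def)
  show "tmap M (N ** P) id id (cotensor_assoc K C M N P t) = ?z"
    using f_inv_into_f[OF im] by (simp add: cotensor_assoc_def)
qed

end

section \<open>The cokernel of the unit and its section\<close>

lemma same_tensor_map_left: "same_space V V' \<Longrightarrow> tensor_map K V W f g = tensor_map K V' W f g"
  using same_tensor_left[of V V' K W]
  by (simp add: tensor_map_def pure_tensor_def tensor_kernel_def bilinear_relations_def same_space_def)

lemma same_tensor_map_right: "same_space W W' \<Longrightarrow> tensor_map K V W f g = tensor_map K V W' f g"
  using same_tensor_right[of W W' K V]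
  by (simp add: tensor_map_def pure_tensor_def tensor_kernel_def bilinear_relations_def same_space_def)

context ground_field
begin

lemma slR_diff:
  assumes V: "module K V" and p: "lin W \<k> \<phi>" and q: "lin W \<k> \<psi>" and x: "x \<in> carrier (V ** W)"
  shows "slR V (\<lambda>w. \<phi> w \<ominus>\<^bsub>\<k>\<^esub> \<psi> w) x = slR V \<phi> x \<ominus>\<^bsub>V\<^esub> slR V \<psi> x"
proof -
  interpret V: module K V by fact
  note d = lin_diff[OF p q]
  have c: "\<phi> w \<in> carrier K" "\<psi> w \<in> carrier K" if "w \<in> carrier W" for w
    using lin_closed[OF p that] lin_closed[OF q that] by simp_all
  interpret S: module K \<k> by (rule self_mod)
  have n: "\<ominus>\<^bsub>\<k>\<^esub> y = \<ominus> y" if "y \<in> carrier K" for y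
    by (rule S.M.minus_equality) (use that in \<open>simp_all add: l_neg\<close>)
  show ?thesis
  proof (rule tensor_ext[OF lin_slR[OF V d] lin_diff[OF lin_slR[OF V p] lin_slR[OF V q]] V linD(1)[OF p] _ x])
    fix v w assume vw: "v \<in> carrier V" "w \<in> carrier W"
    show "slR V (\<lambda>w. \<phi> w \<ominus>\<^bsub>\<k>\<^esub> \<psi> w) (pure V W v w) =
      slR V \<phi> (pure V W v w) \<ominus>\<^bsub>V\<^esub> slR V \<psi> (pure V W v w)"
      unfolding slR_pure[OF V d vw] slR_pure[OF V p vw] slR_pure[OF V q vw]
      using vw c by (simp add: a_minus_def n V.smult_l_distr V.smult_l_minus)
  qed
qed

lemma slR_comp:
  "lin U \<k> \<phi> \<Longrightarrow> lin W U g \<Longrightarrow> module K V \<Longrightarrow> x \<in> carrier (V ** W) \<Longrightarrow>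
    slR V (\<phi> \<circ> g) x = slR V \<phi> (tmap V U id g x)"
  using slR_tmap[OF lin_id] by (metis id_apply)

end

locale character_setting = coalgebra_over_field K C
  for K :: "('k, 'x) ring_scheme" (structure) and C :: "('k, 'c, 'y) coalg_scheme" +
  fixes A :: "('k, 'a, 'c, 'z) C_ring_data_scheme" and \<kappa> :: "'a \<Rightarrow> 'k"
    and lam1 :: "'a set \<Rightarrow> 'c" and lam2 :: "('a set \<times> 'a set \<Rightarrow> 'k) set \<Rightarrow> 'a set"
    and M :: "('k, 'm, 'c, 'w) rcomod_scheme"
  assumes ring: "C_ring K C A"
    and char: "character K C A \<kappa>"
    and lam1_linear: "linear_map K (coker_bicomod K C A) C lam1"
    and lam1_eq: "\<And>a. a \<in> carrier A \<Longrightarrow>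
      lam1 (coker_proj C A a) = left_unit K C (tensor_map K (self_module K) C \<kappa> id (rcoact A a))
        \<ominus>\<^bsub>C\<^esub> right_unit K C (tensor_map K C (self_module K) id \<kappa> (lcoact A a))"
    and lam2_linear: "linear_map K (cotensor K C (coker_bicomod K C A) (coker_bicomod K C A))
      (coker_bicomod K C A) lam2"
    and lam2_eq: "\<And>t. t \<in> carrier (cotensor K C A A) \<Longrightarrow>
      lam2 (tensor_map K (coker_bicomod K C A) (coker_bicomod K C A) (coker_proj C A) (coker_proj C A) t) =
        left_unit K (coker_bicomod K C A)
          (tensor_map K (self_module K) (coker_bicomod K C A) \<kappa> (coker_proj C A) t)
        \<ominus>\<^bsub>coker_bicomod K C A\<^esub> coker_proj C A (mu A t)
        \<oplus>\<^bsub>coker_bicomod K C A\<^esub> right_unit K (coker_bicomod K C A)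
          (tensor_map K (coker_bicomod K C A) (self_module K) (coker_proj C A) \<kappa> t)"
    and comod: "right_comodule K C M"
begin

abbreviation B where "B \<equiv> coker_bicomod K C A"
abbreviation \<pi> where "\<pi> \<equiv> coker_proj C A"

lemma A_comm: "commuting A"
  by (rule bicomodule_commuting[OF C_ring.bicomodule[OF ring]])

lemmas A_rlin = commutingD(1)[OF A_comm] and A_llin = commutingD(2)[OF A_comm]

lemma A_left: "left_comodule K C A"
  by (rule bicomodule.left[OF C_ring.bicomodule[OF ring]])

lemmas A_mod = linD(1)[OF A_rlin] and A_id = lin_id[OF linD(1)[OF A_rlin]]

lemma mu_lact: "lcolin (bicot A A) A (mu A)"
  by (rule bicomod_map_commutes[OF bicot_llin[OF A_comm A_llin] A_llin C_ring.mu_map[OF ring]])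

lemma mu_lin: "lin (bicot A A) A (mu A)" using mu_lact by (simp add: lcolin_def)

lemma eta_lin: "lin C A (eta A)"
  using C_ring.eta_map[OF ring]
  by (intro linI C_mod A_mod)
    (auto simp: bicomod_map_def rcomod_map_def coalg_bicomod_def linear_map_def)

lemma rcoact_eta: "c \<in> carrier C \<Longrightarrow> rcoact A (eta A c) = tmap A C (eta A) id (comult C c)"
  and lcoact_eta: "c \<in> carrier C \<Longrightarrow> lcoact A (eta A c) = tmap C A id (eta A) (comult C c)"
  using C_ring.eta_map[OF ring] by (auto simp: bicomod_map_def rcomod_map_def coalg_bicomod_def)

lemma ract_eta:
  assumes "dual \<phi>" "c \<in> carrier C"
  shows "ract A \<phi> (eta A c) = eta A (slR C \<phi> (comult C c))"
  using slR_tmap[OF eta_lin C_id assms(1) lin_closed[OF comult_lin assms(2)]]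
  by (simp add: ract_def rcoact_eta assms)

lemma lact_eta:
  assumes "dual \<phi>" "c \<in> carrier C"
  shows "lact A \<phi> (eta A c) = eta A (slL C \<phi> (comult C c))"
  using slL_tmap[OF C_id eta_lin assms(1) lin_closed[OF comult_lin assms(2)]]
  by (simp add: lact_def lcoact_eta assms)

lemma kappa_lin: "lin A \<k> \<kappa>"
  using char by (intro linI A_mod self_mod) (simp add: character_def)

lemma kappa_eta: "c \<in> carrier C \<Longrightarrow> \<kappa> (eta A c) = counit C c"
  using char by (simp add: character_def)

lemma kappa_mu:
  assumes t: "t \<in> cot A A"
  shows "\<kappa> (mu A t) = \<kappa> (slR A \<kappa> t)"
proof -
  have tt: "t \<in> carrier (A ** A)" by (rule cot_tensor[OF A_rlin A_llin t])
  show ?thesis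
    using char t left_unit_tmap[OF kappa_lin kappa_lin tt] slice_slice[OF kappa_lin kappa_lin tt]
    by (simp add: character_def)
qed

abbreviation Q where "Q \<equiv> quot_module A (eta A ` carrier C)"

lemma quotient: "quotient_module K A (eta A ` carrier C)"
  by (intro quotient_module.intro quotient_module_axioms.intro A_mod image_submodule linD[OF eta_lin])

lemma same_Q: "same_space Q B"
  by (simp add: same_space_def coker_bicomod_def Let_def)

lemma Q_mod: "module K Q" by (rule quotient_module.quot_module[OF quotient])

lemma B_mod: "module K B"
  by (rule same_module[OF same_Q Q_mod])

lemma pi_lin: "lin A B \<pi>"
proof -
  have "lin A Q \<pi>"
    using quotient_module.proj_linear[OF quotient] unfolding coker_proj_def[abs_def]
    by (intro linI A_mod Q_mod)
  then show ?thesis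
    using same_Q B_mod by (auto simp: lin_def linear_map_def same_space_def)
qed

lemma carrier_B: "carrier B = \<pi> ` carrier A"
  using quotient_module.quot_simps(1)[OF quotient] same_Q by (auto simp: same_space_def coker_proj_def)

lemma B_cases:
  assumes "b \<in> carrier B"
  obtains a where "a \<in> carrier A" "b = \<pi> a"
  using assms carrier_B by auto

lemma pi_eta:
  assumes "c \<in> carrier C"
  shows "\<pi> (eta A c) = \<zero>\<^bsub>B\<^esub>"
proof -
  interpret Q: quotient_module K A "eta A ` carrier C" by (rule quotient)
  have e: "eta A c \<in> carrier A" by (rule lin_closed[OF eta_lin assms])
  have "\<pi> (eta A c) = \<pi> \<zero>\<^bsub>A\<^esub>"
    unfolding coker_proj_def
    by (subst Q.proj_eq_iff) (use e assms in \<open>auto simp: a_minus_def Q.a_inv_zero\<close>)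
  then show ?thesis using lin_zero[OF pi_lin] by simp
qed

lemma some_rep:
  assumes f: "lin A P f" and "\<And>c. c \<in> carrier C \<Longrightarrow> f (eta A c) = \<zero>\<^bsub>P\<^esub>" "a \<in> carrier A"
  shows "f (SOME a'. a' \<in> \<pi> a) = f a"
  unfolding coker_proj_def
  by (rule quotient_module.linear_some_rep[OF quotient linD(2,3)[OF f] _ assms(3)]) (use assms(2) in auto)

lemma lin_from_B:
  assumes f: "lin A P f" and g: "\<And>a. a \<in> carrier A \<Longrightarrow> g (\<pi> a) = f a"
  shows "lin B P g"
proof (intro linI B_mod linD(2)[OF f] linear_mapI)
  interpret A: module K A by (rule A_mod)
  fix x y assume "x \<in> carrier B" "y \<in> carrier B"
  then show "g (x \<oplus>\<^bsub>B\<^esub> y) = g x \<oplus>\<^bsub>P\<^esub> g y"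
    by (elim B_cases) (simp add: lin_add[OF pi_lin, symmetric] g lin_add[OF f])
next
  interpret A: module K A by (rule A_mod)
  fix a x assume "a \<in> carrier K" "x \<in> carrier B"
  then show "g (a \<odot>\<^bsub>B\<^esub> x) = a \<odot>\<^bsub>P\<^esub> g x"
    by (elim B_cases) (simp add: lin_smult[OF pi_lin, symmetric] g lin_smult[OF f])
next
  fix x assume "x \<in> carrier B"
  then show "g x \<in> carrier P" by (elim B_cases) (simp add: g lin_closed[OF f])
qed

lemma rcoact_B:
  assumes a: "a \<in> carrier A"
  shows "rcoact B (\<pi> a) = tmap B C \<pi> id (rcoact A a)"
proof -
  have f: "lin A (B ** C) (tmap B C \<pi> id \<circ> rcoact A)"
    by (rule lin_comp[OF lin_tmap[OF pi_lin C_id] A_rlin])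
  have "(tmap B C \<pi> id \<circ> rcoact A) (SOME a'. a' \<in> \<pi> a) = (tmap B C \<pi> id \<circ> rcoact A) a"
  proof (rule some_rep[OF f _ a])
    fix c assume c: "c \<in> carrier C"
    note d = lin_closed[OF comult_lin c]
    show "(tmap B C \<pi> id \<circ> rcoact A) (eta A c) = \<zero>\<^bsub>B ** C\<^esub>"
      using tmap_comp[OF eta_lin C_id pi_lin C_id d]
        tmap_zero_left[OF lin_comp[OF pi_lin eta_lin] C_id d]
      by (simp add: rcoact_eta c pi_eta)
  qed
  moreover have "rcoact B (\<pi> a) = tmap Q C \<pi> id (rcoact A (SOME a'. a' \<in> \<pi> a))"
    by (simp add: coker_bicomod_def Let_def)
  ultimately show ?thesis by (simp only: same_tensor_map_left[OF same_Q] comp_apply)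
qed

lemma lcoact_B:
  assumes a: "a \<in> carrier A"
  shows "lcoact B (\<pi> a) = tmap C B id \<pi> (lcoact A a)"
proof -
  have f: "lin A (C ** B) (tmap C B id \<pi> \<circ> lcoact A)"
    by (rule lin_comp[OF lin_tmap[OF C_id pi_lin] A_llin])
  have "(tmap C B id \<pi> \<circ> lcoact A) (SOME a'. a' \<in> \<pi> a) = (tmap C B id \<pi> \<circ> lcoact A) a"
  proof (rule some_rep[OF f _ a])
    fix c assume c: "c \<in> carrier C"
    note d = lin_closed[OF comult_lin c]
    show "(tmap C B id \<pi> \<circ> lcoact A) (eta A c) = \<zero>\<^bsub>C ** B\<^esub>"
      using tmap_comp[OF C_id eta_lin C_id pi_lin d]
        tmap_zero_right[OF C_id lin_comp[OF pi_lin eta_lin] d]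
      by (simp add: lcoact_eta c pi_eta)
  qed
  moreover have "lcoact B (\<pi> a) = tmap C Q id \<pi> (lcoact A (SOME a'. a' \<in> \<pi> a))"
    by (simp add: coker_bicomod_def Let_def)
  ultimately show ?thesis by (simp only: same_tensor_map_right[OF same_Q] comp_apply)
qed

lemma B_rlin: "rlin B"
  by (rule lin_from_B[OF lin_comp[OF lin_tmap[OF pi_lin C_id] A_rlin]]) (simp add: rcoact_B)

lemma B_llin: "llin B"
  by (rule lin_from_B[OF lin_comp[OF lin_tmap[OF C_id pi_lin] A_llin]]) (simp add: lcoact_B)

lemma ract_B: "dual \<phi> \<Longrightarrow> a \<in> carrier A \<Longrightarrow> ract B \<phi> (\<pi> a) = \<pi> (ract A \<phi> a)"
  by (simp add: ract_def rcoact_B slR_tmap[OF pi_lin C_id] lin_closed[OF A_rlin])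

lemma lact_B: "dual \<phi> \<Longrightarrow> a \<in> carrier A \<Longrightarrow> lact B \<phi> (\<pi> a) = \<pi> (lact A \<phi> a)"
  by (simp add: lact_def lcoact_B slL_tmap[OF C_id pi_lin] lin_closed[OF A_llin])

lemma pi_ract: "rcolin A B \<pi>"
  by (simp add: rcolin_def pi_lin ract_B)

lemma pi_lact: "lcolin A B \<pi>"
  by (simp add: lcolin_def pi_lin lact_B)

lemma B_comm: "commuting B"
  unfolding commuting_def
proof (intro conjI B_rlin B_llin allI impI)
  fix \<phi> \<psi> b assume p: "dual \<phi>" and q: "dual \<psi>" and "b \<in> carrier B"
  then obtain a where a: "a \<in> carrier A" "b = \<pi> a" by (elim B_cases)
  show "lact B \<phi> (ract B \<psi> b) = ract B \<psi> (lact B \<phi> b)"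
    using A_comm p q a
    by (simp add: ract_B lact_B lin_closed[OF lin_ract[OF A_rlin q]] lin_closed[OF lin_lact[OF A_llin p]]
        commuting_def)
qed

lemma lam1_lin: "lin B C lam1"
  by (intro linI B_mod C_mod lam1_linear)

lemma lam2_lin: "lin (bicot B B) B lam2"
  using linD(1)[OF bicot_incl[OF B_rlin B_llin]] B_mod lam2_linear
  by (intro linI) (simp_all add: same_linear_map[OF same_bicot, symmetric])

text \<open>Slices by \<open>\<phi>\<close> and by \<open>\<kappa>\<close> can be interchanged. In this form \<open>lam1\<close> enters the connection condition.\<close>

lemma lam1_slice:
  assumes p: "dual \<phi>" and a: "a \<in> carrier A"
  shows "\<phi> (lam1 (\<pi> a)) = \<kappa> (ract A \<phi> a) \<ominus>\<^bsub>\<k>\<^esub> \<kappa> (lact A \<phi> a)"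
proof -
  note r = lin_closed[OF A_rlin a] and l = lin_closed[OF A_llin a]
  have "\<phi> (lam1 (\<pi> a)) = \<phi> (slL C \<kappa> (rcoact A a) \<ominus>\<^bsub>C\<^esub> slR C \<kappa> (lcoact A a))"
    by (simp add: lam1_eq[OF a] slL_def slR_def)
  also have "\<dots> = \<phi> (slL C \<kappa> (rcoact A a)) \<ominus>\<^bsub>\<k>\<^esub> \<phi> (slR C \<kappa> (lcoact A a))"
    by (rule lin_minus[OF p lin_closed[OF lin_slL[OF C_mod kappa_lin] r]
          lin_closed[OF lin_slR[OF C_mod kappa_lin] l]])
  also have "\<dots> = \<kappa> (ract A \<phi> a) \<ominus>\<^bsub>\<k>\<^esub> \<kappa> (lact A \<phi> a)"
    using slice_slice[OF kappa_lin p r] slice_slice[OF p kappa_lin l] by (simp add: ract_def lact_def)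
  finally show ?thesis .
qed

lemma lam2_slice:
  assumes t: "t \<in> cot A A"
  shows "lam2 (tmap B B \<pi> \<pi> t) = (\<pi> (slL A \<kappa> t) \<ominus>\<^bsub>B\<^esub> \<pi> (mu A t)) \<oplus>\<^bsub>B\<^esub> \<pi> (slR A \<kappa> t)"
proof -
  have tt: "t \<in> carrier (A ** A)" by (rule cot_tensor[OF A_rlin A_llin t])
  show ?thesis
    using lam2_eq[OF t] left_unit_tmap[OF kappa_lin pi_lin tt] right_unit_tmap[OF pi_lin kappa_lin tt] by simp
qed

section \<open>A left colinear section\<close>

text \<open>\<open>ret a\<close> is \<open>a\<^sub>-\<^sub>1 \<kappa>(a\<^sub>0)\<close>. As \<open>\<kappa> \<circ> \<eta> = \<epsilon>\<close>, it is a left colinear retraction of \<open>\<eta>\<close>, and its complement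
  \<open>a - \<eta> (ret a)\<close> factors through the cokernel.\<close>

definition ret :: "'a \<Rightarrow> 'c" where "ret = slR C \<kappa> \<circ> lcoact A"

definition sec :: "'a set \<Rightarrow> 'a" where
  "sec b = (let a = SOME a. a \<in> b in a \<ominus>\<^bsub>A\<^esub> eta A (ret a))"

lemma ret_lin: "lin A C ret"
  unfolding ret_def by (rule lin_comp[OF lin_slR[OF C_mod kappa_lin] A_llin])

lemma ret_eta:
  assumes c: "c \<in> carrier C"
  shows "ret (eta A c) = c"
proof -
  note d = lin_closed[OF comult_lin c]
  have "ret (eta A c) = slR C (\<kappa> \<circ> eta A) (comult C c)"
    using slR_tmap[OF C_id eta_lin kappa_lin d] by (simp add: ret_def lcoact_eta c)
  also have "\<dots> = slR C (counit C) (comult C c)"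
    by (rule slR_cong[OF C_mod lin_comp[OF kappa_lin eta_lin] _ d]) (simp add: kappa_eta)
  also have "\<dots> = c" using coalg.counit_right[OF c] by (simp add: slR_def)
  finally show ?thesis .
qed

lemma ret_slice:
  assumes "dual \<phi>" "a \<in> carrier A"
  shows "\<phi> (ret a) = \<kappa> (lact A \<phi> a)"
  using slice_slice[OF assms(1) kappa_lin lin_closed[OF A_llin assms(2)]] by (simp add: ret_def lact_def)

lemma ret_lact:
  assumes "dual \<phi>" "a \<in> carrier A"
  shows "ret (lact A \<phi> a) = slL C \<phi> (comult C (ret a))"
  using slR_tmap[OF lin_comp[OF lin_slL[OF C_mod assms(1)] comult_lin] A_id kappa_lin
      lin_closed[OF A_llin assms(2)]]
  by (simp add: ret_def lcoact_lact[OF A_left assms])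

lemma sec_pi:
  assumes a: "a \<in> carrier A"
  shows "sec (\<pi> a) = a \<ominus>\<^bsub>A\<^esub> eta A (ret a)"
proof -
  interpret A: module K A by (rule A_mod)
  have f: "lin A A (\<lambda>a. id a \<ominus>\<^bsub>A\<^esub> (eta A \<circ> ret) a)"
    by (rule lin_diff[OF A_id lin_comp[OF eta_lin ret_lin]])
  show ?thesis
    using some_rep[OF f _ a] lin_closed[OF eta_lin]
    by (simp add: sec_def ret_eta A.minus_eq_zero_iff)
qed

lemma sec_lin: "lin B A sec"
  by (rule lin_from_B[OF lin_diff[OF A_id lin_comp[OF eta_lin ret_lin]]]) (simp add: sec_pi)

lemma pi_sec:
  assumes "b \<in> carrier B"
  shows "\<pi> (sec b) = b"
proof -
  interpret B: module K B by (rule B_mod)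
  obtain a where a: "a \<in> carrier A" "b = \<pi> a" using assms by (elim B_cases)
  note r = lin_closed[OF ret_lin a(1)]
  show ?thesis
    using a lin_closed[OF pi_lin a(1)]
    by (simp add: sec_pi lin_minus[OF pi_lin a(1) lin_closed[OF eta_lin r]] pi_eta r B.minus_zero_right)
qed

lemma sec_lact: "lcolin B A sec"
  unfolding lcolin_def
proof (intro conjI sec_lin allI impI ballI)
  fix \<phi> b assume p: "dual \<phi>" and "b \<in> carrier B"
  then obtain a where a: "a \<in> carrier A" "b = \<pi> a" by (elim B_cases)
  note L = lin_lact[OF A_llin p] and r = lin_closed[OF ret_lin a(1)]
  show "lact A \<phi> (sec b) = sec (lact B \<phi> b)"
    using a by (simp add: sec_pi lact_B p lin_minus[OF L a(1) lin_closed[OF eta_lin r]] lact_eta[OF p r]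
        ret_lact lin_closed[OF L])
qed

section \<open>Maps between the cotensor products with a comodule\<close>

lemmas M_rlin = right_comodule_rlin[OF comod]
lemmas M_mod = linD(1)[OF M_rlin] and M_id = lin_id[OF linD(1)[OF M_rlin]]

abbreviation MA where "MA \<equiv> cotensor_rcomod K C M A"
abbreviation MB where "MB \<equiv> cotensor_rcomod K C M B"
abbreviation cA where "cA \<equiv> (cot M A)"
abbreviation cB where "cB \<equiv> (cot M B)"

text \<open>In the order of the definitions: \<open>M \<box> \<pi>\<close>, \<open>M \<box> sec\<close>, the unit \<open>m \<mapsto> m\<^sub>0 \<otimes> \<eta>(m\<^sub>1)\<close> and \<open>M \<box> \<kappa>\<close>. They are
  defined on the full tensor products; their restrictions to the cotensor products are \<open>piM_lin\<close>,
  \<open>secM_lin\<close>, \<open>unitM_lin\<close> and \<open>kapM_lin\<close>.\<close>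

definition piM where "piM = tmap M B id \<pi>"
definition secM where "secM = tmap M A id sec"
definition unitM where "unitM = tmap M A id (eta A) \<circ> rcoact M"
definition kapM where "kapM = slR M \<kappa>"

lemma piM_tensor: "lin (M ** A) (M ** B) piM"
  unfolding piM_def by (rule lin_tmap[OF M_id pi_lin])

lemma secM_tensor: "lin (M ** B) (M ** A) secM"
  unfolding secM_def by (rule lin_tmap[OF M_id sec_lin])

lemma kapM_tensor: "lin (M ** A) M kapM"
  unfolding kapM_def by (rule lin_slR[OF M_mod kappa_lin])

lemmas MA_rlin = rcot_rlin[OF M_rlin A_comm]
lemmas MB_rlin = rcot_rlin[OF M_rlin B_comm]
lemmas MA_mod = linD(1)[OF MA_rlin] and MB_mod = linD(1)[OF MB_rlin]
lemmas MA_incl = rcot_incl[OF M_rlin A_llin] and MB_incl = rcot_incl[OF M_rlin B_llin]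
lemmas cA_tensor = cot_tensor[OF M_rlin A_llin] and cB_tensor = cot_tensor[OF M_rlin B_llin]
lemmas cA_iff = mem_cotensor[OF M_rlin A_llin] and cB_iff = mem_cotensor[OF M_rlin B_llin]
lemmas ract_MA = ract_rcot[OF M_rlin A_comm] and ract_MB = ract_rcot[OF M_rlin B_comm]

lemma MA_ops: "x \<oplus>\<^bsub>MA\<^esub> y = x \<oplus>\<^bsub>M ** A\<^esub> y" "\<zero>\<^bsub>MA\<^esub> = \<zero>\<^bsub>M ** A\<^esub>"
  "w \<oplus>\<^bsub>MB\<^esub> z = w \<oplus>\<^bsub>M ** B\<^esub> z" "\<zero>\<^bsub>MB\<^esub> = \<zero>\<^bsub>M ** B\<^esub>"
  by (simp_all add: cotensor_rcomod_def cotensor_def Let_def)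

lemma piM_closed: "x \<in> cA \<Longrightarrow> piM x \<in> cB"
  unfolding piM_def
  by (rule cot_tmap[OF M_rlin A_llin M_rlin B_llin rcolin_id[OF M_rlin] pi_lact])

lemma secM_closed: "x \<in> cB \<Longrightarrow> secM x \<in> cA"
  unfolding secM_def
  by (rule cot_tmap[OF M_rlin B_llin M_rlin A_llin rcolin_id[OF M_rlin] sec_lact])

lemma piM_lin: "lin MA MB piM"
  using lin_comp[OF piM_tensor MA_incl] piM_closed by (intro lin_into_rcot[OF M_rlin B_llin]) auto

lemma secM_lin: "lin MB MA secM"
  using lin_comp[OF secM_tensor MB_incl] secM_closed by (intro lin_into_rcot[OF M_rlin A_llin]) auto

lemma kapM_lin: "lin MA M kapM"
  using lin_comp[OF kapM_tensor MA_incl] by simp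

lemma piM_ract: "rcolin MA MB piM"
  unfolding rcolin_def
proof (intro conjI piM_lin allI impI ballI)
  fix \<phi> x assume p: "dual \<phi>" and "x \<in> carrier MA"
  then have x: "x \<in> cA" by simp
  note i = M_id and xt = cA_tensor[OF x]
  have "ract MB \<phi> (piM x) = tmap M B id (ract B \<phi> \<circ> \<pi>) x"
    using tmap_comp[OF i pi_lin i lin_ract[OF B_rlin p] xt] ract_MB[OF piM_closed[OF x] p]
    by (simp add: piM_def)
  also have "\<dots> = tmap M B id (\<pi> \<circ> ract A \<phi>) x"
    by (rule tmap_cong[OF i lin_comp[OF lin_ract[OF B_rlin p] pi_lin] _ _ xt]) (simp_all add: ract_B p)
  also have "\<dots> = piM (ract MA \<phi> x)"
    using tmap_comp[OF i lin_ract[OF A_rlin p] i pi_lin xt] ract_MA[OF x p] by (simp add: piM_def)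
  finally show "ract MB \<phi> (piM x) = piM (ract MA \<phi> x)" .
qed

lemma piM_secM:
  assumes "y \<in> cB"
  shows "piM (secM y) = y"
proof -
  note i = M_id and yt = cB_tensor[OF assms]
  have "piM (secM y) = tmap M B id (\<pi> \<circ> sec) y"
    using tmap_comp[OF i sec_lin i pi_lin yt] by (simp add: piM_def secM_def)
  also have "\<dots> = tmap M B id id y"
    by (rule tmap_cong[OF i lin_comp[OF pi_lin sec_lin] _ _ yt]) (simp_all add: pi_sec)
  also have "\<dots> = y" by (rule tmap_id[OF M_mod B_mod yt])
  finally show ?thesis .
qed

lemma unitM_tensor: "lin M (M ** A) unitM"
  unfolding unitM_def by (rule lin_comp[OF lin_tmap[OF M_id eta_lin] M_rlin])

lemma unitM_closed:
  assumes m: "m \<in> carrier M"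
  shows "unitM m \<in> cA"
  unfolding cA_iff
proof (intro conjI allI impI)
  show "unitM m \<in> carrier (M ** A)" by (rule lin_closed[OF unitM_tensor m])
  fix \<phi> assume p: "dual \<phi>"
  note i = M_id A_id C_id and r = lin_closed[OF M_rlin m]
  note R = lin_ract[OF M_rlin p] and L = lin_lact[OF A_llin p]
  note S = lin_comp[OF lin_slL[OF C_mod p] comult_lin]
  have "tmap M A (ract M \<phi>) id (unitM m) = tmap M A id (eta A) (tmap M C (ract M \<phi>) id (rcoact M m))"
    using tmap_comp[OF i(1) eta_lin R i(2) r] tmap_comp[OF R i(3) i(1) eta_lin r] by (simp add: unitM_def)
  also have "\<dots> = tmap M A id (eta A) (tmap M C id (slL C \<phi> \<circ> comult C) (rcoact M m))"
    using rcoact_in_cotensor[OF comod p m] by simp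
  also have "\<dots> = tmap M A id (eta A \<circ> (slL C \<phi> \<circ> comult C)) (rcoact M m)"
    using tmap_comp[OF i(1) S i(1) eta_lin r] by simp
  also have "\<dots> = tmap M A id (lact A \<phi> \<circ> eta A) (rcoact M m)"
    by (rule tmap_cong[OF i(1) lin_comp[OF eta_lin S] _ _ r]) (simp_all add: lact_eta[OF p])
  also have "\<dots> = tmap M A id (lact A \<phi>) (unitM m)"
    using tmap_comp[OF i(1) eta_lin i(1) L r] by (simp add: unitM_def)
  finally show "tmap M A (ract M \<phi>) id (unitM m) = tmap M A id (lact A \<phi>) (unitM m)" .
qed

lemma unitM_lin: "lin M MA unitM"
  by (rule lin_into_rcot[OF M_rlin A_llin unitM_tensor unitM_closed])

lemma unitM_ract: "rcolin M MA unitM"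
  unfolding rcolin_def
proof (intro conjI unitM_lin allI impI ballI)
  fix \<phi> m assume p: "dual \<phi>" and m: "m \<in> carrier M"
  note i = M_id and r = lin_closed[OF M_rlin m]
  note S = lin_comp[OF lin_slR[OF C_mod p] comult_lin]
  have "ract MA \<phi> (unitM m) = tmap M A id (ract A \<phi> \<circ> eta A) (rcoact M m)"
    using tmap_comp[OF i eta_lin i lin_ract[OF A_rlin p] r] ract_MA[OF unitM_closed[OF m] p]
    by (simp add: unitM_def)
  also have "\<dots> = tmap M A id (eta A \<circ> (slR C \<phi> \<circ> comult C)) (rcoact M m)"
    by (rule tmap_cong[OF i lin_comp[OF lin_ract[OF A_rlin p] eta_lin] _ _ r]) (simp_all add: ract_eta[OF p])
  also have "\<dots> = tmap M A id (eta A) (tmap M C id (slR C \<phi> \<circ> comult C) (rcoact M m))"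
    using tmap_comp[OF i S i eta_lin r] by simp
  also have "\<dots> = unitM (ract M \<phi> m)"
    by (simp add: unitM_def rcoact_ract[OF comod p m])
  finally show "ract MA \<phi> (unitM m) = unitM (ract M \<phi> m)" .
qed

lemma piM_unitM:
  assumes m: "m \<in> carrier M"
  shows "piM (unitM m) = \<zero>\<^bsub>M ** B\<^esub>"
proof -
  note i = M_id and r = lin_closed[OF M_rlin m]
  show ?thesis
    using tmap_comp[OF i eta_lin i pi_lin r] tmap_zero_right[OF i lin_comp[OF pi_lin eta_lin] r]
    by (simp add: piM_def unitM_def pi_eta)
qed

lemma kapM_unitM:
  assumes m: "m \<in> carrier M"
  shows "kapM (unitM m) = m"
proof -
  note i = M_id and r = lin_closed[OF M_rlin m]
  have "kapM (unitM m) = slR M (\<kappa> \<circ> eta A) (rcoact M m)"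
    using slR_tmap[OF i eta_lin kappa_lin r] by (simp add: kapM_def unitM_def)
  also have "\<dots> = slR M (counit C) (rcoact M m)"
    by (rule slR_cong[OF M_mod lin_comp[OF kappa_lin eta_lin] _ r]) (simp add: kappa_eta)
  also have "\<dots> = m" using ract_counit[OF comod m] by (simp add: ract_def)
  finally show ?thesis .
qed

text \<open>\<open>M \<box> \<kappa>\<close> is in general not colinear. On the cotensor product the operator on \<open>M\<close> can be moved over to
  the left operator on \<open>A\<close>, and the difference to colinearity is what \<open>lam1\<close> measures.\<close>

lemma ract_kapM:
  assumes p: "dual \<phi>" and x: "x \<in> cA"
  shows "ract M \<phi> (kapM x) = slR M (\<kappa> \<circ> lact A \<phi>) x"
proof -
  note xt = cA_tensor[OF x]
  have "ract M \<phi> (kapM x) = slR M \<kappa> (tmap M A (ract M \<phi>) id x)"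
    using slR_tmap[OF lin_ract[OF M_rlin p] A_id kappa_lin xt] by (simp add: kapM_def)
  also have "\<dots> = slR M \<kappa> (tmap M A id (lact A \<phi>) x)"
    using x p by (simp add: cA_iff)
  also have "\<dots> = slR M (\<kappa> \<circ> lact A \<phi>) x"
    using slR_comp[OF kappa_lin lin_lact[OF A_llin p] M_mod xt] by simp
  finally show ?thesis .
qed

text \<open>The part of \<open>x\<close> that \<open>sec \<circ> \<pi>\<close> misses is \<open>(id \<otimes> \<eta>) ((id \<otimes> ret) x)\<close>, and on the cotensor product
  \<open>(id \<otimes> ret) x\<close> is the coaction of \<open>(M \<box> \<kappa>) x\<close>.\<close>

lemma decomposition:
  assumes x: "x \<in> cA"
  shows "x = secM (piM x) \<oplus>\<^bsub>M ** A\<^esub> unitM (kapM x)"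
proof -
  note i = M_id and xt = cA_tensor[OF x]
  note k = lin_closed[OF kapM_tensor xt]
  have e: "lin A A (eta A \<circ> ret)" by (rule lin_comp[OF eta_lin ret_lin])
  interpret T: module K "M ** A" by (rule linD[OF unitM_tensor])
  have "tmap M C id ret x = rcoact M (kapM x)"
  proof (rule slR_detect[OF C_mod M_mod lin_closed[OF lin_tmap[OF i ret_lin] xt] lin_closed[OF M_rlin k]])
    fix \<phi> assume p: "dual \<phi>"
    have "slR M \<phi> (tmap M C id ret x) = slR M (\<phi> \<circ> ret) x"
      using slR_comp[OF p ret_lin M_mod xt] by simp
    also have "\<dots> = slR M (\<kappa> \<circ> lact A \<phi>) x"
      by (rule slR_cong[OF M_mod lin_comp[OF p ret_lin] _ xt]) (simp add: ret_slice[OF p])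
    also have "\<dots> = slR M \<phi> (rcoact M (kapM x))"
      using ract_kapM[OF p x] by (simp add: ract_def)
    finally show "slR M \<phi> (tmap M C id ret x) = slR M \<phi> (rcoact M (kapM x))" .
  qed
  then have u: "tmap M A id (eta A \<circ> ret) x = unitM (kapM x)"
    using tmap_comp[OF i ret_lin i eta_lin xt] by (simp add: unitM_def)
  have "secM (piM x) = tmap M A id (sec \<circ> \<pi>) x"
    using tmap_comp[OF i pi_lin i sec_lin xt] by (simp add: secM_def piM_def)
  also have "\<dots> = tmap M A id (\<lambda>a. id a \<ominus>\<^bsub>A\<^esub> (eta A \<circ> ret) a) x"
    by (rule tmap_cong[OF i lin_comp[OF sec_lin pi_lin] _ _ xt]) (simp_all add: sec_pi)
  also have "\<dots> = x \<ominus>\<^bsub>M ** A\<^esub> unitM (kapM x)"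
    using tmap_diff_right[OF i A_id e xt] tmap_id[OF M_mod A_mod xt] u by simp
  finally show ?thesis
    using xt lin_closed[OF unitM_tensor k] by (simp add: a_minus_def T.a_assoc T.l_neg)
qed

section \<open>Actions and flat connections\<close>

context
  fixes D r
  assumes D: "lin MB M D"
    and r_eq: "\<And>x. x \<in> cA \<Longrightarrow> r x = D (piM x) \<oplus>\<^bsub>M\<^esub> kapM x"
begin

interpretation M: module K M by (rule M_mod)
interpretation TB: module K "M ** B" by (rule linD[OF piM_tensor])

lemma r_lin: "lin MA M r"
  using lin_cong[OF lin_plus[OF lin_comp[OF D piM_lin] kapM_lin], of r] r_eq by simp

text \<open>At \<open>y = (M \<box> \<pi>) x\<close> the slice by \<open>\<phi>\<close> of \<open>(id \<otimes> lam1) y\<close> is \<open>kapM (ract MA \<phi> x) - ract M \<phi> (kapM x)\<close>, the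
  failure of \<open>M \<box> \<kappa>\<close> to be colinear. Moving these terms to the sides on which \<open>D\<close> is evaluated at
  \<open>ract MB \<phi> y\<close> and at \<open>y\<close> turns the connection condition into colinearity of \<open>r\<close>.\<close>

lemma connection_iff_ract: "connection K C B lam1 M D \<longleftrightarrow> rcolin MA M r"
proof -
  have tf: "lin MB (M ** C) (\<lambda>y. tmap M C D id (rcoact MB y) \<oplus>\<^bsub>M ** C\<^esub> tmap M C id lam1 y)"
    (is "lin _ _ ?f")
    using lin_plus[OF lin_comp[OF lin_tmap[OF D C_id] MB_rlin]
        lin_comp[OF lin_tmap[OF M_id lam1_lin] MB_incl]] by simp
  have "rcoact M (D (piM x)) = ?f (piM x) \<longleftrightarrow> (\<forall>\<phi>. dual \<phi> \<longrightarrow> ract M \<phi> (r x) = r (ract MA \<phi> x))"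
    if x: "x \<in> cA" for x
  proof -
    have y: "piM x \<in> carrier MB" "piM x \<in> cB" using piM_closed[OF x] by simp_all
    note xt = cA_tensor[OF x] and yt = cB_tensor[OF y(2)]
    have slice: "slR M \<phi> (rcoact M (D (piM x))) = slR M \<phi> (?f (piM x)) \<longleftrightarrow> ract M \<phi> (r x) = r (ract MA \<phi> x)"
      if p: "dual \<phi>" for \<phi>
    proof -
      note R = lin_ract[OF M_rlin p]
      have Rx: "ract MA \<phi> x \<in> cA" using lin_closed[OF lin_ract[OF MA_rlin p], of x] x by simp
      have "slR M \<phi> (?f (piM x)) = slR M \<phi> (tmap M C D id (rcoact MB (piM x)))
          \<oplus>\<^bsub>M\<^esub> slR M \<phi> (tmap M C id lam1 (piM x))"
        by (rule lin_add[OF lin_slR[OF M_mod p] lin_closed[OF lin_tmap[OF D C_id] lin_closed[OF MB_rlin y(1)]]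
              lin_closed[OF lin_tmap[OF M_id lam1_lin] yt]])
      also have "slR M \<phi> (tmap M C D id (rcoact MB (piM x))) = D (piM (ract MA \<phi> x))"
        using slR_tmap[OF D C_id p lin_closed[OF MB_rlin y(1)]] piM_ract p x
        by (simp add: rcolin_def ract_def)
      also have "slR M \<phi> (tmap M C id lam1 (piM x)) = slR M ((\<phi> \<circ> lam1) \<circ> \<pi>) x"
        using slR_comp[OF p lam1_lin M_mod yt] slR_comp[OF lin_comp[OF p lam1_lin] pi_lin M_mod xt]
        by (simp add: piM_def)
      also have "\<dots> = slR M (\<lambda>a. (\<kappa> \<circ> ract A \<phi>) a \<ominus>\<^bsub>\<k>\<^esub> (\<kappa> \<circ> lact A \<phi>) a) x"
        by (rule slR_cong[OF M_mod lin_comp[OF lin_comp[OF p lam1_lin] pi_lin] _ xt]) (simp add: lam1_slice[OF p])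
      also have "\<dots> = slR M (\<kappa> \<circ> ract A \<phi>) x \<ominus>\<^bsub>M\<^esub> slR M (\<kappa> \<circ> lact A \<phi>) x"
        by (rule slR_diff[OF M_mod lin_comp[OF kappa_lin lin_ract[OF A_rlin p]]
              lin_comp[OF kappa_lin lin_lact[OF A_llin p]] xt])
      also have "slR M (\<kappa> \<circ> ract A \<phi>) x = kapM (ract MA \<phi> x)"
        using slR_comp[OF kappa_lin lin_ract[OF A_rlin p] M_mod xt] by (simp add: kapM_def ract_MA[OF x p])
      also have "slR M (\<kappa> \<circ> lact A \<phi>) x = ract M \<phi> (kapM x)"
        using ract_kapM[OF p x] by simp
      finally have f: "slR M \<phi> (?f (piM x)) =
        D (piM (ract MA \<phi> x)) \<oplus>\<^bsub>M\<^esub> (kapM (ract MA \<phi> x) \<ominus>\<^bsub>M\<^esub> ract M \<phi> (kapM x))" .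
      have c: "D (piM x) \<in> carrier M" "kapM x \<in> carrier M" "D (piM (ract MA \<phi> x)) \<in> carrier M"
        "kapM (ract MA \<phi> x) \<in> carrier M"
        using lin_closed[OF D] piM_closed x Rx lin_closed[OF kapM_lin] by simp_all
      have "slR M \<phi> (rcoact M (D (piM x))) = ract M \<phi> (D (piM x))" by (simp add: ract_def)
      then show ?thesis
        unfolding f r_eq[OF x] r_eq[OF Rx] lin_add[OF R c(1,2)]
        using M.eq_add_diff_iff[OF lin_closed[OF R c(1)] c(3,4) lin_closed[OF R c(2)]] by simp
    qed
    show ?thesis
    proof
      assume "rcoact M (D (piM x)) = ?f (piM x)"
      then show "\<forall>\<phi>. dual \<phi> \<longrightarrow> ract M \<phi> (r x) = r (ract MA \<phi> x)" using slice by simp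
    next
      assume "\<forall>\<phi>. dual \<phi> \<longrightarrow> ract M \<phi> (r x) = r (ract MA \<phi> x)"
      then show "rcoact M (D (piM x)) = ?f (piM x)"
        using slice
        by (intro slR_detect[OF C_mod M_mod lin_closed[OF M_rlin lin_closed[OF D y(1)]] lin_closed[OF tf y(1)]])
          simp
    qed
  qed
  moreover have "(\<forall>t\<in>cB. rcoact M (D t) = ?f t) \<longleftrightarrow> (\<forall>x\<in>cA. rcoact M (D (piM x)) = ?f (piM x))"
    using piM_closed secM_closed piM_secM by metis
  moreover have "linear_map K (cotensor K C M B) M D" using linD(3)[OF D] same_linear_map[OF same_rcot] by blast
  ultimately show ?thesis
    unfolding connection_def rcolin_def using r_lin by auto
qed

text \<open>For \<open>t = m \<otimes> a \<otimes> b\<close> in suggestive notation, the left hand side is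
  \<open>D (r(m,a) \<otimes> \<pi> b) + r(m,a) \<kappa>(b)\<close> and the first term on the right is \<open>D (m \<otimes> \<pi>(ab)) + m \<kappa>(a) \<kappa>(b)\<close>.
  Substituting \<open>r(m,a) = D(m \<otimes> \<pi> a) + m \<kappa>(a)\<close> in both summands, the difference is \<open>D\<close> applied to
  \<open>D(m \<otimes> \<pi> a) \<otimes> \<pi> b + m \<otimes> (\<kappa>(a) \<pi> b - \<pi>(ab) + \<pi> a \<kappa>(b))\<close>, which is the curvature. The summand
  \<open>D(m \<otimes> \<pi> a) \<otimes> \<pi> b\<close> alone need not lie in \<open>M \<box> B\<close>; together with \<open>m \<otimes> \<kappa>(a) \<pi> b\<close> it does, because \<open>r\<close> is
  colinear. This is why \<open>?Z\<close> is cancelled in \<open>M \<otimes> B\<close> before \<open>D\<close> is applied.\<close>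

lemma associativity_defect:
  assumes colin: "rcolin MA M r" and t: "t \<in> cot MA A"
  shows "tmap MB B piM \<pi> t \<in> cot MB B"
    "r (tmap M A r id t) = r (tmap M A id (mu A) (cotensor_assoc K C M A A t))
      \<oplus>\<^bsub>M\<^esub> curvature K C B lam2 M D (tmap MB B piM \<pi> t)"
    "curvature K C B lam2 M D (tmap MB B piM \<pi> t) \<in> carrier M"
proof -
  let ?X = "tmap M A r id t" and ?u = "cotensor_assoc K C M A A t"
  let ?Y = "tmap M A id (mu A) ?u" and ?t' = "tmap MB B piM \<pi> t"
  let ?u' = "cotensor_assoc K C M B B ?t'" and ?k = "slR MA \<kappa> t" and ?Z = "tmap M B kapM \<pi> t"
  let ?it = "tmap (M ** A) A id id t"
  note iM = M_id and iA = A_id and iB = lin_id[OF B_mod]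
  note AA = bicot_llin[OF A_comm A_llin] and BB = bicot_llin[OF B_comm B_llin]
  note AAi = bicot_incl[OF A_rlin A_llin] and BBi = bicot_incl[OF B_rlin B_llin]
  have tt: "t \<in> carrier (MA ** A)" by (rule cot_tensor[OF MA_rlin A_llin t])
  have it: "?it \<in> carrier ((M ** A) ** A)" by (rule lin_closed[OF lin_tmap[OF MA_incl iA] tt])
  note u = cot_assoc_spec[OF M_rlin A_comm A_llin t]
  have ut: "?u \<in> carrier (M ** (bicot A A))" by (rule cot_tensor[OF M_rlin AA u(1)])
  show t': "?t' \<in> cot MB B"
    by (rule cot_tmap[OF MA_rlin A_llin MB_rlin B_llin piM_ract pi_lact t])
  have tt': "?t' \<in> carrier (MB ** B)" by (rule cot_tensor[OF MB_rlin B_llin t'])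
  note u' = cot_assoc_spec[OF M_rlin B_comm B_llin t']
  have ut': "?u' \<in> carrier (M ** (bicot B B))" by (rule cot_tensor[OF M_rlin BB u'(1)])
  have X: "?X \<in> cA" by (rule cot_tmap[OF MA_rlin A_llin M_rlin A_llin colin lcolin_id[OF A_llin] t])
  have Y: "?Y \<in> cA" by (rule cot_tmap[OF M_rlin AA M_rlin A_llin rcolin_id[OF M_rlin] mu_lact u(1)])
  have k: "?k \<in> cA" using lin_closed[OF lin_slR[OF MA_mod kappa_lin] tt] by simp
  have ik: "slR (M ** A) \<kappa> ?it = ?k" using slR_tmap[OF MA_incl iA kappa_lin tt] by simp
  have pp: "lin (bicot A A) (bicot B B) (tmap B B \<pi> \<pi>)"
  proof -
    have "lin (bicot A A) (B ** B) (tmap B B \<pi> \<pi>)"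
      using lin_comp[OF lin_tmap[OF pi_lin pi_lin] AAi] by simp
    then show ?thesis
      by (rule lin_into_bicot[OF B_rlin B_llin])
        (use cot_tmap[OF A_rlin A_llin B_rlin B_llin pi_ract pi_lact] in simp)
  qed
  have uu': "?u' = tmap M (bicot B B) id (tmap B B \<pi> \<pi>) ?u"
  proof (rule bicot_incl_inj[OF B_comm B_llin M_mod ut' lin_closed[OF lin_tmap[OF iM pp] ut]])
    have "tmap M (B ** B) id id ?u' = assoc M B B (tmap (M ** B) B id id ?t')"
      by (rule u'(2))
    also have "tmap (M ** B) B id id ?t' = tmap (M ** B) B (tmap M B id \<pi>) \<pi> ?it"
      using tmap_comp[OF piM_lin pi_lin MB_incl iB tt] tmap_comp[OF MA_incl iA piM_tensor pi_lin tt]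
      by (simp add: piM_def)
    also have "assoc M B B \<dots> = tmap M (B ** B) id (tmap B B \<pi> \<pi>)
        (tmap M (A ** A) id id ?u)"
      using assoc_natural[OF iM pi_lin pi_lin it] u(2) by simp
    also have "\<dots> = tmap M (B ** B) id id (tmap M (bicot B B) id (tmap B B \<pi> \<pi>) ?u)"
      using tmap_comp[OF iM AAi iM lin_tmap[OF pi_lin pi_lin] ut] tmap_comp[OF iM pp iM BBi ut] by simp
    finally show "tmap M (B ** B) id id ?u' =
      tmap M (B ** B) id id (tmap M (bicot B B) id (tmap B B \<pi> \<pi>) ?u)" .
  qed
  \<comment> \<open>Applying \<open>\<kappa>\<close> to one of the two factors \<open>A\<close>: the three mixed terms that the definition of
    \<open>lam2\<close> contributes are expressed by \<open>t\<close> itself.\<close>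
  have left: "tmap M A id (slL A \<kappa>) ?u = tmap M A kapM id t"
  proof -
    have "tmap M A id (slL A \<kappa>) ?u = tmap M A id (slL A \<kappa>) (tmap M (A ** A) id id ?u)"
      using tmap_comp[OF iM AAi iM lin_slL[OF A_mod kappa_lin] ut] by simp
    also have "\<dots> = tmap M A (slR M \<kappa>) id ?it"
      using slM_assoc[OF M_mod A_mod A_mod it kappa_lin] u(2) by simp
    also have "\<dots> = tmap M A kapM id t"
      using tmap_comp[OF MA_incl iA lin_slR[OF M_mod kappa_lin] iA tt] by (simp add: kapM_def)
    finally show ?thesis .
  qed
  have right: "tmap M A id (slR A \<kappa>) ?u = ?k"
  proof -
    have "tmap M A id (slR A \<kappa>) ?u = tmap M A id (slR A \<kappa>) (tmap M (A ** A) id id ?u)"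
      using tmap_comp[OF iM AAi iM lin_slR[OF A_mod kappa_lin] ut] by simp
    also have "\<dots> = ?k" using slR_assoc[OF M_mod A_mod A_mod it kappa_lin] u(2) ik by simp
    finally show ?thesis .
  qed
  have slA: "lin (bicot A A) A (slL A \<kappa>)" "lin (bicot A A) A (slR A \<kappa>)"
    using lin_comp[OF lin_slL[OF A_mod kappa_lin] AAi] lin_comp[OF lin_slR[OF A_mod kappa_lin] AAi] by simp_all
  note f1 = lin_comp[OF pi_lin slA(1)] and f2 = lin_comp[OF pi_lin mu_lin] and f3 = lin_comp[OF pi_lin slA(2)]
  have lam: "tmap M B id lam2 ?u' = (?Z \<ominus>\<^bsub>M ** B\<^esub> piM ?Y) \<oplus>\<^bsub>M ** B\<^esub> piM ?k"
  proof -
    have "tmap M B id lam2 ?u' = tmap M B id (lam2 \<circ> tmap B B \<pi> \<pi>) ?u"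
      using tmap_comp[OF iM pp iM lam2_lin ut] uu' by simp
    also have "\<dots> = tmap M B id
        (\<lambda>s. ((\<pi> \<circ> slL A \<kappa>) s \<ominus>\<^bsub>B\<^esub> (\<pi> \<circ> mu A) s) \<oplus>\<^bsub>B\<^esub> (\<pi> \<circ> slR A \<kappa>) s) ?u"
      by (rule tmap_cong[OF iM lin_comp[OF lam2_lin pp] _ _ ut]) (simp_all add: lam2_slice)
    also have "\<dots> = (tmap M B id (\<pi> \<circ> slL A \<kappa>) ?u \<ominus>\<^bsub>M ** B\<^esub> tmap M B id (\<pi> \<circ> mu A) ?u)
        \<oplus>\<^bsub>M ** B\<^esub> tmap M B id (\<pi> \<circ> slR A \<kappa>) ?u"
      using tmap_plus_right[OF iM lin_diff[OF f1 f2] f3 ut] tmap_diff_right[OF iM f1 f2 ut] by simp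
    also have "tmap M B id (\<pi> \<circ> slL A \<kappa>) ?u = ?Z"
      using tmap_comp[OF iM slA(1) iM pi_lin ut] tmap_comp[OF kapM_lin iA iM pi_lin tt] left by simp
    also have "tmap M B id (\<pi> \<circ> mu A) ?u = piM ?Y"
      using tmap_comp[OF iM mu_lin iM pi_lin ut] by (simp add: piM_def)
    also have "tmap M B id (\<pi> \<circ> slR A \<kappa>) ?u = piM ?k"
      using tmap_comp[OF iM slA(2) iM pi_lin ut] right by (simp add: piM_def)
    finally show ?thesis .
  qed
  have Dt: "tmap M B D id ?t' = piM ?X \<ominus>\<^bsub>M ** B\<^esub> ?Z"
  proof -
    have "tmap M B D id ?t' = tmap M B (D \<circ> piM) \<pi> t"
      using tmap_comp[OF piM_lin pi_lin D iB tt] by simp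
    also have "\<dots> = tmap M B (\<lambda>x. r x \<ominus>\<^bsub>M\<^esub> kapM x) \<pi> t"
    proof (rule tmap_cong[OF lin_comp[OF D piM_lin] pi_lin _ _ tt])
      fix x assume "x \<in> carrier MA"
      then have x: "x \<in> cA" by simp
      have "D (piM x) \<in> carrier M" "kapM x \<in> carrier M"
        using lin_closed[OF D] piM_closed[OF x] lin_closed[OF kapM_lin] x by simp_all
      then show "(D \<circ> piM) x = r x \<ominus>\<^bsub>M\<^esub> kapM x"
        by (simp add: r_eq[OF x] a_minus_def M.a_assoc M.r_neg)
    qed simp
    also have "\<dots> = tmap M B r \<pi> t \<ominus>\<^bsub>M ** B\<^esub> ?Z"
      by (rule tmap_diff_left[OF r_lin kapM_lin pi_lin tt])
    also have "tmap M B r \<pi> t = piM ?X"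
      using tmap_comp[OF r_lin iA iM pi_lin tt] by (simp add: piM_def)
    finally show ?thesis .
  qed
  have c: "piM ?X \<in> cB" "piM ?Y \<in> cB" "piM ?k \<in> cB" using piM_closed X Y k by auto
  have Zc: "?Z \<in> carrier (M ** B)" by (rule lin_closed[OF lin_tmap[OF kapM_lin pi_lin] tt])
  interpret MB: module K MB by (rule MB_mod)
  have ext: "connection_ext K C B lam2 M D ?t' = (piM ?X \<ominus>\<^bsub>MB\<^esub> piM ?Y) \<oplus>\<^bsub>MB\<^esub> piM ?k"
  proof -
    have "connection_ext K C B lam2 M D ?t' = (piM ?X \<ominus>\<^bsub>M ** B\<^esub> piM ?Y) \<oplus>\<^bsub>M ** B\<^esub> piM ?k"
      unfolding connection_ext_def Dt lam
      by (rule TB.diff_add_diff[OF cB_tensor[OF c(1)] Zc cB_tensor[OF c(2)] cB_tensor[OF c(3)]])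
    moreover have "piM ?X \<ominus>\<^bsub>MB\<^esub> piM ?Y = piM ?X \<ominus>\<^bsub>M ** B\<^esub> piM ?Y"
      using lin_minus[OF MB_incl, of "piM ?X" "piM ?Y"] c by simp
    ultimately show ?thesis by (simp add: MA_ops)
  qed
  have c': "piM ?X \<in> carrier MB" "piM ?Y \<in> carrier MB" "piM ?k \<in> carrier MB" using c by simp_all
  have curv: "curvature K C B lam2 M D ?t' = (D (piM ?X) \<ominus>\<^bsub>M\<^esub> D (piM ?Y)) \<oplus>\<^bsub>M\<^esub> D (piM ?k)"
    unfolding curvature_def ext
    by (simp only: lin_add[OF D MB.minus_closed[OF c'(1,2)] c'(3)] lin_minus[OF D c'(1,2)])
  have kX: "kapM ?X = r ?k"
    using slR_tmap[OF r_lin iA kappa_lin tt] by (simp add: kapM_def)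
  have kY: "kapM ?Y = kapM ?k"
  proof -
    have "kapM ?Y = slR M (\<kappa> \<circ> mu A) ?u"
      using slR_comp[OF kappa_lin mu_lin M_mod ut] by (simp add: kapM_def)
    also have "\<dots> = slR M (\<kappa> \<circ> slR A \<kappa>) ?u"
      by (rule slR_cong[OF M_mod lin_comp[OF kappa_lin mu_lin] _ ut]) (simp add: kappa_mu)
    also have "\<dots> = kapM ?k"
      using slR_comp[OF kappa_lin slA(2) M_mod ut] right by (simp add: kapM_def)
    finally show ?thesis .
  qed
  note Dc = lin_closed[OF D c'(1)] lin_closed[OF D c'(2)] lin_closed[OF D c'(3)]
  have kc: "kapM ?k \<in> carrier M" using lin_closed[OF kapM_lin] k by simp
  show "r ?X = r ?Y \<oplus>\<^bsub>M\<^esub> curvature K C B lam2 M D ?t'"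
    unfolding r_eq[OF X] r_eq[OF Y] kX kY r_eq[OF k] curv by (rule M.add_diff_shuffle[OF Dc kc])
  show "curvature K C B lam2 M D ?t' \<in> carrier M"
    unfolding curv using Dc by simp
qed

end

text \<open>The map \<open>e x = x - unitM (r x)\<close> is colinear and kills the image of \<open>unitM\<close> by the unit law, hence by
  \<open>decomposition\<close> it factors through \<open>piM\<close>. The factor \<open>j\<close> is a right colinear section of \<open>piM\<close>, and
  \<open>sec\<close> is a left colinear section of \<open>\<pi>\<close>, so \<open>j \<otimes> sec\<close> preserves cotensor products and lifts \<open>y\<close>.\<close>

lemma iterated_lift:
  assumes colin: "rcolin MA M r" and unit: "\<And>m. m \<in> carrier M \<Longrightarrow> r (unitM m) = m"
    and y: "y \<in> cot MB B"
  obtains t where "t \<in> cot MA A" "tmap MB B piM \<pi> t = y"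
proof -
  interpret MA: module K MA by (rule MA_mod)
  interpret MB: module K MB by (rule MB_mod)
  have r: "lin MA M r" using colin by (simp add: rcolin_def)
  define e where "e x = x \<ominus>\<^bsub>MA\<^esub> unitM (r x)" for x
  define j where "j = e \<circ> secM"
  note ur = lin_comp[OF unitM_lin r]
  have e: "lin MA MA e"
    using lin_diff[OF lin_id[OF MA_mod] ur] unfolding e_def[abs_def] by simp
  have j: "lin MB MA j" unfolding j_def by (rule lin_comp[OF e secM_lin])
  have e_unit: "e (unitM m) = \<zero>\<^bsub>MA\<^esub>" if "m \<in> carrier M" for m
    using that lin_closed[OF unitM_lin that] by (simp add: e_def unit MA.minus_eq_zero_iff)
  have j_pi: "j (piM x) = e x" if x: "x \<in> cA" for x
  proof -
    have k: "kapM x \<in> carrier M" using lin_closed[OF kapM_lin] x by simp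
    have s: "secM (piM x) \<in> carrier MA" using secM_closed piM_closed x by simp
    have "x = secM (piM x) \<oplus>\<^bsub>MA\<^esub> unitM (kapM x)" using decomposition[OF x] by (simp add: MA_ops)
    then have "e x = e (secM (piM x) \<oplus>\<^bsub>MA\<^esub> unitM (kapM x))" by simp
    also have "\<dots> = e (secM (piM x)) \<oplus>\<^bsub>MA\<^esub> e (unitM (kapM x))"
      by (rule lin_add[OF e s lin_closed[OF unitM_lin k]])
    finally show ?thesis using lin_closed[OF e s] by (simp add: j_def e_unit k)
  qed
  have e_ract: "ract MA \<phi> (e x) = e (ract MA \<phi> x)" if p: "dual \<phi>" and x: "x \<in> carrier MA" for \<phi> x
  proof -
    note R = lin_ract[OF MA_rlin p] and rx = lin_closed[OF r x]
    show ?thesis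
      using colin unitM_ract p x rx
      by (simp add: e_def lin_minus[OF R x lin_closed[OF unitM_lin rx]] rcolin_def)
  qed
  have j_ract: "rcolin MB MA j"
    unfolding rcolin_def
  proof (intro conjI j allI impI ballI)
    fix \<phi> b assume p: "dual \<phi>" and b: "b \<in> carrier MB"
    define x where "x = secM b"
    have x: "x \<in> cA" "x \<in> carrier MA" "b = piM x" using b secM_closed piM_secM by (simp_all add: x_def)
    have Rx: "ract MA \<phi> x \<in> cA" using lin_closed[OF lin_ract[OF MA_rlin p] x(2)] by simp
    have "ract MB \<phi> b = piM (ract MA \<phi> x)" using piM_ract p x by (simp add: rcolin_def)
    then show "ract MA \<phi> (j b) = j (ract MB \<phi> b)"
      using e_ract[OF p x(2)] by (simp add: x(3) j_pi x(1) Rx)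
  qed
  have pi_j: "piM (j b) = b" if b: "b \<in> carrier MB" for b
  proof -
    have s: "secM b \<in> carrier MA" by (rule lin_closed[OF secM_lin b])
    note m = lin_closed[OF r s]
    show ?thesis
      using b by (simp add: j_def e_def lin_minus[OF piM_lin s lin_closed[OF unitM_lin m]] piM_secM piM_unitM m
          MA_ops(4)[symmetric] MB.minus_zero_right)
  qed
  have yt: "y \<in> carrier (MB ** B)" by (rule cot_tensor[OF MB_rlin B_llin y])
  let ?t = "tmap MA A j sec y"
  have "?t \<in> cot MA A"
    by (rule cot_tmap[OF MB_rlin B_llin MA_rlin A_llin j_ract sec_lact y])
  moreover have "tmap MB B piM \<pi> ?t = tmap MB B (piM \<circ> j) (\<pi> \<circ> sec) y"
    by (rule tmap_comp[OF j sec_lin piM_lin pi_lin yt])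
  moreover have "\<dots> = tmap MB B id id y"
    by (rule tmap_cong[OF lin_comp[OF piM_lin j] lin_comp[OF pi_lin sec_lin] _ _ yt]) (simp_all add: pi_j pi_sec)
  moreover have "\<dots> = y" by (rule tmap_id[OF MB_mod B_mod yt])
  ultimately show thesis using that by simp
qed

lemma right_action_iff:
  "right_action K C A M r \<longleftrightarrow> rcolin MA M r \<and>
    (\<forall>t\<in>cot MA A.
      r (tmap M A r id t) = r (tmap M A id (mu A) (cotensor_assoc K C M A A t))) \<and>
    (\<forall>m\<in>carrier M. r (unitM m) = m)"
  by (simp add: right_action_def rcomod_map_iff[OF MA_rlin M_rlin] unitM_def)

lemma flat_imp_action:
  assumes D: "lin MB M D" and r_eq: "\<And>x. x \<in> cA \<Longrightarrow> r x = D (piM x) \<oplus>\<^bsub>M\<^esub> kapM x"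
    and flat: "flat_connection K C B lam1 lam2 M D"
  shows "right_action K C A M r"
proof -
  interpret M: module K M by (rule M_mod)
  have colin: "rcolin MA M r"
    using connection_iff_ract[OF D r_eq] flat by (simp add: flat_connection_def)
  have "r (tmap M A r id t) = r (tmap M A id (mu A) (cotensor_assoc K C M A A t))"
    if t: "t \<in> cot MA A" for t
  proof -
    let ?Y = "tmap M A id (mu A) (cotensor_assoc K C M A A t)"
    note d = associativity_defect[OF D r_eq colin t]
    have "?Y \<in> cA"
      by (rule cot_tmap[OF M_rlin bicot_llin[OF A_comm A_llin] M_rlin A_llin rcolin_id[OF M_rlin] mu_lact
            cot_assoc_spec(1)[OF M_rlin A_comm A_llin t]])
    then have "r ?Y \<in> carrier M" using lin_closed[OF r_lin[OF D r_eq]] by simp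
    moreover have "curvature K C B lam2 M D (tmap MB B piM \<pi> t) = \<zero>\<^bsub>M\<^esub>"
      using flat d(1) by (simp add: flat_connection_def)
    ultimately show ?thesis using d(2) by simp
  qed
  moreover have "r (unitM m) = m" if m: "m \<in> carrier M" for m
    using m lin_zero[OF D] by (simp add: r_eq unitM_closed piM_unitM kapM_unitM MA_ops)
  ultimately show ?thesis using colin by (simp add: right_action_iff)
qed

lemma action_imp_flat:
  assumes D: "lin MB M D" and r_eq: "\<And>x. x \<in> cA \<Longrightarrow> r x = D (piM x) \<oplus>\<^bsub>M\<^esub> kapM x"
    and action: "right_action K C A M r"
  shows "flat_connection K C B lam1 lam2 M D"
proof -
  interpret M: module K M by (rule M_mod)
  have colin: "rcolin MA M r" and unit: "\<And>m. m \<in> carrier M \<Longrightarrow> r (unitM m) = m"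
    using action by (simp_all add: right_action_iff)
  have "curvature K C B lam2 M D y = \<zero>\<^bsub>M\<^esub>" if y: "y \<in> cot MB B" for y
  proof -
    obtain t where t: "t \<in> cot MA A" "tmap MB B piM \<pi> t = y"
      by (rule iterated_lift[OF colin unit y])
    let ?Y = "tmap M A id (mu A) (cotensor_assoc K C M A A t)"
    note d = associativity_defect[OF D r_eq colin t(1)]
    have "?Y \<in> cA"
      by (rule cot_tmap[OF M_rlin bicot_llin[OF A_comm A_llin] M_rlin A_llin rcolin_id[OF M_rlin] mu_lact
            cot_assoc_spec(1)[OF M_rlin A_comm A_llin t(1)]])
    then have "r ?Y \<in> carrier M" using lin_closed[OF r_lin[OF D r_eq]] by simp
    moreover have "r ?Y \<oplus>\<^bsub>M\<^esub> curvature K C B lam2 M D y = r ?Y"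
      using d(2) action t by (simp add: right_action_iff)
    ultimately show ?thesis using M.add_eq_self[OF _ d(3)] t(2) by simp
  qed
  then show ?thesis
    using connection_iff_ract[OF D r_eq] colin by (simp add: flat_connection_def)
qed

theorem correspondence:
  "bij_betw (\<lambda>D. \<lambda>t\<in>cA. D (piM t) \<oplus>\<^bsub>M\<^esub> kapM t)
    {D \<in> extensional cB. flat_connection K C B lam1 lam2 M D}
    {r \<in> extensional cA. right_action K C A M r}"
proof -
  interpret M: module K M by (rule M_mod)
  let ?\<Phi> = "\<lambda>D. \<lambda>t\<in>cA. D (piM t) \<oplus>\<^bsub>M\<^esub> kapM t"
  have lin: "lin MB M D" if "flat_connection K C B lam1 lam2 M D" for D
    using that by (intro linI MB_mod M_mod)
      (simp add: flat_connection_def connection_def same_linear_map[OF same_rcot, symmetric])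
  have k: "kapM x \<in> carrier M" if "x \<in> cA" for x using lin_closed[OF kapM_lin] that by simp
  show ?thesis
    unfolding bij_betw_def
  proof (intro conjI inj_onI equalityI subsetI)
    fix D D' assume D: "D \<in> {D \<in> extensional cB. flat_connection K C B lam1 lam2 M D}"
      and D': "D' \<in> {D \<in> extensional cB. flat_connection K C B lam1 lam2 M D}" and eq: "?\<Phi> D = ?\<Phi> D'"
    show "D = D'"
    proof (rule extensionalityI)
      fix y assume y: "y \<in> cB"
      have s: "secM y \<in> cA" by (rule secM_closed[OF y])
      have "D y \<oplus>\<^bsub>M\<^esub> kapM (secM y) = D' y \<oplus>\<^bsub>M\<^esub> kapM (secM y)"
        using fun_cong[OF eq, of "secM y"] s piM_secM[OF y] by simp
      moreover have "D y \<in> carrier M" "D' y \<in> carrier M"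
        using lin_closed[OF lin] D D' y by simp_all
      ultimately show "D y = D' y" using k[OF s] by simp
    qed (use D D' in auto)
  next
    fix r assume "r \<in> ?\<Phi> ` {D \<in> extensional cB. flat_connection K C B lam1 lam2 M D}"
    then obtain D where D: "flat_connection K C B lam1 lam2 M D" "r = ?\<Phi> D" by auto
    have "right_action K C A M r" by (rule flat_imp_action[OF lin[OF D(1)] _ D(1)]) (simp add: D(2))
    then show "r \<in> {r \<in> extensional cA. right_action K C A M r}" using D(2) by simp
  next
    fix r assume r: "r \<in> {r \<in> extensional cA. right_action K C A M r}"
    then have act: "right_action K C A M r" and ext: "r \<in> extensional cA" by auto
    have rl: "lin MA M r" using act by (simp add: right_action_iff rcolin_def)
    define D where "D = restrict (r \<circ> secM) cB"
    have D: "lin MB M D" by (rule lin_cong[OF lin_comp[OF rl secM_lin]]) (simp add: D_def)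
    have r_eq: "r x = D (piM x) \<oplus>\<^bsub>M\<^esub> kapM x" if x: "x \<in> cA" for x
    proof -
      have s: "secM (piM x) \<in> carrier MA" using secM_closed piM_closed x by simp
      have "x = secM (piM x) \<oplus>\<^bsub>MA\<^esub> unitM (kapM x)" using decomposition[OF x] by (simp add: MA_ops)
      then have "r x = r (secM (piM x) \<oplus>\<^bsub>MA\<^esub> unitM (kapM x))" by simp
      also have "\<dots> = r (secM (piM x)) \<oplus>\<^bsub>M\<^esub> r (unitM (kapM x))"
        by (rule lin_add[OF rl s lin_closed[OF unitM_lin k[OF x]]])
      finally show ?thesis using act k[OF x] piM_closed[OF x] by (simp add: D_def right_action_iff)
    qed
    have "flat_connection K C B lam1 lam2 M D" by (rule action_imp_flat[OF D r_eq act])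
    moreover have "D \<in> extensional cB" by (simp add: D_def)
    ultimately have Dm: "D \<in> {D \<in> extensional cB. flat_connection K C B lam1 lam2 M D}" by blast
    have rD: "r = ?\<Phi> D" using ext r_eq by (intro extensionalityI[of _ cA]) auto
    show "r \<in> ?\<Phi> ` {D \<in> extensional cB. flat_connection K C B lam1 lam2 M D}"
      by (rule image_eqI[where x = D and f = ?\<Phi>, OF rD Dm])
  qed
qed

end

theorem theorem15:
  fixes K :: "'k ring" and C :: "('k, 'c) coalg" and A :: "('k, 'a, 'c) C_ring_data"
    and M :: "('k, 'm, 'c) rcomod" and \<kappa> :: "'a \<Rightarrow> 'k"
    and lam1 :: "'a set \<Rightarrow> 'c" and lam2 :: "('a set \<times> 'a set \<Rightarrow> 'k) set \<Rightarrow> 'a set"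
  defines "B \<equiv> coker_bicomod K C A" and "\<pi> \<equiv> coker_proj C A" and "k \<equiv> self_module K"
  assumes "field K"
    and "coalgebra K C"
    and "C_ring K C A"
    and "character K C A \<kappa>"
    and "linear_map K B C lam1"
    and "\<And>a. a \<in> carrier A \<Longrightarrow>
      lam1 (\<pi> a) = left_unit K C (tensor_map K k C \<kappa> id (rcoact A a))
        \<ominus>\<^bsub>C\<^esub> right_unit K C (tensor_map K C k id \<kappa> (lcoact A a))"
    and "linear_map K (cotensor K C B B) B lam2"
    and "\<And>t. t \<in> carrier (cotensor K C A A) \<Longrightarrow>
      lam2 (tensor_map K B B \<pi> \<pi> t) = left_unit K B (tensor_map K k B \<kappa> \<pi> t)
        \<ominus>\<^bsub>B\<^esub> \<pi> (mu A t) \<oplus>\<^bsub>B\<^esub> right_unit K B (tensor_map K B k \<pi> \<kappa> t)"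
    and "right_comodule K C M"
  shows "bij_betw
    (\<lambda>D. \<lambda>t\<in>carrier (cotensor K C M A).
       D (tensor_map K M B id \<pi> t) \<oplus>\<^bsub>M\<^esub> right_unit K M (tensor_map K M k id \<kappa> t))
    {D \<in> extensional (carrier (cotensor K C M B)). flat_connection K C B lam1 lam2 M D}
    {r \<in> extensional (carrier (cotensor K C M A)). right_action K C A M r}"
proof -
  interpret ground_field K by (rule ground_field.intro) fact
  interpret character_setting K C A \<kappa> lam1 lam2 M
    by (intro character_setting.intro coalgebra_over_field.intro character_setting_axioms.intro)
      (rule ground_field_axioms assms(4-)[unfolded B_def \<pi>_def k_def] | assumption)+
  show ?thesis
    using correspondence[unfolded piM_def kapM_def slR_def] unfolding B_def \<pi>_def k_def .
qed

end
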